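(* Let $(M,g)$ be a two-dimensional oriented Riemannian manifold and let $E(M)$ be the sc-manifold of unparametrized embedded loops in $M$. Then the length functional $$L:E(M)\to\mathbb R,\qquad L([v])=\int_{S^1}\|v'(t)\|_g\,dt,$$ is sc-smooth.
   Context: $S^1=\mathbb R/\mathbb Z$. For $k\ge2$, $\mathcal E^k(M)$ is the set of $v\in W^{k,2}(S^1,M)$ that are embeddings (a $k$-times weakly differentiable diffeomorphism onto the image), an open subset of $W^{k,2}(S^1,M)$. $\mathcal D^k$ is the group of $k$-times weakly differentiable ($W^{k,2}$) diffeomorphisms $\psi:S^1\to S^1$, acting freely on $\mathcal E^k(M)$ by $(v,\psi)\mapsto v\circ\psi$, and $E^k(M):=\mathcal E^k(M)/\mathcal D^k$. $L$ is invariant under reparametrization. $E(M):=E^2(M)$ is an sc-manifold with levels $E(M)_k=E^{k+2}(M)$, $k\in\mathbb N_0$. Charts: for a loop $u$ choose a parametrization $u:S^1\to M$ and an extension of $u=\sigma(\cdot,0)$ to a local diffeomorphism $\sigma:S^1\times(-\epsilon,\epsilon)\to M$ (of class $W^{k,2}$ for $u\in E^k(M)$); for small $\tau\in W^{k,2}(S^1,\mathbb R)$ with $\sup|\tau|<\epsilon$, the chart sends $\tau$ to the class of $t\mapsto\sigma(t,\tau(t))$. The model sc-Banach space is $W^{2,2}(S^1,\mathbb R)$ with levels $W^{k+2,2}(S^1,\mathbb R)$. An sc-structure on a Banach space $F$ is a nested sequence $F=F_0\supset F_1\supset\cdots$ of Banach spaces with compact inclusions $F_n\hookrightarrow F_m$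 ($n>m$) and $\bigcap_nF_n$ dense in each $F_m$. $\mathbb R$ has the constant sc-structure. A map $f:U\to H$ from an open subset $U\subset F$ (with $U_m=U\cap F_m$) is $sc^0$ if $f:U_m\to H_m$ is well-defined and continuous for every $m$. It is $sc^1$ if it is $sc^0$, for every $x\in U_1$ there is a bounded linear $Df(x):F_0\to H_0$ with $\|f(x+h)-f(x)-Df(x)h\|_{H_0}/\|h\|_{F_1}\to0$ as $\|h\|_{F_1}\to 0$, $h\in F_1$, and the tangent map $Tf:U_1\oplus F_0\to H_1\oplus H_0$, $(x,h)\mapsto(f(x),Df(x)h)$ is $sc^0$ (level $m$ of $U_1\oplus F_0$ being $U_{m+1}\oplus F_m$). Inductively $f$ is $sc^{k}$ if $Tf$ is $sc^{k-1}$; sc-smooth means $sc^k$ for all $k$. On sc-manifolds these notions are tested in charts. *)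

theory Defs
  imports "HOL-Analysis.Analysis"
begin

section \<open>Smooth maps between open subsets of Euclidean spaces\<close>

text \<open>Meant for open \<open>S\<close>; derivatives are Frechet derivatives, tested in all directions.\<close>

fun Ck_on :: "nat \<Rightarrow> ('a::euclidean_space \<Rightarrow> 'b::real_normed_vector) \<Rightarrow> 'a set \<Rightarrow> bool" where
  "Ck_on 0 f S \<longleftrightarrow> continuous_on S f"
| "Ck_on (Suc n) f S \<longleftrightarrow>
     (\<exists>f'. (\<forall>x\<in>S. (f has_derivative f' x) (at x)) \<and> (\<forall>v. Ck_on n (\<lambda>x. f' x v) S))"

definition smooth_on :: "('a::euclidean_space \<Rightarrow> 'b::real_normed_vector) \<Rightarrow> 'a set \<Rightarrow> bool" where
  "smooth_on f S \<longleftrightarrow> (\<forall>n. Ck_on n f S)"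

definition diffeo_between ::
    "'a::euclidean_space set \<Rightarrow> 'b::euclidean_space set \<Rightarrow> ('a \<Rightarrow> 'b) \<Rightarrow> ('b \<Rightarrow> 'a) \<Rightarrow> bool" where
  "diffeo_between S T f f' \<longleftrightarrow>
     open S \<and> open T \<and> homeomorphism S T f f' \<and> smooth_on f S \<and> smooth_on f' T"


section \<open>Oriented Riemannian surfaces\<close>

text \<open>The manifold is the whole type \<open>'m\<close>; a chart is a pair of an open domain and a coordinate map.
  A Riemannian metric is given by its Gram matrix in each chart, as a function of the coordinates,
  together with the tensor transformation law.\<close>

type_synonym 'm chart = "'m set \<times> ('m \<Rightarrow> real^2)"

abbreviation chart_dom :: "'m chart \<Rightarrow> 'm set" where "chart_dom \<equiv> fst"
abbreviation coords :: "'m chart \<Rightarrow> 'm \<Rightarrow> real^2" where "coords \<equiv> snd"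

definition transition :: "'m chart \<Rightarrow> 'm chart \<Rightarrow> real^2 \<Rightarrow> real^2" where
  "transition c d = coords d \<circ> inv_into (chart_dom c) (coords c)"

definition overlap :: "'m chart \<Rightarrow> 'm chart \<Rightarrow> (real^2) set" where
  "overlap c d = coords c ` (chart_dom c \<inter> chart_dom d)"

definition jacobian :: "(real^2 \<Rightarrow> real^2) \<Rightarrow> real^2 \<Rightarrow> real^2^2" where
  "jacobian f x = matrix (frechet_derivative f (at x))"

locale oriented_surface =
  fixes \<A> :: "'m::{t2_space, second_countable_topology} chart set"
  assumes charts_cover: "(\<Union>c\<in>\<A>. chart_dom c) = UNIV"
    and chart_dom_open: "c \<in> \<A> \<Longrightarrow> open (chart_dom c)"
    and chart_image_open: "c \<in> \<A> \<Longrightarrow> open (coords c ` chart_dom c)"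
    and chart_homeomorphism:
      "c \<in> \<A> \<Longrightarrow> homeomorphism (chart_dom c) (coords c ` chart_dom c) (coords c)
                    (inv_into (chart_dom c) (coords c))"
    and transition_smooth:
      "c \<in> \<A> \<Longrightarrow> d \<in> \<A> \<Longrightarrow> smooth_on (transition c d) (overlap c d)"
    and transition_oriented:
      "c \<in> \<A> \<Longrightarrow> d \<in> \<A> \<Longrightarrow> x \<in> overlap c d \<Longrightarrow> det (jacobian (transition c d) x) > 0"

locale oriented_riemannian_surface = oriented_surface \<A>
  for \<A> :: "'m::{t2_space, second_countable_topology} chart set" +
  fixes g :: "'m chart \<Rightarrow> real^2 \<Rightarrow> real^2^2"
  assumes metric_smooth: "c \<in> \<A> \<Longrightarrow> smooth_on (g c) (coords c ` chart_dom c)"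
    and metric_symmetric:
      "c \<in> \<A> \<Longrightarrow> x \<in> coords c ` chart_dom c \<Longrightarrow> transpose (g c x) = g c x"
    and metric_positive:
      "c \<in> \<A> \<Longrightarrow> x \<in> coords c ` chart_dom c \<Longrightarrow> \<xi> \<noteq> 0 \<Longrightarrow> \<xi> \<bullet> (g c x *v \<xi>) > 0"
    and metric_transform:
      "c \<in> \<A> \<Longrightarrow> d \<in> \<A> \<Longrightarrow> x \<in> overlap c d \<Longrightarrow>
         g c x = transpose (jacobian (transition c d) x) ** g d (transition c d x)
                   ** jacobian (transition c d) x"


section \<open>Sobolev spaces in one variable\<close>

definition L2_on :: "real set \<Rightarrow> (real \<Rightarrow> 'b::euclidean_space) set" where
  "L2_on S = {f. f \<in> borel_measurable (lebesgue_on S) \<and>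
                 integrable (lebesgue_on S) (\<lambda>x. (norm (f x))\<^sup>2)}"

text \<open>Test functions are the compactly supported functions of class \<open>C\<^sup>1\<close>; for first-order weak
  derivatives this is equivalent to testing with smooth functions, and higher weak derivatives
  are obtained by iteration.\<close>

definition weak_derivative_on ::
    "real set \<Rightarrow> (real \<Rightarrow> 'b::euclidean_space) \<Rightarrow> (real \<Rightarrow> 'b) \<Rightarrow> bool" where
  "weak_derivative_on S f f' \<longleftrightarrow>
     (\<forall>\<phi> \<phi>' K.
        (\<forall>x. (\<phi> has_real_derivative \<phi>' x) (at x)) \<and> continuous_on UNIV \<phi>' \<and>
        compact K \<and> K \<subseteq> S \<and> (\<forall>x. x \<notin> K \<longrightarrow> \<phi> x = 0) \<longrightarrow>
        (LINT x|lebesgue_on S. \<phi>' x *\<^sub>R f x) = - (LINT x|lebesgue_on S. \<phi> x *\<^sub>R f' x))"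

definition weak_derivatives_on ::
    "nat \<Rightarrow> real set \<Rightarrow> (real \<Rightarrow> 'b::euclidean_space) \<Rightarrow> (nat \<Rightarrow> real \<Rightarrow> 'b) \<Rightarrow> bool" where
  "weak_derivatives_on k S f D \<longleftrightarrow>
     D 0 = f \<and> (\<forall>j\<le>k. D j \<in> L2_on S) \<and> (\<forall>j<k. weak_derivative_on S (D j) (D (Suc j)))"

definition sobolev :: "nat \<Rightarrow> real set \<Rightarrow> (real \<Rightarrow> 'b::euclidean_space) set" where
  "sobolev k S = {f. \<exists>D. weak_derivatives_on k S f D}"

text \<open>The choice of the weak derivatives is immaterial, as they are unique almost everywhere.\<close>

definition sobolev_norm :: "nat \<Rightarrow> real set \<Rightarrow> (real \<Rightarrow> 'b::euclidean_space) \<Rightarrow> real" where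
  "sobolev_norm k S f =
     (let D = (SOME D. weak_derivatives_on k S f D)
      in sqrt (\<Sum>j\<le>k. LINT x|lebesgue_on S. (norm (D j x))\<^sup>2))"

definition sobolev_loc :: "nat \<Rightarrow> (real \<Rightarrow> 'b::euclidean_space) set" where
  "sobolev_loc k = {f. \<forall>a b. a < b \<longrightarrow> f \<in> sobolev k {a<..<b}}"

text \<open>Functions on the circle \<open>\<real>/\<int>\<close> are 1-periodic functions on the line. An element of
  \<open>W\<^sup>k\<^sup>,\<^sup>2\<close> with \<open>k \<ge> 1\<close> is represented by its unique continuous representative.\<close>

definition W_circle :: "nat \<Rightarrow> (real \<Rightarrow> real) set" where
  "W_circle k = {\<tau>. continuous_on UNIV \<tau> \<and> (\<forall>t. \<tau> (t + 1) = \<tau> t) \<and> \<tau> \<in> sobolev_loc k}"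

definition W_circle_norm :: "nat \<Rightarrow> (real \<Rightarrow> real) \<Rightarrow> real" where
  "W_circle_norm k \<tau> = sobolev_norm k {0<..<1} \<tau>"


section \<open>Embedded loops modulo reparametrization\<close>

definition W_loops :: "'m::topological_space chart set \<Rightarrow> nat \<Rightarrow> (real \<Rightarrow> 'm) set" where
  "W_loops \<A> k =
     {v. continuous_on UNIV v \<and> (\<forall>t. v (t + 1) = v t) \<and>
         (\<forall>c\<in>\<A>. \<forall>a b. a < b \<and> v ` {a..b} \<subseteq> chart_dom c \<longrightarrow> coords c \<circ> v \<in> sobolev k {a<..<b})}"

text \<open>Injective immersed loops; as the circle is compact, these are homeomorphisms onto their
  images. For \<open>k \<ge> 2\<close> elements of \<open>W_loops \<A> k\<close> are of class \<open>C\<^sup>1\<close>.\<close>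

definition emb_loops :: "'m::topological_space chart set \<Rightarrow> nat \<Rightarrow> (real \<Rightarrow> 'm) set" where
  "emb_loops \<A> k =
     {v \<in> W_loops \<A> k.
        (\<forall>s t. v s = v t \<longrightarrow> s - t \<in> \<int>) \<and>
        (\<forall>t. \<forall>c\<in>\<A>. v t \<in> chart_dom c \<longrightarrow>
           (\<exists>\<xi>. \<xi> \<noteq> 0 \<and> ((coords c \<circ> v) has_vector_derivative \<xi>) (at t)))}"

text \<open>Diffeomorphisms of the circle are represented by their lifts to the line; both orientation
  preserving and orientation reversing ones are admitted.\<close>

definition circle_diffeos :: "nat \<Rightarrow> (real \<Rightarrow> real) set" where
  "circle_diffeos k =
     {\<psi>. bij \<psi> \<and> continuous_on UNIV \<psi> \<and>
         ((\<forall>t. \<psi> (t + 1) = \<psi> t + 1) \<or> (\<forall>t. \<psi> (t + 1) = \<psi> t - 1)) \<and>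
         \<psi> \<in> sobolev_loc k \<and> inv \<psi> \<in> sobolev_loc k}"

definition reparam_rel ::
    "'m::topological_space chart set \<Rightarrow> nat \<Rightarrow> ((real \<Rightarrow> 'm) \<times> (real \<Rightarrow> 'm)) set" where
  "reparam_rel \<A> k =
     {(v, w). v \<in> emb_loops \<A> k \<and> w \<in> emb_loops \<A> k \<and> (\<exists>\<psi>\<in>circle_diffeos k. w = v \<circ> \<psi>)}"

definition unparam_loops :: "'m::topological_space chart set \<Rightarrow> nat \<Rightarrow> (real \<Rightarrow> 'm) set set" where
  "unparam_loops \<A> k = emb_loops \<A> k // reparam_rel \<A> k"


section \<open>The length functional\<close>

definition speed ::
    "'m chart set \<Rightarrow> ('m chart \<Rightarrow> real^2 \<Rightarrow> real^2^2) \<Rightarrow> (real \<Rightarrow> 'm) \<Rightarrow> real \<Rightarrow> real" where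
  "speed \<A> g v t =
     (let c = (SOME c. c \<in> \<A> \<and> v t \<in> chart_dom c);
          \<xi> = vector_derivative (coords c \<circ> v) (at t)
      in sqrt (\<xi> \<bullet> (g c (coords c (v t)) *v \<xi>)))"

definition loop_length ::
    "'m chart set \<Rightarrow> ('m chart \<Rightarrow> real^2 \<Rightarrow> real^2^2) \<Rightarrow> (real \<Rightarrow> 'm) \<Rightarrow> real" where
  "loop_length \<A> g v = integral {0..1} (speed \<A> g v)"

text \<open>The common length of all parametrizations in a reparametrization class.\<close>

definition length_functional ::
    "'m chart set \<Rightarrow> ('m chart \<Rightarrow> real^2 \<Rightarrow> real^2^2) \<Rightarrow> (real \<Rightarrow> 'm) set \<Rightarrow> real" where
  "length_functional \<A> g e = the_elem (loop_length \<A> g ` e)"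


section \<open>Sc-smooth maps\<close>

text \<open>The iterated tangent \<open>T (T (... F))\<close> of a space with elements in \<open>'a\<close> lives in one type:
  elements of \<open>F\<close> are \<open>Pt x\<close>, and pairs \<open>(x, h)\<close> are \<open>Tan x h\<close>. This is what allows
  \<open>sc\<^sup>k\<close> to be defined by recursion on \<open>k\<close>.\<close>

datatype 'a tower = Pt (pt: 'a) | Tan (base: "'a tower") (dir: "'a tower")

text \<open>The data of an sc-space: levels, the norm of each level, and the vector operations.
  The vector operations are only relevant on level 0. The sc-Banach axioms (completeness, compact
  inclusions, density) are properties of such data; the definition of sc-smooth maps uses only
  the data.\<close>

record 'a sc_space =
  level :: "nat \<Rightarrow> 'a set"
  lnorm :: "nat \<Rightarrow> 'a \<Rightarrow> real"
  vadd :: "'a \<Rightarrow> 'a \<Rightarrow> 'a"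
  vscale :: "real \<Rightarrow> 'a \<Rightarrow> 'a"

definition vdiff :: "'a sc_space \<Rightarrow> 'a \<Rightarrow> 'a \<Rightarrow> 'a" where
  "vdiff E x y = vadd E x (vscale E (- 1) y)"

definition sc_open :: "'a sc_space \<Rightarrow> 'a set \<Rightarrow> bool" where
  "sc_open E U \<longleftrightarrow>
     U \<subseteq> level E 0 \<and>
     (\<forall>x\<in>U. \<exists>\<delta>>0. \<forall>y\<in>level E 0. lnorm E 0 (vdiff E y x) < \<delta> \<longrightarrow> y \<in> U)"

definition tangent_space :: "'a tower sc_space \<Rightarrow> 'a tower sc_space" where
  "tangent_space E =
     \<lparr>level = \<lambda>m. {Tan x h |x h. x \<in> level E (Suc m) \<and> h \<in> level E m},
      lnorm = \<lambda>m z. lnorm E (Suc m) (base z) + lnorm E m (dir z),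
      vadd = \<lambda>z w. Tan (vadd E (base z) (base w)) (vadd E (dir z) (dir w)),
      vscale = \<lambda>r z. Tan (vscale E r (base z)) (vscale E r (dir z))\<rparr>"

definition tangent_dom :: "'a tower sc_space \<Rightarrow> 'a tower set \<Rightarrow> 'a tower set" where
  "tangent_dom E U = {Tan x h |x h. x \<in> U \<inter> level E 1 \<and> h \<in> level E 0}"

definition tangent_map ::
    "('a tower \<Rightarrow> 'b tower) \<Rightarrow> ('a tower \<Rightarrow> 'a tower \<Rightarrow> 'b tower) \<Rightarrow> 'a tower \<Rightarrow> 'b tower" where
  "tangent_map f Df z = Tan (f (base z)) (Df (base z) (dir z))"

definition sc0_on :: "'a sc_space \<Rightarrow> 'b sc_space \<Rightarrow> 'a set \<Rightarrow> ('a \<Rightarrow> 'b) \<Rightarrow> bool" where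
  "sc0_on E H U f \<longleftrightarrow>
     (\<forall>m. \<forall>x\<in>U \<inter> level E m. f x \<in> level H m \<and>
        (\<forall>\<epsilon>>0. \<exists>\<delta>>0. \<forall>y\<in>U \<inter> level E m.
           lnorm E m (vdiff E y x) < \<delta> \<longrightarrow> lnorm H m (vdiff H (f y) (f x)) < \<epsilon>))"

definition bounded_linear_level0 :: "'a sc_space \<Rightarrow> 'b sc_space \<Rightarrow> ('a \<Rightarrow> 'b) \<Rightarrow> bool" where
  "bounded_linear_level0 E H A \<longleftrightarrow>
     (\<forall>x\<in>level E 0. A x \<in> level H 0) \<and>
     (\<forall>x\<in>level E 0. \<forall>y\<in>level E 0. A (vadd E x y) = vadd H (A x) (A y)) \<and>
     (\<forall>r. \<forall>x\<in>level E 0. A (vscale E r x) = vscale H r (A x)) \<and>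
     (\<exists>C. \<forall>x\<in>level E 0. lnorm H 0 (A x) \<le> C * lnorm E 0 x)"

definition has_sc_derivative ::
    "'a sc_space \<Rightarrow> 'b sc_space \<Rightarrow> 'a set \<Rightarrow> ('a \<Rightarrow> 'b) \<Rightarrow> 'a \<Rightarrow> ('a \<Rightarrow> 'b) \<Rightarrow> bool" where
  "has_sc_derivative E H U f x A \<longleftrightarrow>
     bounded_linear_level0 E H A \<and>
     (\<forall>\<epsilon>>0. \<exists>\<delta>>0. \<forall>h\<in>level E 1. lnorm E 1 h < \<delta> \<and> vadd E x h \<in> U \<longrightarrow>
        lnorm H 0 (vdiff H (vdiff H (f (vadd E x h)) (f x)) (A h)) \<le> \<epsilon> * lnorm E 1 h)"

fun sc_on ::
    "nat \<Rightarrow> 'a tower sc_space \<Rightarrow> 'b tower sc_space \<Rightarrow> 'a tower set \<Rightarrow> ('a tower \<Rightarrow> 'b tower) \<Rightarrow> bool" where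
  "sc_on 0 E H U f \<longleftrightarrow> sc0_on E H U f"
| "sc_on (Suc k) E H U f \<longleftrightarrow>
     sc0_on E H U f \<and>
     (\<exists>Df. (\<forall>x\<in>U \<inter> level E 1. has_sc_derivative E H U f x (Df x)) \<and>
           sc_on k (tangent_space E) (tangent_space H) (tangent_dom E U) (tangent_map f Df))"

definition sc_smooth_on ::
    "'a tower sc_space \<Rightarrow> 'b tower sc_space \<Rightarrow> 'a tower set \<Rightarrow> ('a tower \<Rightarrow> 'b tower) \<Rightarrow> bool" where
  "sc_smooth_on E H U f \<longleftrightarrow> (\<forall>k. sc_on k E H U f)"

definition model_space :: "(real \<Rightarrow> real) tower sc_space" where
  "model_space =
     \<lparr>level = \<lambda>m. Pt ` W_circle (m + 2),
      lnorm = \<lambda>m z. W_circle_norm (m + 2) (pt z),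
      vadd = \<lambda>z w. Pt (\<lambda>t. pt z t + pt w t),
      vscale = \<lambda>r z. Pt (\<lambda>t. r * pt z t)\<rparr>"

definition real_space :: "real tower sc_space" where
  "real_space =
     \<lparr>level = \<lambda>m. range Pt,
      lnorm = \<lambda>m z. \<bar>pt z\<bar>,
      vadd = \<lambda>z w. Pt (pt z + pt w),
      vscale = \<lambda>r z. Pt (r * pt z)\<rparr>"


section \<open>Sc-charts of the space of unparametrized embedded loops\<close>

definition local_diffeo_into ::
    "'m::topological_space chart set \<Rightarrow> (real \<times> real) set \<Rightarrow> (real \<times> real \<Rightarrow> 'm) \<Rightarrow> bool" where
  "local_diffeo_into \<A> D \<sigma> \<longleftrightarrow>
     (\<forall>z\<in>D. \<exists>c\<in>\<A>. \<exists>N V \<rho>. z \<in> N \<and> N \<subseteq> D \<and> \<sigma> ` N \<subseteq> chart_dom c \<and>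
        diffeo_between N V (coords c \<circ> \<sigma>) \<rho>)"

definition chart_curve :: "(real \<times> real \<Rightarrow> 'm) \<Rightarrow> (real \<Rightarrow> real) \<Rightarrow> real \<Rightarrow> 'm" where
  "chart_curve \<sigma> \<tau> = (\<lambda>t. \<sigma> (t, \<tau> t))"

definition chart_map ::
    "'m::topological_space chart set \<Rightarrow> (real \<times> real \<Rightarrow> 'm) \<Rightarrow> (real \<Rightarrow> real) \<Rightarrow> (real \<Rightarrow> 'm) set" where
  "chart_map \<A> \<sigma> \<tau> = reparam_rel \<A> 2 `` {chart_curve \<sigma> \<tau>}"

text \<open>An sc-chart centred at the loop \<open>t \<mapsto> \<sigma> (t, 0)\<close>. For \<open>\<tau>\<close> on level \<open>m\<close> to correspond to loops
  of class \<open>W\<^sup>m\<^sup>+\<^sup>2\<^sup>,\<^sup>2\<close> for every \<open>m\<close>, \<open>\<sigma>\<close> has to be smooth; thus the centre is a smooth loop, and the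
  other loops are covered by charts centred at nearby smooth ones. The open set \<open>U\<close> makes precise
  for which \<open>small\<close> \<open>\<tau>\<close> the chart is defined.\<close>

definition sc_chart ::
    "'m::topological_space chart set \<Rightarrow> (real \<times> real \<Rightarrow> 'm) \<Rightarrow> real \<Rightarrow> (real \<Rightarrow> real) set \<Rightarrow> bool" where
  "sc_chart \<A> \<sigma> \<epsilon> U \<longleftrightarrow>
     \<epsilon> > 0 \<and>
     (\<forall>t s. \<bar>s\<bar> < \<epsilon> \<longrightarrow> \<sigma> (t + 1, s) = \<sigma> (t, s)) \<and>
     local_diffeo_into \<A> (UNIV \<times> {-\<epsilon><..<\<epsilon>}) \<sigma> \<and>
     sc_open model_space (Pt ` U) \<and> (\<lambda>t. 0) \<in> U \<and>
     (\<forall>\<tau>\<in>U. (SUP t. \<bar>\<tau> t\<bar>) < \<epsilon> \<and> chart_curve \<sigma> \<tau> \<in> emb_loops \<A> 2) \<and>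
     inj_on (chart_map \<A> \<sigma>) U \<and> chart_map \<A> \<sigma> ` U \<subseteq> unparam_loops \<A> 2"

definition sc_smooth_on_loops ::
    "'m::topological_space chart set \<Rightarrow> ((real \<Rightarrow> 'm) set \<Rightarrow> real) \<Rightarrow> bool" where
  "sc_smooth_on_loops \<A> f \<longleftrightarrow>
     (\<forall>\<sigma> \<epsilon> U. sc_chart \<A> \<sigma> \<epsilon> U \<longrightarrow>
        sc_smooth_on model_space real_space (Pt ` U) (\<lambda>z. Pt (f (chart_map \<A> \<sigma> (pt z)))))"

end

theory Submission
  imports Defs
begin

text \<open>
  In a chart around \<open>t \<mapsto> \<sigma> (t, 0)\<close> the length functional is
  \<open>L \<tau> = \<integral> F (t, \<tau> t, \<tau>' t) dt\<close> over one period, where \<open>F (t, a, b)\<close> is the Riemannian length of the image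
  of \<open>(1, b)\<close> under the differential of \<open>\<sigma>\<close> at \<open>(t, a)\<close>. This uses that the length does not depend on the
  representative of a class (\<open>loop_length_reparametrization\<close>). As \<open>\<sigma>\<close> is a local diffeomorphism and
  \<open>(1, b) \<noteq> 0\<close>, the density \<open>F\<close> is positive, and therefore smooth in spite of the square root
  (\<open>length_density_smooth\<close>).

  A functional of this form is smooth in the classical sense on an open subset of \<open>C\<^sup>1\<close>, and \<open>W\<^sup>2\<^sup>,\<^sup>2\<close>
  embeds in \<open>C\<^sup>1\<close>. As the target \<open>\<real>\<close> has the constant sc-structure, this implies
  sc-smoothness: the norm of each level dominates the \<open>C\<^sup>1\<close> norm (\<open>c1size_le_lnorm\<close>), so continuity and
  differentiability with respect to the \<open>C\<^sup>1\<close> norm imply those required on every level.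

  To follow the recursion over iterated tangent maps, one exhibits a class of maps that contains \<open>L\<close>
  and is closed under forming the tangent map. The components of the iterated tangent maps of \<open>L\<close> are
  integrals of polynomials in the tangent directions and their derivatives, whose coefficients are
  smooth functions of \<open>(t, \<tau> t, \<tau>' t)\<close>. Such integrands are differentiable with respect to the supremum
  norm, with derivatives of the same form (\<open>nemytskii_derivative\<close>); integration then gives
  \<open>integral_map_sc_on\<close>.

  The embedding of \<open>W\<^sup>2\<^sup>,\<^sup>2\<close> in \<open>C\<^sup>1\<close> has to be derived from the definition by weak derivatives. The main
  point is that a continuous function differs from the second primitive of its second weak
  derivative by an affine function (\<open>weak_second_derivative_imp_affine\<close>).
\<close>


section \<open>Calculus of maps of class \<open>C\<^sup>k\<close>\<close>

lemma Ck_on_SucE: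
  assumes "Ck_on (Suc n) f S"
  obtains f' where "\<And>x. x \<in> S \<Longrightarrow> (f has_derivative f' x) (at x)"
    "\<And>v. Ck_on n (\<lambda>x. f' x v) S"
  using assms by auto

lemma Ck_on_SucI:
  assumes "\<And>x. x \<in> S \<Longrightarrow> (f has_derivative f' x) (at x)"
    "\<And>v. Ck_on n (\<lambda>x. f' x v) S"
  shows "Ck_on (Suc n) f S"
  using assms by auto

lemma Ck_on_imp_continuous_on: "Ck_on n f S \<Longrightarrow> continuous_on S f"
  by (cases n) (auto intro!: continuous_at_imp_continuous_on dest: has_derivative_continuous)

lemma Ck_on_cong:
  assumes "open S" "\<And>x. x \<in> S \<Longrightarrow> f x = g x" "Ck_on n f S"
  shows "Ck_on n g S"
proof (cases n)
  case 0
  then show ?thesis using assms by (simp cong: continuous_on_cong)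
next
  case (Suc m)
  with assms(3) obtain f' where f': "\<And>x. x \<in> S \<Longrightarrow> (f has_derivative f' x) (at x)"
    "\<And>v. Ck_on m (\<lambda>x. f' x v) S" by auto
  have "(g has_derivative f' x) (at x)" if "x \<in> S" for x
    using has_derivative_transform_within_open[OF f'(1)[OF that] assms(1) that assms(2)] by blast
  with f'(2) Suc show ?thesis by auto
qed

text \<open>On an open set the derivative is unique, so one and the same derivative serves for every order of
  differentiability. This makes \<open>C\<^sup>k\<close> a local property and keeps derivatives of smooth maps smooth.\<close>

lemma Ck_on_Suc_iff:
  assumes "open S"
  shows "Ck_on (Suc n) f S \<longleftrightarrow>
    (\<forall>x\<in>S. f differentiable at x) \<and> (\<forall>v. Ck_on n (\<lambda>x. frechet_derivative f (at x) v) S)"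
proof
  assume "Ck_on (Suc n) f S"
  then obtain f' where f': "\<And>x. x \<in> S \<Longrightarrow> (f has_derivative f' x) (at x)"
    "\<And>v. Ck_on n (\<lambda>x. f' x v) S" by auto
  have "f' x = frechet_derivative f (at x)" if "x \<in> S" for x
    using f'(1)[OF that] frechet_derivative_at by blast
  then show "(\<forall>x\<in>S. f differentiable at x) \<and> (\<forall>v. Ck_on n (\<lambda>x. frechet_derivative f (at x) v) S)"
    using f' Ck_on_cong[OF assms _ f'(2)] by (auto simp: differentiable_def)
next
  assume "(\<forall>x\<in>S. f differentiable at x) \<and> (\<forall>v. Ck_on n (\<lambda>x. frechet_derivative f (at x) v) S)"
  then show "Ck_on (Suc n) f S"
    by (auto simp: frechet_derivative_works intro!: exI[of _ "\<lambda>x. frechet_derivative f (at x)"])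
qed

lemma Ck_on_pred: "Ck_on (Suc n) f S \<Longrightarrow> Ck_on n f S"
proof (induction n arbitrary: f)
  case 0
  then show ?case using Ck_on_imp_continuous_on by (metis Ck_on.simps(1))
next
  case (Suc n)
  then obtain f' where f': "\<And>x. x \<in> S \<Longrightarrow> (f has_derivative f' x) (at x)"
    "\<And>v. Ck_on (Suc n) (\<lambda>x. f' x v) S" by (subst (asm) (2) Ck_on.simps) blast
  with Suc.IH have "\<And>v. Ck_on n (\<lambda>x. f' x v) S" by blast
  with f'(1) show ?case by auto
qed

lemma Ck_on_local:
  assumes "open S" "\<And>x. x \<in> S \<Longrightarrow> \<exists>N. open N \<and> x \<in> N \<and> Ck_on n f N"
  shows "Ck_on n f S"
  using assms(2)
proof (induction n arbitrary: f)
  case 0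
  show ?case unfolding Ck_on.simps
  proof (rule continuous_at_imp_continuous_on, rule ballI)
    fix x assume "x \<in> S"
    with 0 show "isCont f x"
      by (metis Ck_on.simps(1) continuous_on_eq_continuous_at)
  qed
next
  case (Suc n)
  have *: "\<exists>N. open N \<and> x \<in> N \<and> f differentiable at x \<and> (\<forall>v. Ck_on n (\<lambda>x. frechet_derivative f (at x) v) N)"
    if "x \<in> S" for x
    using Suc.prems[OF that] Ck_on_Suc_iff by metis
  show ?case unfolding Ck_on_Suc_iff[OF assms(1)]
    using * Suc.IH by (metis (no_types, lifting))
qed

lemma Ck_on_const: "Ck_on n (\<lambda>x. c) S"
proof (induction n arbitrary: c)
  case (Suc n)
  then show ?case by (auto intro!: exI[of _ "\<lambda>x v. 0"])
qed auto

lemma Ck_on_bounded_linear: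
  assumes "bounded_linear f" shows "Ck_on n f S"
proof (cases n)
  case 0
  then show ?thesis using assms linear_continuous_on by auto
next
  case (Suc m)
  then show ?thesis
    using assms bounded_linear_imp_has_derivative[OF assms] Ck_on_const by (auto intro!: exI[of _ "\<lambda>x. f"])
qed

lemma Ck_on_add: "Ck_on n f S \<Longrightarrow> Ck_on n g S \<Longrightarrow> Ck_on n (\<lambda>x. f x + g x) S"
proof (induction n arbitrary: f g)
  case 0
  then show ?case by (auto intro: continuous_intros)
next
  case (Suc n)
  obtain f' where f': "\<And>x. x \<in> S \<Longrightarrow> (f has_derivative f' x) (at x)"
    "\<And>v. Ck_on n (\<lambda>x. f' x v) S" using Ck_on_SucE[OF Suc.prems(1)] by blast
  obtain g' where g': "\<And>x. x \<in> S \<Longrightarrow> (g has_derivative g' x) (at x)"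
    "\<And>v. Ck_on n (\<lambda>x. g' x v) S" using Ck_on_SucE[OF Suc.prems(2)] by blast
  show ?case
    by (rule Ck_on_SucI[OF has_derivative_add[OF f'(1) g'(1)] Suc.IH[OF f'(2) g'(2)]])
qed

lemma Ck_on_sum: "finite I \<Longrightarrow> (\<And>i. i \<in> I \<Longrightarrow> Ck_on n (f i) S) \<Longrightarrow> Ck_on n (\<lambda>x. \<Sum>i\<in>I. f i x) S"
  by (induction I rule: finite_induct) (auto intro: Ck_on_const Ck_on_add)

text \<open>The product rule expresses the derivative as a sum of two products of the same kind, so the
  induction on the order closes up.\<close>

lemma Ck_on_bilinear:
  assumes "bounded_bilinear B"
  shows "Ck_on n f S \<Longrightarrow> Ck_on n g S \<Longrightarrow> Ck_on n (\<lambda>x. B (f x) (g x)) S"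
proof (induction n arbitrary: f g)
  case 0
  then show ?case using bounded_bilinear.continuous_on[OF assms] by auto
next
  case (Suc n)
  obtain f' where f': "\<And>x. x \<in> S \<Longrightarrow> (f has_derivative f' x) (at x)"
    "\<And>v. Ck_on n (\<lambda>x. f' x v) S" using Ck_on_SucE[OF Suc.prems(1)] by blast
  obtain g' where g': "\<And>x. x \<in> S \<Longrightarrow> (g has_derivative g' x) (at x)"
    "\<And>v. Ck_on n (\<lambda>x. g' x v) S" using Ck_on_SucE[OF Suc.prems(2)] by blast
  have "\<And>v. Ck_on n (\<lambda>x. B (f x) (g' x v) + B (f' x v) (g x)) S"
    by (intro Ck_on_add Suc.IH f'(2) g'(2) Suc.prems[THEN Ck_on_pred])
  then show ?case
    using bounded_bilinear.FDERIV[OF assms f'(1) g'(1)]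
    by (intro Ck_on_SucI[where f' = "\<lambda>x v. B (f x) (g' x v) + B (f' x v) (g x)"])
qed

text \<open>The chain rule applies the derivative of \<open>g\<close> to a direction that varies with the point, whereas
  \<open>C\<^sup>k\<close> tests fixed directions. Expanding the direction in the standard basis turns the derivative
  of the composition into a finite sum of products of functions of class \<open>C\<^sup>k\<close>.\<close>

lemma Ck_on_compose:
  assumes "f ` S \<subseteq> T"
  shows "Ck_on n f S \<Longrightarrow> Ck_on n g T \<Longrightarrow> Ck_on n (\<lambda>x. g (f x)) S"
proof (induction n arbitrary: g)
  case 0
  then show ?case using assms by (auto intro: continuous_on_compose2)
next
  case (Suc n)
  obtain f' where f': "\<And>x. x \<in> S \<Longrightarrow> (f has_derivative f' x) (at x)"
    "\<And>v. Ck_on n (\<lambda>x. f' x v) S" using Ck_on_SucE[OF Suc.prems(1)] by blast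
  obtain g' where g': "\<And>x. x \<in> T \<Longrightarrow> (g has_derivative g' x) (at x)"
    "\<And>v. Ck_on n (\<lambda>x. g' x v) T" using Ck_on_SucE[OF Suc.prems(2)] by blast
  have d: "((\<lambda>x. g (f x)) has_derivative (\<lambda>v. \<Sum>i\<in>Basis. (f' x v \<bullet> i) *\<^sub>R g' (f x) i)) (at x)" if "x \<in> S" for x
  proof -
    have fx: "f x \<in> T" using that assms by auto
    have "g' (f x) (f' x v) = (\<Sum>i\<in>Basis. (f' x v \<bullet> i) *\<^sub>R g' (f x) i)" for v
    proof -
      have l: "linear (g' (f x))" using g'(1)[OF fx] has_derivative_linear by blast
      show ?thesis
        using linear_sum[OF l, of "\<lambda>i. (f' x v \<bullet> i) *\<^sub>R i" Basis]
        by (simp add: linear_cmul[OF l] euclidean_representation)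
    qed
    then show ?thesis using has_derivative_compose[OF f'(1)[OF that] g'(1)[OF fx]] by simp
  qed
  have "Ck_on n (\<lambda>x. \<Sum>i\<in>Basis. (f' x v \<bullet> i) *\<^sub>R g' (f x) i) S" for v
    by (intro Ck_on_sum Ck_on_bilinear[OF bounded_bilinear_scaleR] Suc.IH f'(2) g'(2)
        Ck_on_bilinear[OF bounded_bilinear_inner] Ck_on_const Suc.prems(1)[THEN Ck_on_pred] finite_Basis)
  with d show ?case
    by (intro Ck_on_SucI[where f' = "\<lambda>x v. \<Sum>i\<in>Basis. (f' x v \<bullet> i) *\<^sub>R g' (f x) i"])
qed

text \<open>All real powers are treated at once because differentiation changes the exponent.\<close>

lemma Ck_on_powr: "Ck_on n (\<lambda>x::real. x powr a) {0<..}"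
proof (induction n arbitrary: a)
  case 0
  then show ?case by (auto intro!: continuous_intros)
next
  case (Suc n)
  have "((\<lambda>x. x powr a) has_derivative (\<lambda>v. v * (a * x powr (a - 1)))) (at x)" if "x \<in> {0<..}" for x
    using has_real_derivative_powr[of x a] that
    by (simp add: has_field_derivative_def mult.commute[of _ "a * x powr (a - 1)"])
  moreover have "Ck_on n (\<lambda>x. v * (a * x powr (a - 1))) {0<..}" for v
    by (intro Ck_on_bilinear[OF bounded_bilinear_mult] Ck_on_const Suc.IH)
  ultimately show ?case
    by (rule Ck_on_SucI)
qed

lemma Ck_on_sqrt: "Ck_on n sqrt {0<..}"
  by (rule Ck_on_cong[OF _ _ Ck_on_powr[of n "1/2"]]) (auto simp: powr_half_sqrt)

lemma smooth_on_differentiable: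
  assumes "smooth_on f S" "x \<in> S" shows "(f has_derivative frechet_derivative f (at x)) (at x)"
  using assms Ck_on.simps(2)[of 0 f S] unfolding smooth_on_def
  by (metis frechet_derivative_at)

lemma smooth_on_derivative:
  assumes "smooth_on f S" "open S" shows "smooth_on (\<lambda>x. frechet_derivative f (at x) v) S"
  using assms Ck_on_Suc_iff[OF assms(2)] unfolding smooth_on_def by blast


section \<open>Weak second derivatives on an interval\<close>

lemma continuous_on_integrable_Ioo:
  fixes f :: "real \<Rightarrow> real"
  assumes "continuous_on {a..b} f"
  shows "integrable (lebesgue_on {a<..<b}) f" "(LINT x|lebesgue_on {a<..<b}. f x) = integral {a..b} f"
proof -
  have "f absolutely_integrable_on {a..b}"
    using assms absolutely_integrable_continuous_real by blast
  then have "f absolutely_integrable_on {a<..<b}"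
    by (rule set_integrable_subset) auto
  then show i: "integrable (lebesgue_on {a<..<b}) f"
    by (rule absolutely_integrable_imp_integrable) auto
  show "(LINT x|lebesgue_on {a<..<b}. f x) = integral {a..b} f"
    using lebesgue_integral_eq_integral[OF i] integral_open_interval_real[of a b f] by simp
qed

text \<open>Integrating a compactly supported function of mean zero gives a compactly supported function;
  this is how the test functions below are obtained from prescribed first and second derivatives.\<close>

lemma primitive_of_compact_support:
  fixes w :: "real \<Rightarrow> real"
  assumes w: "continuous_on UNIV w" "\<And>s. s \<notin> {c..d} \<Longrightarrow> w s = 0" "integral {a..b} w = 0"
    and ord: "a < c" "c \<le> d" "d < b"
  shows "((\<lambda>x. integral {a..x} w) has_real_derivative w x) (at x)"
    and "x \<notin> {c..d} \<Longrightarrow> integral {a..x} w = 0"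
proof -
  have w_int: "w integrable_on {u..v}" for u v
    using w(1) continuous_on_subset integrable_continuous_real by blast
  have left: "integral {a..x} w = 0" if "x < c" for x
    using integral_cong[of "{a..x}" w "\<lambda>_. 0"] that w(2) by simp
  have right: "integral {a..x} w = 0" if "d < x" for x
  proof (cases "x \<le> b")
    case True
    have "integral {x..b} w = 0"
      using integral_cong[of "{x..b}" w "\<lambda>_. 0"] that w(2) by simp
    then show ?thesis using Henstock_Kurzweil_Integration.integral_combine[OF _ True w_int] ord that w(3) by simp
  next
    case False
    have "integral {b..x} w = 0"
      using integral_cong[of "{b..x}" w "\<lambda>_. 0"] that w(2) ord by simp
    then show ?thesis using Henstock_Kurzweil_Integration.integral_combine[OF _ _ w_int, of a b x] ord False w(3) by simp
  qed
  show "x \<notin> {c..d} \<Longrightarrow> integral {a..x} w = 0"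
    using left right by force
  show "((\<lambda>x. integral {a..x} w) has_real_derivative w x) (at x)"
  proof (cases "x < c")
    case True
    have "((\<lambda>x. 0) has_real_derivative w x) (at x)" using True w(2)[of x] by simp
    then show ?thesis
      by (rule has_field_derivative_transform_within_open[where S = "{..<c}"]) (use True left in auto)
  next
    case False
    then have "x \<in> {a..x+1}" using ord by simp
    then have "((\<lambda>x. integral {a..x} w) has_real_derivative w x) (at x within {a..x+1})"
      using w(1) continuous_on_subset by (intro integral_has_real_derivative) auto
    moreover have "x \<in> interior {a..x+1}" using False ord by simp
    ultimately show ?thesis by (simp only: at_within_interior)
  qed
qed

lemma integral_primitive_times:
  fixes \<phi> u :: "real \<Rightarrow> real"
  assumes "a \<le> b" "continuous_on {a..b} \<phi>" "continuous_on {a..b} \<phi>'"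
    "\<And>x. x \<in> {a<..<b} \<Longrightarrow> (\<phi> has_real_derivative \<phi>' x) (at x)" "\<phi> a = 0" "\<phi> b = 0"
    "continuous_on {a..b} u" "continuous_on {a..b} u'"
    "\<And>x. x \<in> {a<..<b} \<Longrightarrow> (u has_real_derivative u' x) (at x)"
  shows "integral {a..b} (\<lambda>x. \<phi>' x * u x) = - integral {a..b} (\<lambda>x. \<phi> x * u' x)"
proof -
  have "((\<lambda>x. \<phi>' x * u x + \<phi> x * u' x) has_integral (\<phi> b * u b - \<phi> a * u a)) {a..b}"
  proof (rule fundamental_theorem_of_calculus_interior[OF assms(1)])
    show "continuous_on {a..b} (\<lambda>x. \<phi> x * u x)" using assms by (intro continuous_intros)
    show "((\<lambda>x. \<phi> x * u x) has_vector_derivative \<phi>' x * u x + \<phi> x * u' x) (at x)" if "x \<in> {a<..<b}" for x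
      using DERIV_mult[OF assms(4)[OF that] assms(9)[OF that]]
      by (simp add: has_real_derivative_iff_has_vector_derivative mult.commute)
  qed
  then have "integral {a..b} (\<lambda>x. \<phi>' x * u x + \<phi> x * u' x) = 0"
    using assms by (simp add: integral_unique)
  moreover have "integral {a..b} (\<lambda>x. \<phi>' x * u x + \<phi> x * u' x)
     = integral {a..b} (\<lambda>x. \<phi>' x * u x) + integral {a..b} (\<lambda>x. \<phi> x * u' x)"
    using assms by (intro integral_add integrable_continuous_real continuous_intros)
  ultimately show ?thesis by simp
qed

lemma test_function_bounded:
  fixes \<phi> \<phi>' :: "real \<Rightarrow> real"
  assumes d: "\<And>x. (\<phi> has_real_derivative \<phi>' x) (at x)" and c: "continuous_on UNIV \<phi>'"
    and K: "compact K" "\<And>x. x \<notin> K \<Longrightarrow> \<phi> x = 0"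
  obtains C where "\<And>x. \<bar>\<phi> x\<bar> \<le> C" "\<And>x. \<bar>\<phi>' x\<bar> \<le> C" "continuous_on UNIV \<phi>"
proof -
  have \<phi>c: "continuous_on UNIV \<phi>"
    using d by (meson DERIV_isCont continuous_at_imp_continuous_on)
  have z: "\<phi>' x = 0" if "x \<notin> K" for x
  proof -
    have "((\<lambda>x. 0) has_real_derivative \<phi>' x) (at x)"
      by (rule has_field_derivative_transform_within_open[OF d, of "-K"])
        (use that K compact_imp_closed in auto)
    then show ?thesis using DERIV_unique[OF _ DERIV_const] by blast
  qed
  obtain C1 where "\<forall>x\<in>K. \<bar>\<phi> x\<bar> \<le> C1"
    using compact_imp_bounded[OF compact_continuous_image[OF continuous_on_subset[OF \<phi>c] K(1)]]
    by (auto simp: bounded_iff)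
  moreover obtain C2 where "\<forall>x\<in>K. \<bar>\<phi>' x\<bar> \<le> C2"
    using compact_imp_bounded[OF compact_continuous_image[OF continuous_on_subset[OF c] K(1)]]
    by (auto simp: bounded_iff)
  ultimately have "\<bar>\<phi> x\<bar> \<le> max 0 (max C1 C2)" "\<bar>\<phi>' x\<bar> \<le> max 0 (max C1 C2)" for x
    using z[of x] K(2)[of x] by (cases "x \<in> K"; force)+
  with that \<phi>c show ?thesis by blast
qed

lemma integrable_bounded_continuous_times:
  fixes f h :: "real \<Rightarrow> real"
  assumes "integrable (lebesgue_on S) f" "S \<in> sets lebesgue" "continuous_on UNIV h" "\<And>x. \<bar>h x\<bar> \<le> C"
  shows "integrable (lebesgue_on S) (\<lambda>x. h x * f x)"
proof (rule Bochner_Integration.integrable_bound)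
  show "integrable (lebesgue_on S) (\<lambda>x. C * f x)" using assms by simp
  have "h \<in> borel_measurable (lebesgue_on S)"
    using assms(2,3) continuous_imp_measurable_on_sets_lebesgue continuous_on_subset by blast
  then show "(\<lambda>x. h x * f x) \<in> borel_measurable (lebesgue_on S)"
    using assms(1) by measurable
  have "\<bar>h x\<bar> \<le> \<bar>C\<bar>" for x using assms(4)[of x] by linarith
  then show "AE x in lebesgue_on S. norm (h x * f x) \<le> norm (C * f x)"
    by (auto simp: abs_mult intro!: AE_I2 mult_right_mono)
qed

text \<open>A primitive of an integrable function is in general not differentiable everywhere, so integration
  by parts is replaced by Fubini's theorem on the triangle \<open>a < s \<le> x < b\<close>: the inner integral of
  \<open>\<phi>'\<close> over \<open>[s, b]\<close> is \<open>-\<phi> s\<close>.\<close>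

lemma weak_derivative_primitive:
  fixes g :: "real \<Rightarrow> real"
  assumes ab: "a < b" and g: "integrable (lebesgue_on {a<..<b}) g"
  shows "weak_derivative_on {a<..<b} (\<lambda>x. integral {a..x} g) g"
  unfolding weak_derivative_on_def real_scaleR_def
proof (intro allI impI, elim conjE)
  fix \<phi> \<phi>' :: "real \<Rightarrow> real" and K
  assume d: "\<forall>x. (\<phi> has_real_derivative \<phi>' x) (at x)" and c: "continuous_on UNIV \<phi>'"
    and K: "compact K" "K \<subseteq> {a<..<b}" "\<forall>x. x \<notin> K \<longrightarrow> \<phi> x = 0"
  obtain C where C: "\<And>x. \<bar>\<phi> x\<bar> \<le> C" "\<And>x. \<bar>\<phi>' x\<bar> \<le> C"
    using test_function_bounded[of \<phi> \<phi>' K] d c K by metis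
  let ?S = "{a<..<b}"
  let ?M = "lebesgue_on ?S"
  let ?h = "\<lambda>x s. \<phi>' x * (if s \<le> x then g s else 0)"
  interpret finite_measure ?M
    by (rule finite_measureI) (use ab in \<open>simp add: emeasure_restrict_space space_restrict_space\<close>)
  interpret P: pair_sigma_finite ?M ?M ..
  have [measurable]: "\<phi>' \<in> borel_measurable ?M"
    by (rule continuous_imp_measurable_on_sets_lebesgue[OF continuous_on_subset[OF c]]) auto
  have [measurable]: "g \<in> borel_measurable ?M" using g by auto
  have id_m: "(\<lambda>x. x) \<in> ?M \<rightarrow>\<^sub>M borel"
    by (simp add: continuous_imp_measurable_on_sets_lebesgue)
  have [measurable]: "(\<lambda>p. fst p) \<in> borel_measurable (?M \<Otimes>\<^sub>M ?M)" "(\<lambda>p. snd p) \<in> borel_measurable (?M \<Otimes>\<^sub>M ?M)"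
    using measurable_compose[OF measurable_fst id_m] measurable_compose[OF measurable_snd id_m] by auto
  have m: "case_prod ?h \<in> borel_measurable (?M \<Otimes>\<^sub>M ?M)"
    unfolding case_prod_beta by measurable
  have [measurable]: "Measurable.pred ?M (\<lambda>s. s \<le> x)" "Measurable.pred ?M (\<lambda>s. x \<le> s)" for x
    by (rule measurable_compose[OF id_m], measurable)+
  have g0: "integrable ?M (\<lambda>s. if s \<le> x then g s else 0)" for x
    by (rule Bochner_Integration.integrable_bound[OF g]) (auto intro!: AE_I2)
  have h_int: "integrable ?M (?h x)" for x
    using g0[of x] by simp
  have "integrable (?M \<Otimes>\<^sub>M ?M) (case_prod ?h)"
  proof (rule P.Fubini_integrable[OF m])
    show "AE x in ?M. integrable ?M (\<lambda>y. case_prod ?h (x, y))" using h_int by simp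
    show "integrable ?M (\<lambda>x. LINT y|?M. norm (case_prod ?h (x, y)))"
    proof (rule integrable_const_bound[where B = "C * (LINT s|?M. \<bar>g s\<bar>)"])
      show "(\<lambda>x. LINT y|?M. norm (case_prod ?h (x, y))) \<in> borel_measurable ?M"
        using m by (intro borel_measurable_lebesgue_integral) measurable
      have "(LINT y|?M. norm (?h x y)) \<le> (LINT s|?M. C * \<bar>g s\<bar>)" for x
      proof (rule integral_mono)
        show "norm (?h x y) \<le> C * \<bar>g y\<bar>" for y
          using C(2)[of x] by (auto simp: abs_mult intro!: mult_right_mono mult_nonneg_nonneg)
      qed (use integrable_norm[OF h_int] g in auto)
      then show "AE x in ?M. norm (LINT y|?M. norm (case_prod ?h (x, y))) \<le> C * (LINT s|?M. \<bar>g s\<bar>)"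
        by simp
    qed
  qed
  then have F: "(LINT s|?M. LINT x|?M. ?h x s) = (LINT x|?M. LINT s|?M. ?h x s)"
    by (rule P.Fubini_integral)
  have "(LINT s|?M. ?h x s) = \<phi>' x * integral {a..x} g" if "x \<in> ?S" for x
  proof -
    have "(LINT s|?M. (if s \<le> x then g s else 0)) = integral ?S (\<lambda>s. if s \<le> x then g s else 0)"
      by (rule lebesgue_integral_eq_integral[OF g0]) simp
    also have "\<dots> = integral ?S (\<lambda>s. if s \<in> {..x} then g s else 0)" by (simp add: atMost_def)
    also have "\<dots> = integral ({..x} \<inter> ?S) g" by (rule Henstock_Kurzweil_Integration.integral_restrict_Int)
    also have "{..x} \<inter> ?S = {a<..x}" using that by auto
    also have "integral {a<..x} g = integral {a..x} g"
      by (rule integral_subset_negligible) (auto intro: negligible_subset[of "{a}"])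
    finally show ?thesis by simp
  qed
  then have "(LINT x|?M. LINT s|?M. ?h x s) = (LINT x|?M. \<phi>' x * integral {a..x} g)"
    by (intro Bochner_Integration.integral_cong) auto
  moreover have "(LINT x|?M. ?h x s) = - (\<phi> s * g s)" if "s \<in> ?S" for s
  proof -
    have "(LINT x|?M. (if s \<le> x then \<phi>' x else 0)) = integral ?S (\<lambda>x. if s \<le> x then \<phi>' x else 0)"
    proof (rule lebesgue_integral_eq_integral)
      show "integrable ?M (\<lambda>x. if s \<le> x then \<phi>' x else 0)"
        by (rule integrable_const_bound[where B = C])
          (auto intro!: AE_I2 C order_trans[OF abs_ge_zero C(2)[of s]])
    qed simp
    also have "\<dots> = integral ?S (\<lambda>x. if x \<in> {s..} then \<phi>' x else 0)" by (simp add: atLeast_def)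
    also have "\<dots> = integral ({s..} \<inter> ?S) \<phi>'" by (rule Henstock_Kurzweil_Integration.integral_restrict_Int)
    also have "{s..} \<inter> ?S = {s..<b}" using that by auto
    also have "integral {s..<b} \<phi>' = integral {s..b} \<phi>'"
      by (rule integral_subset_negligible) (auto intro: negligible_subset[of "{b}"])
    also have "\<dots> = \<phi> b - \<phi> s"
      using that d by (intro integral_unique fundamental_theorem_of_calculus)
        (auto simp: has_real_derivative_iff_has_vector_derivative[symmetric] intro: has_field_derivative_at_within)
    also have "\<phi> b = 0" using K by auto
    finally have "(LINT x|?M. g s * (if s \<le> x then \<phi>' x else 0)) = - (\<phi> s * g s)" by simp
    moreover have "(\<lambda>x. g s * (if s \<le> x then \<phi>' x else 0)) = (\<lambda>x. ?h x s)" by auto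
    ultimately show ?thesis by simp
  qed
  then have "(LINT s|?M. LINT x|?M. ?h x s) = (LINT s|?M. - (\<phi> s * g s))"
    by (intro Bochner_Integration.integral_cong) auto
  ultimately show "(LINT x|?M. \<phi>' x * integral {a..x} g) = - (LINT x|?M. \<phi> x * g x)"
    using F by simp
qed

text \<open>Let \<open>P = \<tau> - Q\<close>, where \<open>Q\<close> is the second primitive of the second weak derivative of \<open>\<tau>\<close>. Then
  \<open>P\<close> is continuous and \<open>\<integral> \<phi>'' P = 0\<close> for every test function \<open>\<phi>\<close>. That \<open>P\<close> is affine follows from a
  single test function: let \<open>l\<close> be the orthogonal projection of \<open>P\<close> to the affine functions in
  \<open>L\<^sup>2\<close> with a weight \<open>\<rho>\<close> that is positive exactly on \<open>(c, d)\<close>. As \<open>\<rho> (P - l)\<close> is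
  orthogonal to the affine functions, it is the second derivative of a compactly supported function,
  and so \<open>\<integral> \<rho> (P - l)\<^sup>2 = 0\<close>.\<close>

lemma weak_second_derivative_imp_affine:
  fixes \<tau> :: "real \<Rightarrow> real"
  assumes \<tau>: "continuous_on UNIV \<tau>"
    and D1: "weak_derivative_on {a<..<b} \<tau> D1"
    and D2: "weak_derivative_on {a<..<b} D1 D2" "integrable (lebesgue_on {a<..<b}) D2"
    and ord: "a < c" "c < d" "d < b"
  defines "Q \<equiv> \<lambda>x. integral {a..x} (\<lambda>y. integral {a..y} D2)"
  obtains \<alpha> \<beta> where "\<And>x. x \<in> {c<..<d} \<Longrightarrow> \<tau> x = \<alpha> + \<beta> * x + Q x"
proof -
  define G where "G = (\<lambda>y. integral {a..y} D2)"
  define \<rho> where "\<rho> = (\<lambda>s. max 0 (s - c) * max 0 (d - s))"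
  \<comment> \<open>Composing with the projection to \<open>[a, b]\<close> extends \<open>P\<close> continuously to the whole line.\<close>
  define clamp where "clamp = (\<lambda>s. max a (min b s))"
  define P where "P = (\<lambda>s. \<tau> s - Q s)"
  define I where "I = (\<lambda>f::real \<Rightarrow> real. integral {a..b} f)"
  have ab: "a < b" using ord by simp
  have clamp: "clamp s \<in> {a..b}" "s \<in> {a..b} \<Longrightarrow> clamp s = s" for s
    using ab by (auto simp: clamp_def)
  have "D2 integrable_on {a..b}"
    using integrable_on_lebesgue_on[OF D2(2)] integrable_on_open_interval_real by auto
  then have G_cont: "continuous_on {a..b} G"
    unfolding G_def by (rule indefinite_integral_continuous_1)
  have Q_deriv: "(Q has_real_derivative G x) (at x)" if "x \<in> {a<..<b}" for x
  proof -
    have "(Q has_real_derivative G x) (at x within {a..b})"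
      using that G_cont unfolding Q_def G_def[symmetric] by (intro integral_has_real_derivative) auto
    then show ?thesis using that at_within_Icc_at[of a x b] by simp
  qed
  have Q_cont: "continuous_on {a..b} Q"
    unfolding Q_def G_def[symmetric]
    by (rule indefinite_integral_continuous_1[OF integrable_continuous_real[OF G_cont]])
  have \<tau>_cont: "continuous_on {a..b} \<tau>" using \<tau> continuous_on_subset by blast
  have P_cont: "continuous_on {a..b} P" unfolding P_def by (intro continuous_intros Q_cont \<tau>_cont)
  have \<rho>_cont: "continuous_on S \<rho>" for S unfolding \<rho>_def by (intro continuous_intros)
  have \<rho>_nonneg: "\<rho> s \<ge> 0" for s by (simp add: \<rho>_def)
  have \<rho>_pos: "\<rho> s > 0" if "s \<in> {c<..<d}" for s using that by (simp add: \<rho>_def)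
  have \<rho>_zero: "\<rho> s = 0" if "s \<notin> {c..d}" for s
    using that by (auto simp: \<rho>_def max_def)
  have I_pos: "I (\<lambda>s. \<rho> s * (q s)\<^sup>2) > 0"
    if q: "continuous_on {a..b} q" "s0 \<in> {c<..<d}" "q s0 \<noteq> 0" for q s0
  proof -
    have c: "continuous_on {a..b} (\<lambda>s. \<rho> s * (q s)\<^sup>2)" by (intro continuous_intros q \<rho>_cont)
    have "\<rho> s0 * (q s0)\<^sup>2 \<noteq> 0" "s0 \<in> {a..b}" using \<rho>_pos[OF q(2)] q ord by auto
    then have "I (\<lambda>s. \<rho> s * (q s)\<^sup>2) \<noteq> 0"
      unfolding I_def using integral_eq_0_iff[OF c ab] \<rho>_nonneg by fastforce
    moreover have "I (\<lambda>s. \<rho> s * (q s)\<^sup>2) \<ge> 0"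
      unfolding I_def using \<rho>_nonneg by (auto intro!: integral_nonneg integrable_continuous_real c)
    ultimately show ?thesis by simp
  qed
  have I_add: "I (\<lambda>s. f s + h s) = I f + I h" if "continuous_on {a..b} f" "continuous_on {a..b} h" for f h
    unfolding I_def using that by (intro integral_add integrable_continuous_real)
  have I_cmul: "I (\<lambda>s. k * f s) = k * I f" for k f
    unfolding I_def by simp
  have I_diff: "I (\<lambda>s. f s - h s) = I f - I h" if "continuous_on {a..b} f" "continuous_on {a..b} h" for f h
    unfolding I_def using that by (intro integral_diff integrable_continuous_real)
  have s0: "(c + d) / 2 \<in> {c<..<d}" using ord by auto
  have I\<rho>: "I \<rho> > 0" using I_pos[OF continuous_on_const s0, of 1] by simp
  \<comment> \<open>The center of mass of the weight: \<open>1\<close> and \<open>s - m\<close> are then an orthogonal basis of the affine functions.\<close>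
  define m where "m = I (\<lambda>s. s * \<rho> s) / I \<rho>"
  have first_moment: "I (\<lambda>s. \<rho> s * (s - m)) = 0"
  proof -
    have "I (\<lambda>s. \<rho> s * (s - m)) = I (\<lambda>s. s * \<rho> s - m * \<rho> s)" by (simp add: algebra_simps)
    also have "\<dots> = I (\<lambda>s. s * \<rho> s) - m * I \<rho>"
      by (subst I_diff) (auto intro!: continuous_intros \<rho>_cont simp only: I_cmul)
    also have "\<dots> = 0" using I\<rho> by (simp add: m_def)
    finally show ?thesis .
  qed
  obtain s1 where s1: "s1 \<in> {c<..<d}" "s1 \<noteq> m"
  proof -
    have "infinite {c<..<d}" using ord by simp
    then have "infinite ({c<..<d} - {m})" by simp
    then show ?thesis using that by (metis DiffE finite.emptyI ex_in_conv singletonI)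
  qed
  have V: "I (\<lambda>s. \<rho> s * (s - m)\<^sup>2) > 0"
    by (rule I_pos[OF _ s1(1)]) (use s1 in \<open>auto intro!: continuous_intros\<close>)
  define \<alpha> where "\<alpha> = I (\<lambda>s. \<rho> s * P s) / I \<rho>"
  define \<beta> where "\<beta> = I (\<lambda>s. \<rho> s * P s * (s - m)) / I (\<lambda>s. \<rho> s * (s - m)\<^sup>2)"
  define l where "l = (\<lambda>s. \<alpha> + \<beta> * (s - m))"
  have l_cont: "continuous_on S l" for S unfolding l_def by (intro continuous_intros)
  define w where "w = (\<lambda>s. \<rho> s * (P (clamp s) - l s))"
  have w_eq: "w s = \<rho> s * (P s - l s)" if "s \<in> {a..b}" for s
    using clamp(2)[OF that] by (simp add: w_def)
  have I_w: "I (\<lambda>s. w s * f s) = I (\<lambda>s. \<rho> s * (P s - l s) * f s)" for f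
    unfolding I_def by (rule integral_cong) (simp add: w_eq)
  have "continuous_on UNIV (\<lambda>s. P (clamp s))"
    by (rule continuous_on_compose2[OF P_cont]) (use clamp(1) in \<open>auto simp: clamp_def intro!: continuous_intros\<close>)
  then have w_cont: "continuous_on UNIV w"
    unfolding w_def by (intro continuous_intros \<rho>_cont l_cont)
  have w_contS: "continuous_on S w" for S using w_cont continuous_on_subset by blast
  have w_zero: "w s = 0" if "s \<notin> {c..d}" for s using \<rho>_zero[OF that] by (simp add: w_def)
  have w0: "I w = 0"
  proof -
    have "I w = I (\<lambda>s. \<rho> s * P s - (\<alpha> * \<rho> s + \<beta> * (\<rho> s * (s - m))))"
      using I_w[of "\<lambda>_. 1"] by (simp add: l_def algebra_simps)
    also have "\<dots> = I (\<lambda>s. \<rho> s * P s) - (\<alpha> * I \<rho> + \<beta> * I (\<lambda>s. \<rho> s * (s - m)))"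
      by (subst I_diff I_add; (intro continuous_intros \<rho>_cont P_cont)?)+ (simp add: I_cmul)
    finally show ?thesis using I\<rho> first_moment by (simp add: \<alpha>_def)
  qed
  have w1: "I (\<lambda>s. w s * (s - m)) = 0"
  proof -
    have "I (\<lambda>s. w s * (s - m)) = I (\<lambda>s. \<rho> s * P s * (s - m) - (\<alpha> * (\<rho> s * (s - m)) + \<beta> * (\<rho> s * (s - m)\<^sup>2)))"
      unfolding I_w by (simp add: l_def algebra_simps power2_eq_square)
    also have "\<dots> = I (\<lambda>s. \<rho> s * P s * (s - m)) - (\<alpha> * I (\<lambda>s. \<rho> s * (s - m)) + \<beta> * I (\<lambda>s. \<rho> s * (s - m)\<^sup>2))"
      by (subst I_diff I_add; (intro continuous_intros \<rho>_cont P_cont)?)+ (simp add: I_cmul)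
    finally show ?thesis using V first_moment by (simp add: \<beta>_def)
  qed
  define \<phi>1 where "\<phi>1 = (\<lambda>x. integral {a..x} w)"
  have \<phi>1: "(\<phi>1 has_real_derivative w x) (at x)" "x \<notin> {c..d} \<Longrightarrow> \<phi>1 x = 0" for x
    using primitive_of_compact_support[OF w_cont w_zero _ ord(1) _ ord(3)] w0 ord(2)
    unfolding \<phi>1_def I_def by auto
  have \<phi>1_cont: "continuous_on S \<phi>1" for S
    using \<phi>1(1) by (meson DERIV_isCont continuous_at_imp_continuous_on)
  have "I \<phi>1 = 0"
  proof -
    have "integral {a..b} (\<lambda>x. w x * (x - m)) = - integral {a..b} (\<lambda>x. \<phi>1 x * 1)"
      by (rule integral_primitive_times)
        (use ab ord \<phi>1 \<phi>1_cont w_contS in \<open>auto intro!: derivative_eq_intros continuous_intros\<close>)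
    then show ?thesis using w1 by (simp add: I_def)
  qed
  define \<phi> where "\<phi> = (\<lambda>x. integral {a..x} \<phi>1)"
  have \<phi>: "(\<phi> has_real_derivative \<phi>1 x) (at x)" "x \<notin> {c..d} \<Longrightarrow> \<phi> x = 0" for x
    using primitive_of_compact_support[OF \<phi>1_cont \<phi>1(2) _ ord(1) _ ord(3)] \<open>I \<phi>1 = 0\<close> ord(2)
    unfolding \<phi>_def I_def by auto
  let ?L = "\<lambda>f. LINT x|lebesgue_on {a<..<b}. f x"
  have cd: "compact {c..d}" "{c..d} \<subseteq> {a<..<b}" using ord by auto
  have "?L (\<lambda>x. w x * \<tau> x) = - ?L (\<lambda>x. \<phi>1 x * D1 x)"
    using D1[unfolded weak_derivative_on_def, rule_format, of \<phi>1 w "{c..d}"] \<phi>1 w_cont cd by simp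
  also have "?L (\<lambda>x. \<phi>1 x * D1 x) = - ?L (\<lambda>x. \<phi> x * D2 x)"
    using D2(1)[unfolded weak_derivative_on_def, rule_format, of \<phi> \<phi>1 "{c..d}"] \<phi> \<phi>1_cont cd by simp
  also have "?L (\<lambda>x. \<phi> x * D2 x) = - ?L (\<lambda>x. \<phi>1 x * G x)"
    using weak_derivative_primitive[OF ab D2(2), unfolded weak_derivative_on_def, rule_format, of \<phi> \<phi>1 "{c..d}"]
      \<phi> \<phi>1_cont cd by (simp add: G_def)
  finally have "?L (\<lambda>x. w x * \<tau> x) = - ?L (\<lambda>x. \<phi>1 x * G x)" by simp
  then have "I (\<lambda>x. w x * \<tau> x) = - I (\<lambda>x. \<phi>1 x * G x)"
    unfolding I_def
    by (simp add: continuous_on_integrable_Ioo(2) w_contS \<tau>_cont \<phi>1_cont G_cont continuous_on_mult)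
  also have "\<dots> = I (\<lambda>x. w x * Q x)"
    unfolding I_def by (rule integral_primitive_times[symmetric])
      (use ab ord \<phi>1 \<phi>1_cont w_contS Q_cont G_cont Q_deriv in auto)
  finally have "I (\<lambda>x. w x * P x) = 0"
    by (simp add: P_def right_diff_distrib I_diff w_contS \<tau>_cont Q_cont continuous_on_mult)
  moreover have "I (\<lambda>x. w x * l x) = \<alpha> * I w + \<beta> * I (\<lambda>s. w s * (s - m))"
  proof -
    have "(\<lambda>x. w x * l x) = (\<lambda>s. \<alpha> * w s + \<beta> * (w s * (s - m)))"
      by (auto simp: l_def algebra_simps)
    moreover have "I (\<lambda>s. \<alpha> * w s + \<beta> * (w s * (s - m))) = I (\<lambda>s. \<alpha> * w s) + I (\<lambda>s. \<beta> * (w s * (s - m)))"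
      by (intro I_add continuous_intros w_contS)
    ultimately show ?thesis by (simp add: I_cmul)
  qed
  ultimately have "I (\<lambda>x. w x * (P x - l x)) = 0"
    using w0 w1 by (simp add: right_diff_distrib I_diff w_contS P_cont l_cont continuous_on_mult)
  then have "I (\<lambda>x. \<rho> x * (P x - l x)\<^sup>2) = 0"
    unfolding I_w by (simp add: power2_eq_square mult.assoc)
  then have eq: "P x = l x" if "x \<in> {c<..<d}" for x
    using I_pos[of "\<lambda>x. P x - l x" x] that P_cont l_cont by (force intro: continuous_intros)
  show thesis
  proof (rule that)
    show "\<tau> x = (\<alpha> - \<beta> * m) + \<beta> * x + Q x" if "x \<in> {c<..<d}" for x
      using eq[OF that] by (simp add: P_def l_def algebra_simps)
  qed
qed


section \<open>The Sobolev embedding on the circle\<close>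

definition C1 :: "(real \<Rightarrow> real) set" where
  "C1 = {\<tau>. (\<forall>t. (\<tau> has_real_derivative deriv \<tau> t) (at t)) \<and> continuous_on UNIV (deriv \<tau>)}"

text \<open>The affine part depends on the subinterval on which it is determined, but differences of values of
  the derivative only see the primitive \<open>G\<close> of \<open>D2\<close>.\<close>

lemma weak_second_derivative_imp_C1:
  fixes \<tau> :: "real \<Rightarrow> real"
  assumes \<tau>: "continuous_on UNIV \<tau>"
    and D: "weak_derivative_on {a<..<b} \<tau> D1" "weak_derivative_on {a<..<b} D1 D2"
      "integrable (lebesgue_on {a<..<b}) D2"
    and x: "x \<in> {a<..<b}"
  shows "(\<tau> has_real_derivative deriv \<tau> x) (at x)" "isCont (deriv \<tau>) x"
    and "y \<in> {a<..<b} \<Longrightarrow> \<bar>deriv \<tau> x - deriv \<tau> y\<bar> \<le> (LINT s|lebesgue_on {a<..<b}. \<bar>D2 s\<bar>)"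
proof -
  define G where "G = (\<lambda>y. integral {a..y} D2)"
  define Q where "Q = (\<lambda>x. integral {a..x} G)"
  have D2_on: "D2 integrable_on {a..b}"
    using integrable_on_lebesgue_on[OF D(3)] integrable_on_open_interval_real by auto
  then have G_cont: "continuous_on {a..b} G"
    unfolding G_def by (rule indefinite_integral_continuous_1)
  have Q_deriv: "(Q has_real_derivative G x) (at x)" if "x \<in> {a<..<b}" for x
    using integral_has_real_derivative[OF G_cont, of x] that at_within_Icc_at[of a x b]
    unfolding Q_def by simp
  have local: "\<exists>\<beta>. \<forall>z\<in>{c<..<d}. (\<tau> has_real_derivative \<beta> + G z) (at z)"
    if cd: "a < c" "c < d" "d < b" for c d
  proof -
    obtain \<alpha> \<beta> where eq: "\<And>z. z \<in> {c<..<d} \<Longrightarrow> \<tau> z = \<alpha> + \<beta> * z + Q z"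
      using weak_second_derivative_imp_affine[OF \<tau> D cd] unfolding Q_def G_def by metis
    have "(\<tau> has_real_derivative \<beta> + G z) (at z)" if z: "z \<in> {c<..<d}" for z
    proof -
      have "((\<lambda>z. \<alpha> + \<beta> * z + Q z) has_real_derivative \<beta> + G z) (at z)"
        using z cd by (auto intro!: derivative_eq_intros Q_deriv)
      then show ?thesis
        by (rule has_field_derivative_transform_within_open[of _ _ _ "{c<..<d}"]) (use z eq in auto)
    qed
    then show ?thesis by blast
  qed
  obtain c d where cd: "a < c" "c < d" "d < b" "x \<in> {c<..<d}"
  proof -
    have "a < (a + x) / 2" "(a + x) / 2 < (x + b) / 2" "(x + b) / 2 < b" "x \<in> {(a + x) / 2<..<(x + b) / 2}"
      using x by auto
    then show ?thesis using that by blast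
  qed
  then obtain \<beta> where \<beta>: "\<forall>z\<in>{c<..<d}. (\<tau> has_real_derivative \<beta> + G z) (at z)"
    using local by blast
  then have deriv_eq: "deriv \<tau> z = \<beta> + G z" if "z \<in> {c<..<d}" for z
    using that DERIV_imp_deriv by blast
  show "(\<tau> has_real_derivative deriv \<tau> x) (at x)" using \<beta> deriv_eq cd by auto
  have "continuous_on {c<..<d} (\<lambda>z. \<beta> + G z)"
    using cd by (intro continuous_intros continuous_on_subset[OF G_cont]) auto
  then have "continuous_on {c<..<d} (deriv \<tau>)"
    using continuous_on_cong[of "{c<..<d}" "{c<..<d}" "deriv \<tau>"] deriv_eq by metis
  then show "isCont (deriv \<tau>) x" using cd by (simp add: continuous_on_eq_continuous_at)
  show "\<bar>deriv \<tau> x - deriv \<tau> y\<bar> \<le> (LINT s|lebesgue_on {a<..<b}. \<bar>D2 s\<bar>)" if y: "y \<in> {a<..<b}"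
  proof -
    have *: "\<bar>deriv \<tau> x - deriv \<tau> y\<bar> \<le> (LINT s|lebesgue_on {a<..<b}. \<bar>D2 s\<bar>)"
      if xy: "x \<in> {a<..<b}" "y \<in> {a<..<b}" "x \<le> y" for x y
    proof -
      have "a < (a + x) / 2" "(a + x) / 2 < (y + b) / 2" "(y + b) / 2 < b"
        "x \<in> {(a + x) / 2<..<(y + b) / 2}" "y \<in> {(a + x) / 2<..<(y + b) / 2}"
        using xy by auto
      then obtain \<beta> where "deriv \<tau> x = \<beta> + G x" "deriv \<tau> y = \<beta> + G y"
        using local DERIV_imp_deriv by meson
      then have "\<bar>deriv \<tau> x - deriv \<tau> y\<bar> = \<bar>G y - G x\<bar>" by simp
      also have "G y - G x = integral {x..y} D2"
        using Henstock_Kurzweil_Integration.integral_combine[of a x y D2] xy D2_on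
          integrable_subinterval_real[OF D2_on, of a y] unfolding G_def by simp
      also have "integral {x..y} D2 = (LINT s|lebesgue_on {a<..<b}. indicator {x..y} s * D2 s)"
      proof -
        have "integrable (lebesgue_on {a<..<b}) (\<lambda>s. indicator {x..y} s * D2 s)"
          using D(3) xy by (intro integrable_mult_indicator[where 'b = real, unfolded real_scaleR_def]) (auto simp: sets_restrict_space_iff)
        then have "(LINT s|lebesgue_on {a<..<b}. indicator {x..y} s * D2 s) = integral {a<..<b} (\<lambda>s. indicator {x..y} s * D2 s)"
          by (rule lebesgue_integral_eq_integral) simp
        also have "\<dots> = integral {a<..<b} (\<lambda>s. if s \<in> {x..y} then D2 s else 0)"
          by (rule integral_cong) (auto simp: indicator_def)
        also have "\<dots> = integral ({x..y} \<inter> {a<..<b}) D2"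
          by (rule Henstock_Kurzweil_Integration.integral_restrict_Int)
        also have "{x..y} \<inter> {a<..<b} = {x..y}" using xy by auto
        finally show ?thesis by simp
      qed
      also have "\<bar>\<dots>\<bar> \<le> (LINT s|lebesgue_on {a<..<b}. \<bar>indicator {x..y} s * D2 s\<bar>)"
        by (rule integral_abs_bound)
      also have "\<dots> \<le> (LINT s|lebesgue_on {a<..<b}. \<bar>D2 s\<bar>)"
      proof (rule Bochner_Integration.integral_mono)
        show "integrable (lebesgue_on {a<..<b}) (\<lambda>s. \<bar>indicator {x..y} s * D2 s\<bar>)"
          using D(3) xy by (intro integrable_abs integrable_mult_indicator[where 'b = real, unfolded real_scaleR_def]) (auto simp: sets_restrict_space_iff)
      qed (use D(3) in \<open>auto simp: indicator_def\<close>)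
      finally show ?thesis .
    qed
    show ?thesis using *[OF x y] *[OF y x] by (cases "x \<le> y") (auto simp: abs_minus_commute)
  qed
qed

lemma L2_on_interval_integrable:
  fixes f :: "real \<Rightarrow> real"
  assumes "f \<in> L2_on {a<..<b}" shows "integrable (lebesgue_on {a<..<b}) f"
proof (rule Bochner_Integration.integrable_bound)
  have "integrable (lebesgue_on {a<..<b}) (\<lambda>x. 1::real)"
    using continuous_on_integrable_Ioo(1)[of a b "\<lambda>_. 1"] by simp
  with assms show "integrable (lebesgue_on {a<..<b}) (\<lambda>x. 1 + (f x)\<^sup>2)"
    by (simp add: L2_on_def)
  show "f \<in> borel_measurable (lebesgue_on {a<..<b})" using assms by (simp add: L2_on_def)
  have "\<bar>f x\<bar> \<le> 1 + (f x)\<^sup>2" for x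
    using zero_le_power2[of "\<bar>f x\<bar> - 1"] by (simp add: power2_diff)
  then show "AE x in lebesgue_on {a<..<b}. norm (f x) \<le> norm (1 + (f x)\<^sup>2)"
    by (auto intro!: AE_I2 order_trans[OF _ abs_ge_self])
qed

text \<open>The variance of \<open>\<bar>f\<bar>\<close> over an interval of length one is nonnegative.\<close>

lemma L1_le_L2_unit_interval:
  fixes f :: "real \<Rightarrow> real"
  assumes "f \<in> L2_on {0<..<1}"
  shows "(LINT x|lebesgue_on {0<..<1}. \<bar>f x\<bar>) \<le> sqrt (LINT x|lebesgue_on {0<..<1}. (f x)\<^sup>2)"
proof (rule real_le_rsqrt)
  let ?M = "lebesgue_on {0<..<1::real}"
  define m where "m = (LINT x|?M. \<bar>f x\<bar>)"
  have i: "integrable ?M (\<lambda>x. \<bar>f x\<bar>)" "integrable ?M (\<lambda>x. (f x)\<^sup>2)" "integrable ?M (\<lambda>x. c::real)" for c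
    using L2_on_interval_integrable[OF assms] assms continuous_on_integrable_Ioo(1)[of 0 1 "\<lambda>_. c"]
    by (auto simp: L2_on_def)
  have c: "(LINT x|?M. c) = c" for c :: real
    using continuous_on_integrable_Ioo(2)[of 0 1 "\<lambda>_. c"] by simp
  have "0 \<le> (LINT x|?M. (\<bar>f x\<bar> - m)\<^sup>2)" by (rule integral_nonneg_AE) simp
  also have "\<dots> = (LINT x|?M. (f x)\<^sup>2 - 2 * m * \<bar>f x\<bar> + m\<^sup>2)"
    by (rule Bochner_Integration.integral_cong) (auto simp: power2_diff)
  also have "\<dots> = (LINT x|?M. (f x)\<^sup>2) - 2 * m * m + m\<^sup>2"
    using i c[of "m\<^sup>2"] by (simp add: m_def)
  finally show "(LINT x|?M. \<bar>f x\<bar>)\<^sup>2 \<le> (LINT x|?M. (f x)\<^sup>2)"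
    by (simp add: m_def power2_eq_square)
qed

lemma W_circle_C1:
  assumes "\<tau> \<in> W_circle (m + 2)" shows "\<tau> \<in> C1"
proof -
  have "(\<tau> has_real_derivative deriv \<tau> t) (at t) \<and> isCont (deriv \<tau>) t" for t
  proof -
    obtain D where D: "weak_derivatives_on (m + 2) {t - 1<..<t + 1} \<tau> D"
      using assms unfolding W_circle_def sobolev_loc_def sobolev_def by force
    have "weak_derivative_on {t - 1<..<t + 1} \<tau> (D 1)" "weak_derivative_on {t - 1<..<t + 1} (D 1) (D 2)"
      "D 2 \<in> L2_on {t - 1<..<t + 1}"
      using D[unfolded weak_derivatives_on_def] by (auto simp: numeral_2_eq_2)
    then show ?thesis
      using weak_second_derivative_imp_C1[of \<tau> "t - 1" "t + 1" "D 1" "D 2" t] assms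
        L2_on_interval_integrable by (auto simp: W_circle_def)
  qed
  then show ?thesis unfolding C1_def by (auto intro: continuous_at_imp_continuous_on)
qed

text \<open>The Sobolev embedding of \<open>W\<^sup>2\<^sup>,\<^sup>2\<close> in \<open>C\<^sup>1\<close> with constants that are the same on all levels. By
  periodicity \<open>\<tau>'\<close> has a zero, so it is bounded by the \<open>L\<^sup>1\<close> norm of \<open>\<tau>''\<close>; the bound for \<open>\<tau>\<close> is
  obtained by averaging \<open>\<bar>\<tau> t\<bar> \<le> \<bar>\<tau> y\<bar> + sup \<bar>\<tau>'\<bar>\<close> over \<open>y\<close>.\<close>

lemma W_circle_sup_bounds:
  assumes "\<tau> \<in> W_circle (m + 2)" and t: "t \<in> {0..1}"
  shows "\<bar>deriv \<tau> t\<bar> \<le> W_circle_norm (m + 2) \<tau>" "\<bar>\<tau> t\<bar> \<le> 2 * W_circle_norm (m + 2) \<tau>"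
proof -
  let ?N = "W_circle_norm (m + 2) \<tau>"
  let ?M = "lebesgue_on {0<..<1::real}"
  \<comment> \<open>The norm refers to this choice of weak derivatives; the estimates hold for any choice.\<close>
  define D where "D = (SOME D. weak_derivatives_on (m + 2) {0<..<1} \<tau> D)"
  have "\<exists>D. weak_derivatives_on (m + 2) {0<..<1} \<tau> D"
    using assms(1) unfolding W_circle_def sobolev_loc_def sobolev_def by force
  then have D: "weak_derivatives_on (m + 2) {0<..<1} \<tau> D"
    unfolding D_def by (rule someI_ex)
  have norm_eq: "?N = sqrt (\<Sum>j\<le>m + 2. LINT x|?M. (norm (D j x))\<^sup>2)"
    unfolding W_circle_norm_def sobolev_norm_def D_def Let_def ..
  have L2: "D j \<in> L2_on {0<..<1}" if "j \<le> 2" for j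
    using D[unfolded weak_derivatives_on_def] that by auto
  have L1: "(LINT x|?M. \<bar>D j x\<bar>) \<le> ?N" if "j \<le> 2" for j
  proof -
    have "(LINT x|?M. (D j x)\<^sup>2) \<le> (\<Sum>j\<le>m + 2. LINT x|?M. (norm (D j x))\<^sup>2)"
      using member_le_sum[of j "{..m+2}" "\<lambda>j. LINT x|?M. (norm (D j x))\<^sup>2"] that by simp
    then show ?thesis
      using L1_le_L2_unit_interval[OF L2[OF that]] norm_eq real_sqrt_le_mono by (smt (verit))
  qed
  have \<tau>: "(\<tau> has_real_derivative deriv \<tau> x) (at x)" "continuous_on UNIV (deriv \<tau>)" for x
    using W_circle_C1[OF assms(1)] by (auto simp: C1_def)
  have \<tau>_cont: "continuous_on S \<tau>" for S
    using \<tau>(1) by (meson DERIV_isCont continuous_at_imp_continuous_on)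
  have wd: "weak_derivative_on {0<..<1} \<tau> (D 1)" "weak_derivative_on {0<..<1} (D 1) (D 2)" "D 0 = \<tau>"
    using D[unfolded weak_derivatives_on_def] by (auto simp: numeral_2_eq_2)
  have "\<tau> 1 = \<tau> 0" using assms(1) unfolding W_circle_def by (metis (mono_tags, lifting) add_0 mem_Collect_eq)
  then obtain z where z: "z \<in> {0<..<1}" "deriv \<tau> z = 0"
    using MVT2[of 0 1 \<tau> "deriv \<tau>"] \<tau>(1) by auto
  have "\<bar>deriv \<tau> x\<bar> \<le> ?N" if "x \<in> {0<..<1}" for x
    using weak_second_derivative_imp_C1(3)[OF \<tau>_cont wd(1,2) L2_on_interval_integrable[OF L2[OF order_refl]] that z(1)]
      L1[of 2] z(2) by simp
  then have d: "\<bar>deriv \<tau> x\<bar> \<le> ?N" if "x \<in> {0..1}" for x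
    using continuous_le_on_closure[of "{0<..<1::real}" "\<lambda>x. \<bar>deriv \<tau> x\<bar>" x ?N] that
      continuous_on_subset[OF \<tau>(2)] by (auto intro!: continuous_intros)
  then show "\<bar>deriv \<tau> t\<bar> \<le> ?N" using t .
  have le: "\<bar>\<tau> t\<bar> \<le> \<bar>\<tau> y\<bar> + ?N" if y: "y \<in> {0..1}" for y
  proof -
    have "norm (\<tau> t - \<tau> y) \<le> ?N * norm (t - y)"
      by (rule field_differentiable_bound[of "{0..1}" \<tau> "deriv \<tau>"])
        (use \<tau>(1) d t y in \<open>auto intro: has_field_derivative_at_within\<close>)
    moreover have "?N * norm (t - y) \<le> ?N * 1"
      using t y d[OF t] by (intro mult_left_mono) auto
    ultimately show ?thesis by simp
  qed
  have "integral {0..1::real} (\<lambda>y. \<bar>\<tau> t\<bar>) \<le> integral {0..1} (\<lambda>y. \<bar>\<tau> y\<bar> + ?N)"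
    by (rule Henstock_Kurzweil_Integration.integral_le[OF _ _ le]) (auto intro!: integrable_continuous_real continuous_intros \<tau>_cont)
  also have "\<dots> = integral {0..1} (\<lambda>y. \<bar>\<tau> y\<bar>) + ?N"
    by (subst Henstock_Kurzweil_Integration.integral_add) (auto intro!: integrable_continuous_real continuous_intros \<tau>_cont)
  also have "integral {0..1} (\<lambda>y. \<bar>\<tau> y\<bar>) \<le> ?N"
    using L1[of 0] continuous_on_integrable_Ioo(2)[of 0 1 "\<lambda>y. \<bar>\<tau> y\<bar>"] wd(3)
    by (simp add: \<tau>_cont continuous_intros)
  finally show "\<bar>\<tau> t\<bar> \<le> 2 * ?N" by simp
qed

lemma weak_derivative_on_add:
  fixes f g :: "real \<Rightarrow> real"
  assumes "weak_derivative_on {a<..<b} f f'" "weak_derivative_on {a<..<b} g g'"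
    and int: "integrable (lebesgue_on {a<..<b}) f" "integrable (lebesgue_on {a<..<b}) f'"
      "integrable (lebesgue_on {a<..<b}) g" "integrable (lebesgue_on {a<..<b}) g'"
  shows "weak_derivative_on {a<..<b} (\<lambda>x. f x + g x) (\<lambda>x. f' x + g' x)"
  unfolding weak_derivative_on_def real_scaleR_def
proof (intro allI impI)
  fix \<phi> \<phi>' :: "real \<Rightarrow> real" and K
  assume test: "(\<forall>x. (\<phi> has_real_derivative \<phi>' x) (at x)) \<and> continuous_on UNIV \<phi>' \<and>
        compact K \<and> K \<subseteq> {a<..<b} \<and> (\<forall>x. x \<notin> K \<longrightarrow> \<phi> x = 0)"
  obtain C where C: "\<And>x. \<bar>\<phi> x\<bar> \<le> C" "\<And>x. \<bar>\<phi>' x\<bar> \<le> C" "continuous_on UNIV \<phi>"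
    using test_function_bounded[of \<phi> \<phi>' K] test by metis
  have i: "integrable (lebesgue_on {a<..<b}) (\<lambda>x. \<phi> x * h x)"
    "integrable (lebesgue_on {a<..<b}) (\<lambda>x. \<phi>' x * h x)"
    if "integrable (lebesgue_on {a<..<b}) h" for h
    using integrable_bounded_continuous_times[OF that] C test by auto
  show "(LINT x|lebesgue_on {a<..<b}. \<phi>' x * (f x + g x)) = - (LINT x|lebesgue_on {a<..<b}. \<phi> x * (f' x + g' x))"
    using assms(1,2)[unfolded weak_derivative_on_def real_scaleR_def, rule_format, OF test] int
    by (simp add: distrib_left i)
qed

lemma sobolev_add:
  fixes f g :: "real \<Rightarrow> real"
  assumes "f \<in> sobolev k {a<..<b}" "g \<in> sobolev k {a<..<b}"
  shows "(\<lambda>x. f x + g x) \<in> sobolev k {a<..<b}"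
proof -
  obtain D D' where D: "weak_derivatives_on k {a<..<b} f D" "weak_derivatives_on k {a<..<b} g D'"
    using assms by (auto simp: sobolev_def)
  have L2: "(\<lambda>x. f x + g x) \<in> L2_on {a<..<b}" if "f \<in> L2_on {a<..<b}" "g \<in> L2_on {a<..<b}"
    for f g :: "real \<Rightarrow> real"
    unfolding L2_on_def
  proof safe
    have m: "f \<in> borel_measurable (lebesgue_on {a<..<b})" "g \<in> borel_measurable (lebesgue_on {a<..<b})"
      and i: "integrable (lebesgue_on {a<..<b}) (\<lambda>x. (f x)\<^sup>2)" "integrable (lebesgue_on {a<..<b}) (\<lambda>x. (g x)\<^sup>2)"
      using that by (auto simp: L2_on_def)
    then show fg: "(\<lambda>x. f x + g x) \<in> borel_measurable (lebesgue_on {a<..<b})" by simp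
    show "integrable (lebesgue_on {a<..<b}) (\<lambda>x. (norm (f x + g x))\<^sup>2)"
    proof (rule Bochner_Integration.integrable_bound)
      show "integrable (lebesgue_on {a<..<b}) (\<lambda>x. 2 * (f x)\<^sup>2 + 2 * (g x)\<^sup>2)" using i by simp
      show "(\<lambda>x. (norm (f x + g x))\<^sup>2) \<in> borel_measurable (lebesgue_on {a<..<b})" using fg by measurable
      have "(norm (f x + g x))\<^sup>2 \<le> 2 * (f x)\<^sup>2 + 2 * (g x)\<^sup>2" for x
        using zero_le_power2[of "f x - g x"] by (simp add: power2_eq_square algebra_simps)
      then show "AE x in lebesgue_on {a<..<b}. norm ((norm (f x + g x))\<^sup>2) \<le> norm (2 * (f x)\<^sup>2 + 2 * (g x)\<^sup>2)"
        by (auto intro!: AE_I2)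
    qed
  qed
  have "weak_derivatives_on k {a<..<b} (\<lambda>x. f x + g x) (\<lambda>j x. D j x + D' j x)"
    using D unfolding weak_derivatives_on_def
    by (auto intro!: L2 weak_derivative_on_add L2_on_interval_integrable)
  then show ?thesis by (auto simp: sobolev_def)
qed

lemma sobolev_scale:
  fixes f :: "real \<Rightarrow> real"
  assumes "f \<in> sobolev k S"
  shows "(\<lambda>x. r * f x) \<in> sobolev k S"
proof -
  obtain D where D: "weak_derivatives_on k S f D" using assms by (auto simp: sobolev_def)
  have "weak_derivative_on S (\<lambda>x. r * h x) (\<lambda>x. r * h' x)" if "weak_derivative_on S h h'" for h h' :: "real \<Rightarrow> real"
    unfolding weak_derivative_on_def
  proof (intro allI impI)
    fix \<phi> \<phi>' :: "real \<Rightarrow> real" and K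
    assume "(\<forall>x. (\<phi> has_real_derivative \<phi>' x) (at x)) \<and> continuous_on UNIV \<phi>' \<and>
        compact K \<and> K \<subseteq> S \<and> (\<forall>x. x \<notin> K \<longrightarrow> \<phi> x = 0)"
    from that[unfolded weak_derivative_on_def, rule_format, OF this]
    show "(LINT x|lebesgue_on S. \<phi>' x *\<^sub>R (r * h x)) = - (LINT x|lebesgue_on S. \<phi> x *\<^sub>R (r * h' x))"
      by (simp add: mult.left_commute[of _ r])
  qed
  then have "weak_derivatives_on k S (\<lambda>x. r * f x) (\<lambda>j x. r * D j x)"
    using D unfolding weak_derivatives_on_def by (auto simp: L2_on_def power_mult_distrib abs_mult)
  then show ?thesis by (auto simp: sobolev_def)
qed

lemma W_circle_add: "\<tau> \<in> W_circle k \<Longrightarrow> \<eta> \<in> W_circle k \<Longrightarrow> (\<lambda>t. \<tau> t + \<eta> t) \<in> W_circle k"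
  by (auto simp: W_circle_def sobolev_loc_def intro!: continuous_intros sobolev_add)

lemma W_circle_scale: "\<tau> \<in> W_circle k \<Longrightarrow> (\<lambda>t. r * \<tau> t) \<in> W_circle k"
  by (auto simp: W_circle_def sobolev_loc_def intro!: continuous_intros sobolev_scale)

lemma id_sobolev:
  assumes ab: "a < b" shows "(\<lambda>x::real. x) \<in> sobolev 2 {a<..<b}"
proof -
  define D where "D = (\<lambda>j::nat. if j = 0 then (\<lambda>x::real. x) else if j = 1 then (\<lambda>x. 1) else (\<lambda>x. 0))"
  have L2: "f \<in> L2_on {a<..<b}" if "continuous_on UNIV f" for f :: "real \<Rightarrow> real"
  proof -
    have "continuous_on {a..b} f" using that by (rule continuous_on_subset) simp
    moreover have "continuous_on {a..b} (\<lambda>x. (norm (f x))\<^sup>2)" by (intro continuous_intros calculation)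
    ultimately show ?thesis
      using continuous_on_integrable_Ioo(1)[of a b f]
        continuous_on_integrable_Ioo(1)[of a b "\<lambda>x. (norm (f x))\<^sup>2"] by (simp add: L2_on_def)
  qed
  have W: "weak_derivative_on {a<..<b} f f'"
    if "continuous_on UNIV f'" "\<And>x. (f has_real_derivative f' x) (at x)" for f f' :: "real \<Rightarrow> real"
    unfolding weak_derivative_on_def real_scaleR_def
  proof (intro allI impI)
    fix \<phi> \<phi>' :: "real \<Rightarrow> real" and K
    assume test: "(\<forall>x. (\<phi> has_real_derivative \<phi>' x) (at x)) \<and> continuous_on UNIV \<phi>' \<and>
        compact K \<and> K \<subseteq> {a<..<b} \<and> (\<forall>x. x \<notin> K \<longrightarrow> \<phi> x = 0)"
    have c: "continuous_on {a..b} \<phi>'" "continuous_on {a..b} f'"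
      using conjunct1[OF conjunct2[OF test]] that(1) by (auto elim: continuous_on_subset)
    have c': "continuous_on {a..b} \<phi>" "continuous_on {a..b} f"
      using conjunct1[OF test] that(2) by (meson DERIV_isCont continuous_at_imp_continuous_on)+
    have "\<phi> a = 0" "\<phi> b = 0" using test by auto
    then have "integral {a..b} (\<lambda>x. \<phi>' x * f x) = - integral {a..b} (\<lambda>x. \<phi> x * f' x)"
      using test that ab c c' by (intro integral_primitive_times) auto
    then show "(LINT x|lebesgue_on {a<..<b}. \<phi>' x * f x) = - (LINT x|lebesgue_on {a<..<b}. \<phi> x * f' x)"
      using c c' by (simp add: continuous_on_integrable_Ioo(2) continuous_on_mult)
  qed
  have "weak_derivatives_on 2 {a<..<b} (\<lambda>x. x) D"
    unfolding weak_derivatives_on_def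
    by (auto simp: D_def less_2_cases_iff intro!: L2 W continuous_intros derivative_eq_intros)
  then show ?thesis by (auto simp: sobolev_def)
qed


section \<open>Iterated tangent vectors and integrands\<close>

fun C1_towers :: "nat \<Rightarrow> (real \<Rightarrow> real) tower set" where
  "C1_towers 0 = Pt ` C1"
| "C1_towers (Suc n) = {Tan x h |x h. x \<in> C1_towers n \<and> h \<in> C1_towers n}"

text \<open>The \<open>C\<^sup>1\<close> norms of all functions in an iterated tangent vector, added up. By periodicity one period
  carries all the information.\<close>

primrec c1size :: "(real \<Rightarrow> real) tower \<Rightarrow> real" where
  "c1size (Pt \<tau>) = (SUP t\<in>{0..1}. \<bar>\<tau> t\<bar>) + (SUP t\<in>{0..1}. \<bar>deriv \<tau> t\<bar>)"
| "c1size (Tan x h) = c1size x + c1size h"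

definition model_tower :: "nat \<Rightarrow> (real \<Rightarrow> real) tower sc_space" where
  "model_tower n = (tangent_space ^^ n) model_space"

definition real_tower :: "nat \<Rightarrow> real tower sc_space" where
  "real_tower n = (tangent_space ^^ n) real_space"

lemma model_tower_simps [simp]:
  "model_tower 0 = model_space" "model_tower (Suc n) = tangent_space (model_tower n)"
  by (simp_all add: model_tower_def)

lemma real_tower_simps [simp]:
  "real_tower 0 = real_space" "real_tower (Suc n) = tangent_space (real_tower n)"
  by (simp_all add: real_tower_def)

text \<open>The projections of an \<open>n\<close>-fold iterated tangent vector to the \<open>2\<^sup>n\<close> functions of which it
  consists.\<close>

inductive leaf :: "nat \<Rightarrow> ((real \<Rightarrow> real) tower \<Rightarrow> real \<Rightarrow> real) \<Rightarrow> bool" where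
  leaf_pt: "leaf 0 pt"
| leaf_base: "leaf n l \<Longrightarrow> leaf (Suc n) (\<lambda>z. l (base z))"
| leaf_dir: "leaf n l \<Longrightarrow> leaf (Suc n) (\<lambda>z. l (dir z))"

text \<open>The underlying point of an iterated tangent vector. It is the only component that is subject to the
  smallness condition of a chart, and the only one on which the integrands depend nonlinearly.\<close>

primrec root_fun :: "nat \<Rightarrow> (real \<Rightarrow> real) tower \<Rightarrow> real \<Rightarrow> real" where
  "root_fun 0 = pt"
| "root_fun (Suc n) = (\<lambda>z. root_fun n (base z))"

lemma leaf_root_fun: "leaf n (root_fun n)"
proof (induction n)
  case 0
  show ?case using leaf_pt by simp
next
  case (Suc n)
  show ?case using leaf_base[OF Suc] by simp
qed

lemma leaf_vadd: "leaf n l \<Longrightarrow> l (vadd (model_tower n) z w) = (\<lambda>t. l z t + l w t)"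
  by (induction arbitrary: z w rule: leaf.induct) (auto simp: model_space_def tangent_space_def)

lemma leaf_vscale: "leaf n l \<Longrightarrow> l (vscale (model_tower n) r z) = (\<lambda>t. r * l z t)"
  by (induction arbitrary: z rule: leaf.induct) (auto simp: model_space_def tangent_space_def)

lemma C1_D:
  assumes "\<tau> \<in> C1"
  shows "(\<tau> has_real_derivative deriv \<tau> t) (at t)" "continuous_on S \<tau>" "continuous_on S (deriv \<tau>)"
proof -
  show d: "(\<tau> has_real_derivative deriv \<tau> t) (at t)" for t using assms by (simp add: C1_def)
  then show "continuous_on S \<tau>" by (meson DERIV_isCont continuous_at_imp_continuous_on)
  show "continuous_on S (deriv \<tau>)"
    using assms unfolding C1_def by (auto elim: continuous_on_subset)
qed

lemma deriv_C1_add: "\<tau> \<in> C1 \<Longrightarrow> \<eta> \<in> C1 \<Longrightarrow> deriv (\<lambda>t. \<tau> t + \<eta> t) = (\<lambda>t. deriv \<tau> t + deriv \<eta> t)"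
  by (intro ext DERIV_imp_deriv DERIV_add C1_D)

lemma deriv_C1_scale: "\<tau> \<in> C1 \<Longrightarrow> deriv (\<lambda>t. r * \<tau> t) = (\<lambda>t. r * deriv \<tau> t)"
  by (intro ext DERIV_imp_deriv DERIV_cmult C1_D)

lemma C1_add: "\<tau> \<in> C1 \<Longrightarrow> \<eta> \<in> C1 \<Longrightarrow> (\<lambda>t. \<tau> t + \<eta> t) \<in> C1"
  by (subst C1_def) (auto simp: deriv_C1_add intro!: DERIV_add continuous_on_add C1_D(1,3))

lemma C1_scale: "\<tau> \<in> C1 \<Longrightarrow> (\<lambda>t. r * \<tau> t) \<in> C1"
  by (subst C1_def) (auto simp: deriv_C1_scale intro!: DERIV_cmult continuous_on_mult_left C1_D(1,3))

lemma leaf_C1: "leaf n l \<Longrightarrow> z \<in> C1_towers n \<Longrightarrow> l z \<in> C1"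
  by (induction arbitrary: z rule: leaf.induct) auto

lemma C1_le_SUP:
  assumes "\<tau> \<in> C1" "t \<in> {0..1}"
  shows "\<bar>\<tau> t\<bar> \<le> (SUP t\<in>{0..1}. \<bar>\<tau> t\<bar>)" "\<bar>deriv \<tau> t\<bar> \<le> (SUP t\<in>{0..1}. \<bar>deriv \<tau> t\<bar>)"
proof -
  have *: "bdd_above ((\<lambda>t. \<bar>f t\<bar>) ` {0..1})" if "continuous_on {0..1} f" for f :: "real \<Rightarrow> real"
    using that by (intro bounded_imp_bdd_above compact_imp_bounded compact_continuous_image continuous_intros) auto
  show "\<bar>\<tau> t\<bar> \<le> (SUP t\<in>{0..1}. \<bar>\<tau> t\<bar>)" "\<bar>deriv \<tau> t\<bar> \<le> (SUP t\<in>{0..1}. \<bar>deriv \<tau> t\<bar>)"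
    using assms C1_D by (auto intro!: cSUP_upper *)
qed

lemma c1size_nonneg: "z \<in> C1_towers n \<Longrightarrow> 0 \<le> c1size z"
proof (induction n arbitrary: z)
  case 0
  then obtain \<tau> where "z = Pt \<tau>" "\<tau> \<in> C1" by auto
  then show ?case using C1_le_SUP[of \<tau> 0] by (simp add: order_trans[OF abs_ge_zero])
qed auto

lemma leaf_le_c1size:
  "leaf n l \<Longrightarrow> z \<in> C1_towers n \<Longrightarrow> t \<in> {0..1} \<Longrightarrow> \<bar>l z t\<bar> \<le> c1size z \<and> \<bar>deriv (l z) t\<bar> \<le> c1size z"
proof (induction arbitrary: z rule: leaf.induct)
  case leaf_pt
  then obtain \<tau> where "z = Pt \<tau>" "\<tau> \<in> C1" by auto
  then show ?case using C1_le_SUP[of \<tau> t] leaf_pt by (auto intro: order_trans[OF abs_ge_zero] add_increasing add_increasing2)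
next
  case (leaf_base n l)
  then obtain x h where "z = Tan x h" "x \<in> C1_towers n" "h \<in> C1_towers n" by auto
  then show ?case using leaf_base.IH[of x] leaf_base.prems c1size_nonneg[of h n] by force
next
  case (leaf_dir n l)
  then obtain x h where "z = Tan x h" "x \<in> C1_towers n" "h \<in> C1_towers n" by auto
  then show ?case using leaf_dir.IH[of h] leaf_dir.prems c1size_nonneg[of x n] by force
qed

lemma level_model_tower_C1: "z \<in> level (model_tower n) m \<Longrightarrow> z \<in> C1_towers n"
proof (induction n arbitrary: z m)
  case 0
  then show ?case using W_circle_C1 by (auto simp: model_space_def)
qed (auto simp: tangent_space_def)

text \<open>Every level norm dominates the \<open>C\<^sup>1\<close> norm. Estimates in the \<open>C\<^sup>1\<close> norm therefore hold on all levels
  at once.\<close>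

lemma c1size_le_lnorm: "z \<in> level (model_tower n) m \<Longrightarrow> c1size z \<le> 3 * lnorm (model_tower n) m z"
proof (induction n arbitrary: z m)
  case 0
  then obtain \<tau> where z: "z = Pt \<tau>" "\<tau> \<in> W_circle (m + 2)" by (auto simp: model_space_def)
  have "(SUP t\<in>{0..1}. \<bar>\<tau> t\<bar>) \<le> 2 * W_circle_norm (m + 2) \<tau>"
    by (rule cSUP_least) (use W_circle_sup_bounds[OF z(2)] in auto)
  moreover have "(SUP t\<in>{0..1}. \<bar>deriv \<tau> t\<bar>) \<le> W_circle_norm (m + 2) \<tau>"
    by (rule cSUP_least) (use W_circle_sup_bounds[OF z(2)] in auto)
  ultimately show ?case using z by (simp add: model_space_def)
next
  case (Suc n)
  then obtain x h where z: "z = Tan x h" "x \<in> level (model_tower n) (Suc m)" "h \<in> level (model_tower n) m"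
    by (auto simp: tangent_space_def)
  show ?case using Suc.IH[OF z(2)] Suc.IH[OF z(3)] z(1) by (simp add: tangent_space_def)
qed

lemma level_model_tower_vadd:
  "x \<in> level (model_tower n) m \<Longrightarrow> y \<in> level (model_tower n) m \<Longrightarrow> vadd (model_tower n) x y \<in> level (model_tower n) m"
  by (induction n arbitrary: x y m) (auto simp: model_space_def tangent_space_def W_circle_add simp del: add_2_eq_Suc')

lemma level_model_tower_vscale:
  "x \<in> level (model_tower n) m \<Longrightarrow> vscale (model_tower n) r x \<in> level (model_tower n) m"
  by (induction n arbitrary: x m) (auto simp: model_space_def tangent_space_def W_circle_scale simp del: add_2_eq_Suc')

lemma vadd_vdiff:
  "x \<in> C1_towers n \<Longrightarrow> y \<in> C1_towers n \<Longrightarrow> vadd (model_tower n) x (vdiff (model_tower n) y x) = y"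
  by (induction n arbitrary: x y) (auto simp: model_space_def tangent_space_def vdiff_def)

text \<open>The possible values of \<open>(t, \<tau> t, \<tau>' t)\<close> for \<open>\<bar>\<tau>\<bar> < \<epsilon>\<close>.\<close>

definition tube :: "real \<Rightarrow> (real \<times> real \<times> real) set" where
  "tube \<epsilon> = UNIV \<times> {-\<epsilon><..<\<epsilon>} \<times> UNIV"

lemma open_tube: "open (tube \<epsilon>)"
  unfolding tube_def by (intro open_Times) auto

definition small_towers :: "real \<Rightarrow> nat \<Rightarrow> (real \<Rightarrow> real) tower set" where
  "small_towers \<epsilon> n = {z \<in> C1_towers n. \<forall>t. \<bar>root_fun n z t\<bar> < \<epsilon>}"

lemma Tan_small_towers:
  "Tan x h \<in> small_towers \<epsilon> (Suc n) \<longleftrightarrow> x \<in> small_towers \<epsilon> n \<and> h \<in> C1_towers n"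
  by (auto simp: small_towers_def)

text \<open>The integrands of the iterated tangent maps: polynomials in the functions of an iterated tangent
  vector and their derivatives, with coefficients that are smooth functions of \<open>t\<close> and of the first jet
  of the underlying point. This class contains the integrand of the length functional and is closed
  under differentiation.\<close>

inductive nemytskii :: "real \<Rightarrow> nat \<Rightarrow> ((real \<Rightarrow> real) tower \<Rightarrow> real \<Rightarrow> real) \<Rightarrow> bool" for \<epsilon> where
  nem_kernel: "smooth_on K (tube \<epsilon>) \<Longrightarrow> nemytskii \<epsilon> n (\<lambda>z t. K (t, root_fun n z t, deriv (root_fun n z) t))"
| nem_leaf: "leaf n l \<Longrightarrow> nemytskii \<epsilon> n (\<lambda>z t. l z t)"
| nem_leaf_deriv: "leaf n l \<Longrightarrow> nemytskii \<epsilon> n (\<lambda>z t. deriv (l z) t)"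
| nem_add: "nemytskii \<epsilon> n N1 \<Longrightarrow> nemytskii \<epsilon> n N2 \<Longrightarrow> nemytskii \<epsilon> n (\<lambda>z t. N1 z t + N2 z t)"
| nem_mult: "nemytskii \<epsilon> n N1 \<Longrightarrow> nemytskii \<epsilon> n N2 \<Longrightarrow> nemytskii \<epsilon> n (\<lambda>z t. N1 z t * N2 z t)"

lemma nemytskii_base: "nemytskii \<epsilon> n N \<Longrightarrow> nemytskii \<epsilon> (Suc n) (\<lambda>z. N (base z))"
proof (induction rule: nemytskii.induct)
  case (nem_kernel K n)
  then show ?case using nemytskii.nem_kernel[of K \<epsilon> "Suc n"] by simp
next
  case (nem_leaf n l)
  show ?case by (rule nemytskii.nem_leaf[OF leaf_base[OF nem_leaf]])
next
  case (nem_leaf_deriv n l)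
  show ?case by (rule nemytskii.nem_leaf_deriv[OF leaf_base[OF nem_leaf_deriv]])
next
  case (nem_add n N1 N2)
  show ?case by (rule nemytskii.nem_add[OF nem_add.IH])
next
  case (nem_mult n N1 N2)
  show ?case by (rule nemytskii.nem_mult[OF nem_mult.IH])
qed

lemma nemytskii_continuous:
  "nemytskii \<epsilon> n N \<Longrightarrow> z \<in> small_towers \<epsilon> n \<Longrightarrow> continuous_on {0..1} (N z)"
proof (induction rule: nemytskii.induct)
  case (nem_kernel K n)
  have r: "root_fun n z \<in> C1" using nem_kernel leaf_C1[OF leaf_root_fun] by (auto simp: small_towers_def)
  have "continuous_on (tube \<epsilon>) K" using nem_kernel(1) Ck_on_imp_continuous_on by (auto simp: smooth_on_def)
  then show ?case
    by (rule continuous_on_compose2)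
      (use nem_kernel(2) C1_D[OF r] in \<open>auto intro!: continuous_intros simp: tube_def small_towers_def abs_less_iff minus_less_iff\<close>)
next
  case (nem_leaf n l)
  then show ?case using C1_D(2)[OF leaf_C1] by (simp add: small_towers_def)
next
  case (nem_leaf_deriv n l)
  then show ?case using C1_D(3)[OF leaf_C1] by (simp add: small_towers_def)
next
  case (nem_add n N1 N2)
  show ?case by (rule continuous_on_add[OF nem_add.IH[OF nem_add.prems]])
next
  case (nem_mult n N1 N2)
  show ?case by (rule continuous_on_mult[OF nem_mult.IH[OF nem_mult.prems]])
qed

text \<open>The linear approximation of \<open>K\<close> is uniform along a compact curve, because by the mean value theorem
  the error is a difference of partial derivatives at points of a compact neighbourhood, where these
  are uniformly continuous. Only displacements in the last two variables occur, as \<open>t\<close> is never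
  perturbed.\<close>

lemma uniform_linearization:
  fixes K :: "real \<times> real \<times> real \<Rightarrow> real"
  assumes K: "smooth_on K (tube \<epsilon>)" and a: "continuous_on {0..1} a" "\<And>t. \<bar>a t\<bar> < \<epsilon>"
    and b: "continuous_on {0..1} b" and e: "e > 0"
  defines "Ka \<equiv> \<lambda>p. frechet_derivative K (at p) (0, 1, 0)"
    and "Kb \<equiv> \<lambda>p. frechet_derivative K (at p) (0, 0, 1)"
  obtains d where "d > 0" "\<And>t u v. t \<in> {0..1} \<Longrightarrow> \<bar>u\<bar> < d \<Longrightarrow> \<bar>v\<bar> < d \<Longrightarrow>
    \<bar>K (t, a t + u, b t + v) - K (t, a t, b t) - (Ka (t, a t, b t) * u + Kb (t, a t, b t) * v)\<bar> \<le> e * (\<bar>u\<bar> + \<bar>v\<bar>)"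
proof -
  define q where "q = (\<lambda>t. (t, a t, b t))"
  have "compact (q ` {0..1})"
    unfolding q_def by (intro compact_continuous_image continuous_intros a b) auto
  moreover have "q ` {0..1} \<subseteq> tube \<epsilon>" using a(2) by (auto simp: q_def tube_def abs_less_iff minus_less_iff)
  ultimately obtain r where r: "r > 0" "(\<Union>x\<in>q ` {0..1}. cball x r) \<subseteq> tube \<epsilon>"
    using compact_subset_open_imp_cball_epsilon_subset[OF _ open_tube] by metis
  define Q where "Q = {x + y |x y. x \<in> q ` {0..1} \<and> y \<in> cball 0 r}"
  have Q_compact: "compact Q"
    unfolding Q_def using \<open>compact (q ` {0..1})\<close> by (rule compact_sums) simp
  have Q_I: "q t + w \<in> Q" if "t \<in> {0..1}" "norm w \<le> r" for t w
    using that unfolding Q_def by (intro CollectI exI[of _ "q t"] exI[of _ w]) simp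
  have Q_sub: "Q \<subseteq> tube \<epsilon>"
  proof
    fix p assume "p \<in> Q"
    then obtain x y where xy: "x \<in> q ` {0..1}" "y \<in> cball 0 r" "p = x + y" unfolding Q_def by blast
    then obtain t where "t \<in> {0..1}" "x = q t" by blast
    with xy have ty: "t \<in> {0..1}" "norm y \<le> r" "p = q t + y" by auto
    then have "p \<in> cball (q t) r" by (simp add: dist_norm)
    with ty r show "p \<in> tube \<epsilon>" by blast
  qed
  have "uniformly_continuous_on Q Ka" "uniformly_continuous_on Q Kb"
    unfolding Ka_def Kb_def
    using smooth_on_derivative[OF K open_tube] Ck_on_imp_continuous_on Q_sub Q_compact
    by (meson compact_uniformly_continuous continuous_on_subset smooth_on_def)+
  then obtain d1 d2 where d12: "d1 > 0" "d2 > 0"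
    "\<And>x y. x \<in> Q \<Longrightarrow> y \<in> Q \<Longrightarrow> dist y x < d1 \<Longrightarrow> dist (Ka y) (Ka x) < e"
    "\<And>x y. x \<in> Q \<Longrightarrow> y \<in> Q \<Longrightarrow> dist y x < d2 \<Longrightarrow> dist (Kb y) (Kb x) < e"
    using e unfolding uniformly_continuous_on_def by metis
  define d where "d = min r (min d1 d2) / 2"
  show thesis
  proof (rule that)
    show "d > 0" using r d12 by (simp add: d_def)
    fix t u v assume t: "t \<in> {0..1::real}" and uv: "\<bar>u\<bar> < d" "\<bar>v\<bar> < d"
    define w where "w = (0::real, u, v)"
    have "norm w \<le> \<bar>u\<bar> + \<bar>v\<bar>" unfolding w_def norm_Pair by (simp add: sqrt_sum_squares_le_sum_abs)
    then have w: "norm w < min r (min d1 d2)" using uv by (simp add: d_def)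
    have sw: "norm (s *\<^sub>R w) < min r (min d1 d2)" if "s \<in> {0..1}" for s
      using that w mult_left_le_one_le[of "norm w" "\<bar>s\<bar>"] by auto
    have inQ: "q t + s *\<^sub>R w \<in> Q" if "s \<in> {0..1}" for s using Q_I[OF t] sw[OF that] by auto
    have lin: "frechet_derivative K (at p) w = Ka p * u + Kb p * v" if "p \<in> tube \<epsilon>" for p
    proof -
      have l: "linear (frechet_derivative K (at p))"
        using smooth_on_differentiable[OF K that] has_derivative_linear by blast
      have "w = u *\<^sub>R (0, 1, 0) + v *\<^sub>R (0, 0, 1)" by (simp add: w_def)
      then have "frechet_derivative K (at p) w =
          u *\<^sub>R frechet_derivative K (at p) (0, 1, 0) + v *\<^sub>R frechet_derivative K (at p) (0, 0, 1)"
        by (simp only: linear_add[OF l] linear_cmul[OF l])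
      then show ?thesis by (simp add: Ka_def Kb_def mult.commute)
    qed
    have "((\<lambda>s. K (q t + s *\<^sub>R w)) has_real_derivative Ka (q t + s *\<^sub>R w) * u + Kb (q t + s *\<^sub>R w) * v) (at s)"
      if "s \<in> {0..1}" for s
    proof -
      have p: "q t + s *\<^sub>R w \<in> tube \<epsilon>" using inQ[OF that] Q_sub by blast
      have "((\<lambda>s. K (q t + s *\<^sub>R w)) has_derivative (\<lambda>k. frechet_derivative K (at (q t + s *\<^sub>R w)) (k *\<^sub>R w))) (at s)"
        by (rule has_derivative_compose[where f = "\<lambda>s. q t + s *\<^sub>R w" and g = K])
          (use smooth_on_differentiable[OF K p] in \<open>auto intro!: derivative_eq_intros\<close>)
      moreover have "frechet_derivative K (at (q t + s *\<^sub>R w)) (k *\<^sub>R w) = (Ka (q t + s *\<^sub>R w) * u + Kb (q t + s *\<^sub>R w) * v) * k" for k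
        using linear_cmul[OF has_derivative_linear[OF smooth_on_differentiable[OF K p]]] lin[OF p] by simp
      ultimately show ?thesis by (simp add: has_field_derivative_def)
    qed
    then obtain s where s: "0 < s" "s < 1"
      "K (q t + 1 *\<^sub>R w) - K (q t + 0 *\<^sub>R w) = (1 - 0) * (Ka (q t + s *\<^sub>R w) * u + Kb (q t + s *\<^sub>R w) * v)"
      using MVT2[of 0 1 "\<lambda>s. K (q t + s *\<^sub>R w)" "\<lambda>s. Ka (q t + s *\<^sub>R w) * u + Kb (q t + s *\<^sub>R w) * v"] by auto
    let ?p = "q t + s *\<^sub>R w"
    have "dist ?p (q t) < min r (min d1 d2)" using sw[of s] s by (simp add: dist_norm)
    moreover have "q t \<in> Q" "?p \<in> Q" using inQ[of 0] inQ[of s] s by auto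
    ultimately have "\<bar>Ka ?p - Ka (q t)\<bar> \<le> e" "\<bar>Kb ?p - Kb (q t)\<bar> \<le> e"
      using d12(3)[of "q t" ?p] d12(4)[of "q t" ?p] by (auto simp: dist_real_def)
    then have "\<bar>(Ka ?p - Ka (q t)) * u + (Kb ?p - Kb (q t)) * v\<bar> \<le> e * \<bar>u\<bar> + e * \<bar>v\<bar>"
      by (intro order_trans[OF abs_triangle_ineq] add_mono) (auto simp: abs_mult intro: mult_right_mono)
    moreover have "K (t, a t + u, b t + v) - K (t, a t, b t) = Ka ?p * u + Kb ?p * v"
      using s(3) by (simp add: q_def w_def)
    ultimately show "\<bar>K (t, a t + u, b t + v) - K (t, a t, b t) - (Ka (t, a t, b t) * u + Kb (t, a t, b t) * v)\<bar> \<le> e * (\<bar>u\<bar> + \<bar>v\<bar>)"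
      by (simp add: q_def algebra_simps)
  qed
qed


section \<open>Differentiability of the integrands in the supremum norm\<close>

text \<open>Frechet differentiability of an operator from \<open>C\<^sup>1\<close> to the continuous functions on the unit
  interval with the supremum norm.\<close>

definition has_sup_derivative ::
    "nat \<Rightarrow> ((real \<Rightarrow> real) tower \<Rightarrow> real \<Rightarrow> real) \<Rightarrow> (real \<Rightarrow> real) tower \<Rightarrow>
      ((real \<Rightarrow> real) tower \<Rightarrow> real \<Rightarrow> real) \<Rightarrow> bool" where
  "has_sup_derivative n N x A \<longleftrightarrow>
    (\<forall>h\<in>C1_towers n. \<forall>k\<in>C1_towers n. \<forall>t\<in>{0..1}. A (vadd (model_tower n) h k) t = A h t + A k t) \<and>
    (\<forall>r. \<forall>h\<in>C1_towers n. \<forall>t\<in>{0..1}. A (vscale (model_tower n) r h) t = r * A h t) \<and>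
    (\<exists>C\<ge>0. \<forall>h\<in>C1_towers n. \<forall>t\<in>{0..1}. \<bar>A h t\<bar> \<le> C * c1size h) \<and>
    (\<forall>e>0. \<exists>d>0. \<forall>h\<in>C1_towers n. c1size h < d \<longrightarrow>
      (\<forall>t\<in>{0..1}. \<bar>N (vadd (model_tower n) x h) t - N x t - A h t\<bar> \<le> e * c1size h))"

lemma has_sup_derivative_leaf:
  assumes "leaf n l" shows "has_sup_derivative n (\<lambda>z t. l z t) x (\<lambda>h t. l h t)"
  unfolding has_sup_derivative_def
  using assms leaf_le_c1size[OF assms] c1size_nonneg
  by (auto simp: leaf_vadd leaf_vscale intro!: exI[of _ 1])

lemma has_sup_derivative_leaf_deriv:
  assumes l: "leaf n l" and x: "x \<in> C1_towers n"
  shows "has_sup_derivative n (\<lambda>z t. deriv (l z) t) x (\<lambda>h t. deriv (l h) t)"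
proof -
  have "deriv (l (vadd (model_tower n) h k)) = (\<lambda>t. deriv (l h) t + deriv (l k) t)"
    if "h \<in> C1_towers n" "k \<in> C1_towers n" for h k
    using that by (simp add: leaf_vadd[OF l] deriv_C1_add leaf_C1[OF l])
  moreover have "deriv (l (vscale (model_tower n) r h)) = (\<lambda>t. r * deriv (l h) t)"
    if "h \<in> C1_towers n" for h r
    using that by (simp add: leaf_vscale[OF l] deriv_C1_scale leaf_C1[OF l])
  ultimately show ?thesis
    unfolding has_sup_derivative_def using leaf_le_c1size[OF l] c1size_nonneg x
    by (auto intro!: exI[of _ 1])
qed

lemma has_sup_derivative_add:
  assumes "has_sup_derivative n N1 x A1" "has_sup_derivative n N2 x A2"
  shows "has_sup_derivative n (\<lambda>z t. N1 z t + N2 z t) x (\<lambda>h t. A1 h t + A2 h t)"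
proof -
  obtain C1 C2 where C: "C1 \<ge> 0" "C2 \<ge> 0"
    "\<And>h t. h \<in> C1_towers n \<Longrightarrow> t \<in> {0..1} \<Longrightarrow> \<bar>A1 h t\<bar> \<le> C1 * c1size h"
    "\<And>h t. h \<in> C1_towers n \<Longrightarrow> t \<in> {0..1} \<Longrightarrow> \<bar>A2 h t\<bar> \<le> C2 * c1size h"
    using assms unfolding has_sup_derivative_def by metis
  have "\<bar>A1 h t + A2 h t\<bar> \<le> (C1 + C2) * c1size h" if "h \<in> C1_towers n" "t \<in> {0..1}" for h t
    using C(3,4)[OF that] abs_triangle_ineq[of "A1 h t" "A2 h t"] by (simp add: distrib_right)
  moreover have "\<exists>d>0. \<forall>h\<in>C1_towers n. c1size h < d \<longrightarrow> (\<forall>t\<in>{0..1}.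
      \<bar>N1 (vadd (model_tower n) x h) t + N2 (vadd (model_tower n) x h) t - (N1 x t + N2 x t) - (A1 h t + A2 h t)\<bar> \<le> e * c1size h)"
    if "e > 0" for e
  proof -
    from that have e2: "e / 2 > 0" by simp
    obtain d1 where d1: "d1 > 0" "\<And>h t. h \<in> C1_towers n \<Longrightarrow> c1size h < d1 \<Longrightarrow> t \<in> {0..1} \<Longrightarrow>
        \<bar>N1 (vadd (model_tower n) x h) t - N1 x t - A1 h t\<bar> \<le> e / 2 * c1size h"
      using assms(1) e2 unfolding has_sup_derivative_def by meson
    obtain d2 where d2: "d2 > 0" "\<And>h t. h \<in> C1_towers n \<Longrightarrow> c1size h < d2 \<Longrightarrow> t \<in> {0..1} \<Longrightarrow>
        \<bar>N2 (vadd (model_tower n) x h) t - N2 x t - A2 h t\<bar> \<le> e / 2 * c1size h"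
      using assms(2) e2 unfolding has_sup_derivative_def by meson
    have "\<bar>N1 (vadd (model_tower n) x h) t + N2 (vadd (model_tower n) x h) t - (N1 x t + N2 x t) - (A1 h t + A2 h t)\<bar> \<le> e * c1size h"
      if "h \<in> C1_towers n" "c1size h < min d1 d2" "t \<in> {0..1}" for h t
    proof -
      let ?r1 = "N1 (vadd (model_tower n) x h) t - N1 x t - A1 h t"
      let ?r2 = "N2 (vadd (model_tower n) x h) t - N2 x t - A2 h t"
      have "\<bar>?r1 + ?r2\<bar> \<le> e / 2 * c1size h + e / 2 * c1size h"
        using d1(2)[of h t] d2(2)[of h t] that by (intro order_trans[OF abs_triangle_ineq] add_mono) auto
      moreover have "N1 (vadd (model_tower n) x h) t + N2 (vadd (model_tower n) x h) t - (N1 x t + N2 x t) - (A1 h t + A2 h t) = ?r1 + ?r2"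
        by simp
      ultimately show ?thesis by (simp only:)
    qed
    then show ?thesis using d1(1) d2(1) by (intro exI[of _ "min d1 d2"]) auto
  qed
  ultimately show ?thesis
    using assms C(1,2) unfolding has_sup_derivative_def
    by (auto simp: distrib_left intro!: exI[of _ "C1 + C2"])
qed

lemma continuous_unit_interval_bounded:
  fixes f :: "real \<Rightarrow> real"
  assumes "continuous_on {0..1} f"
  obtains B where "B \<ge> 0" "\<And>t. t \<in> {0..1} \<Longrightarrow> \<bar>f t\<bar> \<le> B"
proof -
  have "bounded (f ` {0..1})" by (intro compact_imp_bounded compact_continuous_image assms compact_Icc)
  then obtain B where B: "\<And>t. t \<in> {0..1} \<Longrightarrow> \<bar>f t\<bar> \<le> B" unfolding bounded_iff by (metis imageI real_norm_def)
  then show thesis using that[of "max 0 B"] by (meson max.cobounded1 max.coboundedI2)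
qed

text \<open>With remainders \<open>r1\<close> and \<open>r2\<close> of the factors, the remainder of the product is
  \<open>r1 N2 + N1 r2\<close> plus the product of the two increments, and the latter is quadratic in the size of \<open>h\<close>.\<close>

lemma has_sup_derivative_mult:
  assumes D: "has_sup_derivative n N1 x A1" "has_sup_derivative n N2 x A2"
    and cont: "continuous_on {0..1} (N1 x)" "continuous_on {0..1} (N2 x)"
  shows "has_sup_derivative n (\<lambda>z t. N1 z t * N2 z t) x (\<lambda>h t. A1 h t * N2 x t + N1 x t * A2 h t)"
proof -
  obtain C1 C2 where C: "C1 \<ge> 0" "C2 \<ge> 0"
    "\<And>h t. h \<in> C1_towers n \<Longrightarrow> t \<in> {0..1} \<Longrightarrow> \<bar>A1 h t\<bar> \<le> C1 * c1size h"
    "\<And>h t. h \<in> C1_towers n \<Longrightarrow> t \<in> {0..1} \<Longrightarrow> \<bar>A2 h t\<bar> \<le> C2 * c1size h"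
    using D unfolding has_sup_derivative_def by metis
  obtain B1 where B1: "B1 \<ge> 0" "\<And>t. t \<in> {0..1} \<Longrightarrow> \<bar>N1 x t\<bar> \<le> B1"
    by (rule continuous_unit_interval_bounded[OF cont(1)]) blast
  obtain B2 where B2: "B2 \<ge> 0" "\<And>t. t \<in> {0..1} \<Longrightarrow> \<bar>N2 x t\<bar> \<le> B2"
    by (rule continuous_unit_interval_bounded[OF cont(2)]) blast
  note B = B1(1) B2(1) B1(2) B2(2)
  have "\<bar>A1 h t * N2 x t + N1 x t * A2 h t\<bar> \<le> (C1 * B2 + B1 * C2) * c1size h" if "h \<in> C1_towers n" "t \<in> {0..1}" for h t
  proof -
    have "\<bar>A1 h t * N2 x t\<bar> \<le> (C1 * c1size h) * B2" "\<bar>N1 x t * A2 h t\<bar> \<le> B1 * (C2 * c1size h)"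
      unfolding abs_mult using C B that c1size_nonneg[OF that(1)] by (auto intro!: mult_mono)
    then show ?thesis using abs_triangle_ineq[of "A1 h t * N2 x t" "N1 x t * A2 h t"] by (simp add: algebra_simps)
  qed
  moreover have "\<exists>d>0. \<forall>h\<in>C1_towers n. c1size h < d \<longrightarrow> (\<forall>t\<in>{0..1}.
      \<bar>N1 (vadd (model_tower n) x h) t * N2 (vadd (model_tower n) x h) t - N1 x t * N2 x t - (A1 h t * N2 x t + N1 x t * A2 h t)\<bar> \<le> e * c1size h)"
    if e: "e > 0" for e
  proof -
    \<comment> \<open>The remainders of the factors take up half of the error, and the product of the increments the other half.\<close>
    define e' where "e' = min 1 (e / (2 * (B1 + B2 + 1)))"
    have e': "e' > 0" "e' \<le> 1" using e B by (auto simp: e'_def)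
    have "e' * (B1 + B2) \<le> e / (2 * (B1 + B2 + 1)) * (B1 + B2 + 1)"
      using e B by (intro mult_mono) (auto simp: e'_def)
    also have "\<dots> = e / 2" using B by (simp add: field_simps)
    finally have e'B: "e' * (B1 + B2) \<le> e / 2" .
    obtain d1 where d1: "d1 > 0" "\<And>h t. h \<in> C1_towers n \<Longrightarrow> c1size h < d1 \<Longrightarrow> t \<in> {0..1} \<Longrightarrow>
        \<bar>N1 (vadd (model_tower n) x h) t - N1 x t - A1 h t\<bar> \<le> e' * c1size h"
      using D(1) e'(1) unfolding has_sup_derivative_def by meson
    obtain d2 where d2: "d2 > 0" "\<And>h t. h \<in> C1_towers n \<Longrightarrow> c1size h < d2 \<Longrightarrow> t \<in> {0..1} \<Longrightarrow>
        \<bar>N2 (vadd (model_tower n) x h) t - N2 x t - A2 h t\<bar> \<le> e' * c1size h"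
      using D(2) e'(1) unfolding has_sup_derivative_def by meson
    define p where "p = (C1 + 1) * (C2 + 1)"
    have p: "p > 0" unfolding p_def using C(1,2) by (intro mult_pos_pos) auto
    define d3 where "d3 = e / (2 * p)"
    have d3: "d3 > 0" "p * d3 = e / 2" using e p by (simp_all add: d3_def)
    have "\<bar>N1 (vadd (model_tower n) x h) t * N2 (vadd (model_tower n) x h) t - N1 x t * N2 x t - (A1 h t * N2 x t + N1 x t * A2 h t)\<bar> \<le> e * c1size h"
      if h: "h \<in> C1_towers n" "c1size h < min d1 (min d2 d3)" "t \<in> {0..1}" for h t
    proof -
      define s where "s = c1size h"
      define r1 where "r1 = N1 (vadd (model_tower n) x h) t - N1 x t - A1 h t"
      define r2 where "r2 = N2 (vadd (model_tower n) x h) t - N2 x t - A2 h t"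
      have s: "s \<ge> 0" "s \<le> d3" using c1size_nonneg[OF h(1)] h(2) by (auto simp: s_def)
      have r: "\<bar>r1\<bar> \<le> e' * s" "\<bar>r2\<bar> \<le> e' * s"
        using d1(2)[of h t] d2(2)[of h t] h by (auto simp: r1_def r2_def s_def)
      have "e' * s \<le> 1 * s" using e' s by (intro mult_right_mono) auto
      then have inc: "\<bar>A1 h t + r1\<bar> \<le> (C1 + 1) * s" "\<bar>A2 h t + r2\<bar> \<le> (C2 + 1) * s"
        using r C(3,4)[OF h(1,3)] by (auto simp: distrib_right s_def intro!: order_trans[OF abs_triangle_ineq])
      have "N1 (vadd (model_tower n) x h) t * N2 (vadd (model_tower n) x h) t - N1 x t * N2 x t - (A1 h t * N2 x t + N1 x t * A2 h t)
          = r1 * N2 x t + N1 x t * r2 + (A1 h t + r1) * (A2 h t + r2)"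
        by (simp add: r1_def r2_def algebra_simps)
      also have "\<bar>\<dots>\<bar> \<le> \<bar>r1 * N2 x t\<bar> + \<bar>N1 x t * r2\<bar> + \<bar>(A1 h t + r1) * (A2 h t + r2)\<bar>" by linarith
      also have "\<dots> \<le> (e' * s) * B2 + B1 * (e' * s) + ((C1 + 1) * s) * ((C2 + 1) * s)"
        unfolding abs_mult using r inc B h(3) s e' C by (intro add_mono mult_mono) auto
      also have "\<dots> = (e' * (B1 + B2) + p * s) * s" by (simp add: p_def algebra_simps)
      also have "\<dots> \<le> (e / 2 + p * d3) * s"
        using e'B s p by (intro mult_right_mono add_mono mult_left_mono) auto
      also have "\<dots> = e * s" using d3 by simp
      finally show ?thesis by (simp add: s_def)
    qed
    then show ?thesis using d1(1) d2(1) d3(1) by (intro exI[of _ "min d1 (min d2 d3)"]) auto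
  qed
  ultimately show ?thesis
    using D C B unfolding has_sup_derivative_def
    by (auto simp: algebra_simps intro!: exI[of _ "C1 * B2 + B1 * C2"])
qed

lemma has_sup_derivative_kernel:
  assumes K: "smooth_on K (tube \<epsilon>)" and x: "x \<in> small_towers \<epsilon> n"
  defines "Ka \<equiv> \<lambda>p. frechet_derivative K (at p) (0, 1, 0)"
    and "Kb \<equiv> \<lambda>p. frechet_derivative K (at p) (0, 0, 1)"
  shows "has_sup_derivative n (\<lambda>z t. K (t, root_fun n z t, deriv (root_fun n z) t)) x
    (\<lambda>h t. Ka (t, root_fun n x t, deriv (root_fun n x) t) * root_fun n h t
         + Kb (t, root_fun n x t, deriv (root_fun n x) t) * deriv (root_fun n h) t)"
proof -
  let ?l = "root_fun n"
  note l = leaf_root_fun[of n]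
  have xC: "x \<in> C1_towers n" "\<And>t. \<bar>?l x t\<bar> < \<epsilon>" using x by (auto simp: small_towers_def)
  have add: "deriv (?l (vadd (model_tower n) h k)) = (\<lambda>t. deriv (?l h) t + deriv (?l k) t)"
    if "h \<in> C1_towers n" "k \<in> C1_towers n" for h k
    using that by (simp add: leaf_vadd[OF l] deriv_C1_add leaf_C1[OF l])
  have Ka: "continuous_on {0..1} (\<lambda>t. Ka (t, ?l x t, deriv (?l x) t))"
    and Kb: "continuous_on {0..1} (\<lambda>t. Kb (t, ?l x t, deriv (?l x) t))"
    unfolding Ka_def Kb_def
    by (rule nemytskii_continuous[OF nem_kernel x], rule smooth_on_derivative[OF K open_tube])+
  obtain Ba where Ba: "Ba \<ge> 0" "\<And>t. t \<in> {0..1} \<Longrightarrow> \<bar>Ka (t, ?l x t, deriv (?l x) t)\<bar> \<le> Ba"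
    by (rule continuous_unit_interval_bounded[OF Ka]) blast
  obtain Bb where Bb: "Bb \<ge> 0" "\<And>t. t \<in> {0..1} \<Longrightarrow> \<bar>Kb (t, ?l x t, deriv (?l x) t)\<bar> \<le> Bb"
    by (rule continuous_unit_interval_bounded[OF Kb]) blast
  note B0 = Ba(1) Bb(1) and B = Ba(2) Bb(2)
  have bound: "\<bar>Ka (t, ?l x t, deriv (?l x) t) * ?l h t + Kb (t, ?l x t, deriv (?l x) t) * deriv (?l h) t\<bar> \<le> (Ba + Bb) * c1size h"
    if "h \<in> C1_towers n" "t \<in> {0..1}" for h t
    unfolding distrib_right using leaf_le_c1size[OF l that] B[OF that(2)] B0 c1size_nonneg[OF that(1)]
    by (intro order_trans[OF abs_triangle_ineq] add_mono) (auto simp: abs_mult intro!: mult_mono)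
  have approx: "\<exists>d>0. \<forall>h\<in>C1_towers n. c1size h < d \<longrightarrow> (\<forall>t\<in>{0..1}.
      \<bar>K (t, ?l (vadd (model_tower n) x h) t, deriv (?l (vadd (model_tower n) x h)) t) - K (t, ?l x t, deriv (?l x) t)
        - (Ka (t, ?l x t, deriv (?l x) t) * ?l h t + Kb (t, ?l x t, deriv (?l x) t) * deriv (?l h) t)\<bar> \<le> e * c1size h)"
    if "e > 0" for e
  proof -
    have e2: "e / 2 > 0" using that by simp
    have xl: "?l x \<in> C1" using leaf_C1[OF l xC(1)] .
    obtain d where d: "d > 0" "\<And>t u v. t \<in> {0..1} \<Longrightarrow> \<bar>u\<bar> < d \<Longrightarrow> \<bar>v\<bar> < d \<Longrightarrow>
      \<bar>K (t, ?l x t + u, deriv (?l x) t + v) - K (t, ?l x t, deriv (?l x) t)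
        - (Ka (t, ?l x t, deriv (?l x) t) * u + Kb (t, ?l x t, deriv (?l x) t) * v)\<bar> \<le> e / 2 * (\<bar>u\<bar> + \<bar>v\<bar>)"
      unfolding Ka_def Kb_def
      using uniform_linearization[OF K C1_D(2)[OF xl] xC(2) C1_D(3)[OF xl] e2] by blast
    have "\<bar>K (t, ?l (vadd (model_tower n) x h) t, deriv (?l (vadd (model_tower n) x h)) t) - K (t, ?l x t, deriv (?l x) t)
        - (Ka (t, ?l x t, deriv (?l x) t) * ?l h t + Kb (t, ?l x t, deriv (?l x) t) * deriv (?l h) t)\<bar> \<le> e * c1size h"
      if h: "h \<in> C1_towers n" "c1size h < d" "t \<in> {0..1}" for h t
    proof -
      have le: "\<bar>?l h t\<bar> \<le> c1size h" "\<bar>deriv (?l h) t\<bar> \<le> c1size h" using leaf_le_c1size[OF l h(1,3)] by auto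
      have "e / 2 * (\<bar>?l h t\<bar> + \<bar>deriv (?l h) t\<bar>) \<le> e / 2 * (c1size h + c1size h)"
        using le e2 by (intro mult_left_mono add_mono) auto
      then show ?thesis
        unfolding add[OF xC(1) h(1)] unfolding leaf_vadd[OF l, of x h]
        using d(2)[OF h(3), of "?l h t" "deriv (?l h) t"] le h(2) by simp
    qed
    with d(1) show ?thesis by blast
  qed
  show ?thesis
    unfolding has_sup_derivative_def
  proof (intro conjI)
    show "\<exists>C\<ge>0. \<forall>h\<in>C1_towers n. \<forall>t\<in>{0..1}. \<bar>Ka (t, ?l x t, deriv (?l x) t) * ?l h t + Kb (t, ?l x t, deriv (?l x) t) * deriv (?l h) t\<bar> \<le> C * c1size h"
      using bound B0 by (intro exI[of _ "Ba + Bb"]) auto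
  qed (simp add: leaf_vadd[OF l] deriv_C1_add leaf_C1[OF l] algebra_simps,
      simp add: leaf_vscale[OF l] deriv_C1_scale leaf_C1[OF l] algebra_simps, use approx in blast)
qed

text \<open>Differentiating a coefficient gives new coefficients multiplied by the functions in the direction,
  and all other generators are linear; so the derivative, as a function of point and direction,
  stays in the class.\<close>

lemma nemytskii_derivative:
  "nemytskii \<epsilon> n N \<Longrightarrow> \<exists>D. nemytskii \<epsilon> (Suc n) (\<lambda>z. D (base z) (dir z)) \<and>
     (\<forall>x\<in>small_towers \<epsilon> n. has_sup_derivative n N x (D x))"
proof (induction rule: nemytskii.induct)
  case (nem_kernel K n)
  have k: "nemytskii \<epsilon> (Suc n) (\<lambda>z t. frechet_derivative K (at (t, root_fun n (base z) t, deriv (root_fun n (base z)) t)) v)" for v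
    using nemytskii.nem_kernel[OF smooth_on_derivative[OF nem_kernel open_tube], of "Suc n" v] by simp
  have "nemytskii \<epsilon> (Suc n) (\<lambda>z t.
      frechet_derivative K (at (t, root_fun n (base z) t, deriv (root_fun n (base z)) t)) (0, 1, 0) * root_fun n (dir z) t +
      frechet_derivative K (at (t, root_fun n (base z) t, deriv (root_fun n (base z)) t)) (0, 0, 1) * deriv (root_fun n (dir z)) t)"
    by (intro nem_add nem_mult k nemytskii.nem_leaf[OF leaf_dir[OF leaf_root_fun]]
        nemytskii.nem_leaf_deriv[OF leaf_dir[OF leaf_root_fun]])
  then show ?case
    using has_sup_derivative_kernel[OF nem_kernel]
    by (intro exI[of _ "\<lambda>x h t. frechet_derivative K (at (t, root_fun n x t, deriv (root_fun n x) t)) (0, 1, 0) * root_fun n h t +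
      frechet_derivative K (at (t, root_fun n x t, deriv (root_fun n x) t)) (0, 0, 1) * deriv (root_fun n h) t"]) blast
next
  case (nem_leaf n l)
  show ?case
    using nemytskii.nem_leaf[OF leaf_dir[OF nem_leaf]] has_sup_derivative_leaf[OF nem_leaf]
    by (intro exI[of _ "\<lambda>x h t. l h t"]) blast
next
  case (nem_leaf_deriv n l)
  show ?case
    using nemytskii.nem_leaf_deriv[OF leaf_dir[OF nem_leaf_deriv]] has_sup_derivative_leaf_deriv[OF nem_leaf_deriv]
    by (intro exI[of _ "\<lambda>x h t. deriv (l h) t"]) (auto simp: small_towers_def)
next
  case (nem_add n N1 N2)
  then obtain D1 D2 where D: "nemytskii \<epsilon> (Suc n) (\<lambda>z. D1 (base z) (dir z))" "nemytskii \<epsilon> (Suc n) (\<lambda>z. D2 (base z) (dir z))"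
    "\<And>x. x \<in> small_towers \<epsilon> n \<Longrightarrow> has_sup_derivative n N1 x (D1 x)"
    "\<And>x. x \<in> small_towers \<epsilon> n \<Longrightarrow> has_sup_derivative n N2 x (D2 x)" by blast
  show ?case
    using nemytskii.nem_add[OF D(1,2)] has_sup_derivative_add[OF D(3,4)]
    by (intro exI[of _ "\<lambda>x h t. D1 x h t + D2 x h t"]) blast
next
  case (nem_mult n N1 N2)
  then obtain D1 D2 where D: "nemytskii \<epsilon> (Suc n) (\<lambda>z. D1 (base z) (dir z))" "nemytskii \<epsilon> (Suc n) (\<lambda>z. D2 (base z) (dir z))"
    "\<And>x. x \<in> small_towers \<epsilon> n \<Longrightarrow> has_sup_derivative n N1 x (D1 x)"
    "\<And>x. x \<in> small_towers \<epsilon> n \<Longrightarrow> has_sup_derivative n N2 x (D2 x)" by blast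
  have "nemytskii \<epsilon> (Suc n) (\<lambda>z t. D1 (base z) (dir z) t * N2 (base z) t + N1 (base z) t * D2 (base z) (dir z) t)"
    by (intro nemytskii.nem_add nemytskii.nem_mult D(1,2) nemytskii_base nem_mult.hyps)
  then show ?case
    using has_sup_derivative_mult[OF D(3,4) nemytskii_continuous[OF nem_mult.hyps(1)] nemytskii_continuous[OF nem_mult.hyps(2)]]
    by (intro exI[of _ "\<lambda>x h t. D1 x h t * N2 x t + N1 x t * D2 x h t"]) blast
qed


section \<open>Integral functionals are sc-smooth\<close>

fun real_towers :: "nat \<Rightarrow> real tower set" where
  "real_towers 0 = range Pt"
| "real_towers (Suc j) = {Tan x h |x h. x \<in> real_towers j \<and> h \<in> real_towers j}"

text \<open>The norm of each level of an iterated tangent space of \<open>\<real>\<close>; it does not depend on the level.\<close>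

primrec rsize :: "real tower \<Rightarrow> real" where
  "rsize (Pt r) = \<bar>r\<bar>"
| "rsize (Tan x h) = rsize x + rsize h"

lemma level_real_tower: "level (real_tower j) m = real_towers j"
  by (induction j arbitrary: m) (auto simp: real_space_def tangent_space_def)

lemma lnorm_real_tower: "z \<in> real_towers j \<Longrightarrow> lnorm (real_tower j) m z = rsize z"
  by (induction j arbitrary: m z) (auto simp: real_space_def tangent_space_def)

lemma real_towers_vdiff: "x \<in> real_towers j \<Longrightarrow> y \<in> real_towers j \<Longrightarrow> vdiff (real_tower j) x y \<in> real_towers j"
  by (induction j arbitrary: x y) (auto simp: real_space_def tangent_space_def vdiff_def)

lemma rsize_le_vdiff: "x \<in> real_towers j \<Longrightarrow> y \<in> real_towers j \<Longrightarrow> rsize x \<le> rsize (vdiff (real_tower j) x y) + rsize y"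
proof (induction j arbitrary: x y)
  case (Suc j)
  then obtain a b c d where "x = Tan a b" "y = Tan c d" "a \<in> real_towers j" "b \<in> real_towers j" "c \<in> real_towers j" "d \<in> real_towers j"
    by auto
  then show ?case using Suc.IH[of a c] Suc.IH[of b d] by (simp add: tangent_space_def vdiff_def)
qed (auto simp: real_space_def vdiff_def)

lemma vdiff_Tan: "vdiff (real_tower (Suc j)) (Tan a b) (Tan c d) = Tan (vdiff (real_tower j) a c) (vdiff (real_tower j) b d)"
  by (simp add: vdiff_def tangent_space_def)

text \<open>Maps into a \<open>j\<close>-fold iterated tangent space of \<open>\<real>\<close> all of whose components are integrals of
  operators from the class above.\<close>

inductive integral_map :: "real \<Rightarrow> nat \<Rightarrow> nat \<Rightarrow> ((real \<Rightarrow> real) tower \<Rightarrow> real tower) \<Rightarrow> bool" for \<epsilon> n where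
  int_Pt: "nemytskii \<epsilon> n N \<Longrightarrow> integral_map \<epsilon> n 0 (\<lambda>z. Pt (integral {0..1} (N z)))"
| int_Tan: "integral_map \<epsilon> n j F \<Longrightarrow> integral_map \<epsilon> n j G \<Longrightarrow> integral_map \<epsilon> n (Suc j) (\<lambda>z. Tan (F z) (G z))"

lemma integral_map_real_towers: "integral_map \<epsilon> n j F \<Longrightarrow> F z \<in> real_towers j"
  by (induction rule: integral_map.induct) auto

lemma integral_map_base: "integral_map \<epsilon> n j F \<Longrightarrow> integral_map \<epsilon> (Suc n) j (\<lambda>z. F (base z))"
proof (induction rule: integral_map.induct)
  case (int_Pt N)
  show ?case by (rule integral_map.int_Pt[OF nemytskii_base[OF int_Pt]])
next
  case (int_Tan j F G)
  show ?case by (rule integral_map.int_Tan[OF int_Tan.IH])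
qed

text \<open>As for operators, but with values in a \<open>j\<close>-fold iterated tangent space of \<open>\<real>\<close>. The perturbed point
  is required to be small again, since the integrals are controlled only there.\<close>

definition has_tower_derivative ::
    "real \<Rightarrow> nat \<Rightarrow> nat \<Rightarrow> ((real \<Rightarrow> real) tower \<Rightarrow> real tower) \<Rightarrow> (real \<Rightarrow> real) tower \<Rightarrow>
      ((real \<Rightarrow> real) tower \<Rightarrow> real tower) \<Rightarrow> bool" where
  "has_tower_derivative \<epsilon> n j F x A \<longleftrightarrow>
    (\<forall>h\<in>C1_towers n. \<forall>k\<in>C1_towers n. A (vadd (model_tower n) h k) = vadd (real_tower j) (A h) (A k)) \<and>
    (\<forall>r. \<forall>h\<in>C1_towers n. A (vscale (model_tower n) r h) = vscale (real_tower j) r (A h)) \<and>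
    (\<exists>C\<ge>0. \<forall>h\<in>C1_towers n. rsize (A h) \<le> C * c1size h) \<and>
    (\<forall>e>0. \<exists>d>0. \<forall>h\<in>C1_towers n. c1size h < d \<and> vadd (model_tower n) x h \<in> small_towers \<epsilon> n \<longrightarrow>
      rsize (vdiff (real_tower j) (vdiff (real_tower j) (F (vadd (model_tower n) x h)) (F x)) (A h)) \<le> e * c1size h)"

lemma has_tower_derivative_integral:
  assumes N: "nemytskii \<epsilon> n N" and D: "nemytskii \<epsilon> (Suc n) (\<lambda>z. D (base z) (dir z))"
    and x: "x \<in> small_towers \<epsilon> n" and d: "has_sup_derivative n N x (D x)"
  shows "has_tower_derivative \<epsilon> n 0 (\<lambda>z. Pt (integral {0..1} (N z))) x (\<lambda>h. Pt (integral {0..1} (D x h)))"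
proof -
  have Dc: "continuous_on {0..1} (D x h)" if "h \<in> C1_towers n" for h
    using nemytskii_continuous[OF D, of "Tan x h"] x that by (simp add: Tan_small_towers)
  have Nc: "continuous_on {0..1} (N z)" if "z \<in> small_towers \<epsilon> n" for z
    using nemytskii_continuous[OF N that] .
  have bound: "\<bar>integral {0..1} f\<bar> \<le> B" if "continuous_on {0..1} f" "\<And>t. t \<in> {0..1} \<Longrightarrow> \<bar>f t\<bar> \<le> B" for f :: "real \<Rightarrow> real" and B
    using integral_bound[of 0 1 f B] that by simp
  have add: "integral {0..1} (D x (vadd (model_tower n) h k)) = integral {0..1} (D x h) + integral {0..1} (D x k)"
    if "h \<in> C1_towers n" "k \<in> C1_towers n" for h k
  proof -
    have "integral {0..1} (D x (vadd (model_tower n) h k)) = integral {0..1} (\<lambda>t. D x h t + D x k t)"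
      using d that by (intro integral_cong) (auto simp: has_sup_derivative_def)
    then show ?thesis using Dc that by (simp add: integral_add integrable_continuous_real)
  qed
  have scale: "integral {0..1} (D x (vscale (model_tower n) r h)) = r * integral {0..1} (D x h)"
    if "h \<in> C1_towers n" for r h
  proof -
    have "integral {0..1} (D x (vscale (model_tower n) r h)) = integral {0..1} (\<lambda>t. r * D x h t)"
      using d that by (intro integral_cong) (auto simp: has_sup_derivative_def)
    then show ?thesis by simp
  qed
  obtain C where C: "C \<ge> 0" "\<And>h t. h \<in> C1_towers n \<Longrightarrow> t \<in> {0..1} \<Longrightarrow> \<bar>D x h t\<bar> \<le> C * c1size h"
    using d unfolding has_sup_derivative_def by metis
  have bnd: "\<bar>integral {0..1} (D x h)\<bar> \<le> C * c1size h" if "h \<in> C1_towers n" for h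
    using bound[OF Dc[OF that] C(2)[OF that]] .
  have approx: "\<exists>d>0. \<forall>h\<in>C1_towers n. c1size h < d \<and> vadd (model_tower n) x h \<in> small_towers \<epsilon> n \<longrightarrow>
      \<bar>integral {0..1} (N (vadd (model_tower n) x h)) - integral {0..1} (N x) - integral {0..1} (D x h)\<bar> \<le> e * c1size h"
    if e: "e > 0" for e
  proof -
    obtain \<delta> where \<delta>: "\<delta> > 0" "\<And>h t. h \<in> C1_towers n \<Longrightarrow> c1size h < \<delta> \<Longrightarrow> t \<in> {0..1} \<Longrightarrow>
        \<bar>N (vadd (model_tower n) x h) t - N x t - D x h t\<bar> \<le> e * c1size h"
      using d e unfolding has_sup_derivative_def by meson
    have "\<bar>integral {0..1} (N (vadd (model_tower n) x h)) - integral {0..1} (N x) - integral {0..1} (D x h)\<bar> \<le> e * c1size h"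
      if h: "h \<in> C1_towers n" "c1size h < \<delta>" "vadd (model_tower n) x h \<in> small_towers \<epsilon> n" for h
    proof -
      note c = Nc[OF h(3)] Nc[OF x] Dc[OF h(1)]
      have "integral {0..1} (\<lambda>t. N (vadd (model_tower n) x h) t - N x t - D x h t) =
        integral {0..1} (N (vadd (model_tower n) x h)) - integral {0..1} (N x) - integral {0..1} (D x h)"
        using integral_diff[of "\<lambda>t. N (vadd (model_tower n) x h) t - N x t" "{0..1}" "D x h"]
          integral_diff[of "N (vadd (model_tower n) x h)" "{0..1}" "N x"] c
        by (simp add: integrable_continuous_real continuous_on_diff)
      then show ?thesis
        using bound[of "\<lambda>t. N (vadd (model_tower n) x h) t - N x t - D x h t" "e * c1size h"] \<delta>(2)[OF h(1,2)] c
        by (simp add: continuous_on_diff)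
    qed
    with \<delta>(1) show ?thesis by blast
  qed
  show ?thesis
    unfolding has_tower_derivative_def real_tower_simps
    using add scale C(1) bnd approx by (auto simp: real_space_def vdiff_def intro!: exI[of _ C])
qed

lemma has_tower_derivative_Tan:
  assumes F: "has_tower_derivative \<epsilon> n j F x A" and G: "has_tower_derivative \<epsilon> n j G x B"
  shows "has_tower_derivative \<epsilon> n (Suc j) (\<lambda>z. Tan (F z) (G z)) x (\<lambda>h. Tan (A h) (B h))"
proof -
  obtain C1 C2 where C: "C1 \<ge> 0" "C2 \<ge> 0" "\<And>h. h \<in> C1_towers n \<Longrightarrow> rsize (A h) \<le> C1 * c1size h"
    "\<And>h. h \<in> C1_towers n \<Longrightarrow> rsize (B h) \<le> C2 * c1size h"
    using F G unfolding has_tower_derivative_def by metis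
  have "rsize (Tan (A h) (B h)) \<le> (C1 + C2) * c1size h" if "h \<in> C1_towers n" for h
    using C(3,4)[OF that] by (simp add: distrib_right)
  moreover have "\<exists>d>0. \<forall>h\<in>C1_towers n. c1size h < d \<and> vadd (model_tower n) x h \<in> small_towers \<epsilon> n \<longrightarrow>
      rsize (vdiff (real_tower (Suc j)) (vdiff (real_tower (Suc j)) (Tan (F (vadd (model_tower n) x h)) (G (vadd (model_tower n) x h)))
        (Tan (F x) (G x))) (Tan (A h) (B h))) \<le> e * c1size h" if "e > 0" for e
  proof -
    from that have e2: "e / 2 > 0" by simp
    obtain d1 where d1: "d1 > 0" "\<And>h. h \<in> C1_towers n \<Longrightarrow> c1size h < d1 \<Longrightarrow> vadd (model_tower n) x h \<in> small_towers \<epsilon> n \<Longrightarrow>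
      rsize (vdiff (real_tower j) (vdiff (real_tower j) (F (vadd (model_tower n) x h)) (F x)) (A h)) \<le> e / 2 * c1size h"
      using F e2 unfolding has_tower_derivative_def by meson
    obtain d2 where d2: "d2 > 0" "\<And>h. h \<in> C1_towers n \<Longrightarrow> c1size h < d2 \<Longrightarrow> vadd (model_tower n) x h \<in> small_towers \<epsilon> n \<Longrightarrow>
      rsize (vdiff (real_tower j) (vdiff (real_tower j) (G (vadd (model_tower n) x h)) (G x)) (B h)) \<le> e / 2 * c1size h"
      using G e2 unfolding has_tower_derivative_def by meson
    show ?thesis
    proof (intro exI[of _ "min d1 d2"] conjI ballI impI)
      fix h assume "h \<in> C1_towers n" "c1size h < min d1 d2 \<and> vadd (model_tower n) x h \<in> small_towers \<epsilon> n"
      then show "rsize (vdiff (real_tower (Suc j)) (vdiff (real_tower (Suc j)) (Tan (F (vadd (model_tower n) x h)) (G (vadd (model_tower n) x h)))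
        (Tan (F x) (G x))) (Tan (A h) (B h))) \<le> e * c1size h"
        using d1(2)[of h] d2(2)[of h] by (simp add: vdiff_Tan del: real_tower_simps)
    qed (use d1 d2 in auto)
  qed
  ultimately show ?thesis
    using F G C(1,2) unfolding has_tower_derivative_def
    by (auto simp: tangent_space_def intro!: exI[of _ "C1 + C2"])
qed

lemma integral_map_derivative:
  "integral_map \<epsilon> n j F \<Longrightarrow> \<exists>D. integral_map \<epsilon> (Suc n) j (\<lambda>z. D (base z) (dir z)) \<and>
    (\<forall>x\<in>small_towers \<epsilon> n. has_tower_derivative \<epsilon> n j F x (D x))"
proof (induction rule: integral_map.induct)
  case (int_Pt N)
  obtain D where D: "nemytskii \<epsilon> (Suc n) (\<lambda>z. D (base z) (dir z))"
    "\<And>x. x \<in> small_towers \<epsilon> n \<Longrightarrow> has_sup_derivative n N x (D x)"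
    using nemytskii_derivative[OF int_Pt] by blast
  show ?case
    using integral_map.int_Pt[OF D(1)] has_tower_derivative_integral[OF int_Pt D(1) _ D(2)]
    by (intro exI[of _ "\<lambda>x h. Pt (integral {0..1} (D x h))"]) blast
next
  case (int_Tan j F G)
  then obtain A B where D: "integral_map \<epsilon> (Suc n) j (\<lambda>z. A (base z) (dir z))" "integral_map \<epsilon> (Suc n) j (\<lambda>z. B (base z) (dir z))"
    "\<And>x. x \<in> small_towers \<epsilon> n \<Longrightarrow> has_tower_derivative \<epsilon> n j F x (A x)"
    "\<And>x. x \<in> small_towers \<epsilon> n \<Longrightarrow> has_tower_derivative \<epsilon> n j G x (B x)" by blast
  show ?case
    using integral_map.int_Tan[OF D(1,2)] has_tower_derivative_Tan[OF D(3,4)]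
    by (intro exI[of _ "\<lambda>x h. Tan (A x h) (B x h)"]) blast
qed

text \<open>Continuity is a consequence of differentiability. The factor \<open>3\<close> is the constant that relates the
  \<open>C\<^sup>1\<close> norm to the level norms.\<close>

lemma integral_map_sc0_on:
  assumes F: "integral_map \<epsilon> n j F" and U: "U \<subseteq> small_towers \<epsilon> n"
  shows "sc0_on (model_tower n) (real_tower j) U F"
  unfolding sc0_on_def level_real_tower
proof (intro allI ballI conjI impI)
  fix m x assume x: "x \<in> U \<inter> level (model_tower n) m"
  show "F x \<in> real_towers j" by (rule integral_map_real_towers[OF F])
  fix e :: real assume e: "e > 0"
  obtain D where D: "integral_map \<epsilon> (Suc n) j (\<lambda>z. D (base z) (dir z))"
    "\<And>x. x \<in> small_towers \<epsilon> n \<Longrightarrow> has_tower_derivative \<epsilon> n j F x (D x)"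
    using integral_map_derivative[OF F] by blast
  have Dt: "D x h \<in> real_towers j" for h using integral_map_real_towers[OF D(1), of "Tan x h"] by simp
  have Dx: "has_tower_derivative \<epsilon> n j F x (D x)" using D(2) x U by blast
  then obtain C where C: "C \<ge> 0" "\<And>h. h \<in> C1_towers n \<Longrightarrow> rsize (D x h) \<le> C * c1size h"
    unfolding has_tower_derivative_def by blast
  obtain d where d: "d > 0" "\<And>h. h \<in> C1_towers n \<Longrightarrow> c1size h < d \<Longrightarrow> vadd (model_tower n) x h \<in> small_towers \<epsilon> n \<Longrightarrow>
      rsize (vdiff (real_tower j) (vdiff (real_tower j) (F (vadd (model_tower n) x h)) (F x)) (D x h)) \<le> 1 * c1size h"
    using Dx unfolding has_tower_derivative_def by (meson zero_less_one)
  define d' where "d' = min d (e / (C + 1)) / 3"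
  have "d' > 0" using d(1) e C(1) by (simp add: d'_def)
  moreover have "lnorm (real_tower j) m (vdiff (real_tower j) (F y) (F x)) < e"
    if y: "y \<in> U \<inter> level (model_tower n) m" "lnorm (model_tower n) m (vdiff (model_tower n) y x) < d'" for y
  proof -
    define h where "h = vdiff (model_tower n) y x"
    have hl: "h \<in> level (model_tower n) m"
      unfolding h_def vdiff_def using x y by (intro level_model_tower_vadd level_model_tower_vscale) auto
    then have hC: "h \<in> C1_towers n" by (rule level_model_tower_C1)
    have xh: "vadd (model_tower n) x h = y"
      unfolding h_def using x y U by (intro vadd_vdiff) (auto simp: small_towers_def)
    have "lnorm (model_tower n) m h < min d (e / (C + 1)) / 3" using y(2) unfolding h_def d'_def .
    then have "3 * lnorm (model_tower n) m h < min d (e / (C + 1))" by simp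
    then have "c1size h < min d (e / (C + 1))"
      using c1size_le_lnorm[OF hl] by (rule order_le_less_trans[rotated])
    then have h: "c1size h < d" "c1size h < e / (C + 1)" by auto
    let ?\<Delta> = "vdiff (real_tower j) (F y) (F x)"
    have \<Delta>: "?\<Delta> \<in> real_towers j" using integral_map_real_towers[OF F] by (intro real_towers_vdiff)
    have "rsize ?\<Delta> \<le> rsize (vdiff (real_tower j) ?\<Delta> (D x h)) + rsize (D x h)"
      by (rule rsize_le_vdiff[OF \<Delta> Dt])
    also have "\<dots> \<le> 1 * c1size h + C * c1size h"
      using d(2)[OF hC h(1)] xh y U C(2)[OF hC] by (intro add_mono) auto
    also have "\<dots> = (C + 1) * c1size h" by (simp add: algebra_simps)
    also have "\<dots> < e" using h(2) C(1) by (simp add: field_simps)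
    finally show ?thesis using lnorm_real_tower[OF \<Delta>] by simp
  qed
  ultimately show "\<exists>\<delta>>0. \<forall>y\<in>U \<inter> level (model_tower n) m.
      lnorm (model_tower n) m (vdiff (model_tower n) y x) < \<delta> \<longrightarrow>
      lnorm (real_tower j) m (vdiff (real_tower j) (F y) (F x)) < e" by blast
qed

lemma has_tower_derivative_sc:
  assumes F: "has_tower_derivative \<epsilon> n j F x A" and U: "U \<subseteq> small_towers \<epsilon> n"
    and Ft: "\<And>z. F z \<in> real_towers j" "\<And>h. A h \<in> real_towers j"
  shows "has_sc_derivative (model_tower n) (real_tower j) U F x A"
proof -
  obtain C where C: "C \<ge> 0" "\<And>h. h \<in> C1_towers n \<Longrightarrow> rsize (A h) \<le> C * c1size h"
    using F unfolding has_tower_derivative_def by blast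
  have "lnorm (real_tower j) 0 (A h) \<le> (C * 3) * lnorm (model_tower n) 0 h" if "h \<in> level (model_tower n) 0" for h
    using C(2)[OF level_model_tower_C1[OF that]] mult_left_mono[OF c1size_le_lnorm[OF that] C(1)] lnorm_real_tower[OF Ft(2)]
    by simp
  then have "bounded_linear_level0 (model_tower n) (real_tower j) A"
    using F Ft(2) level_model_tower_C1 unfolding bounded_linear_level0_def has_tower_derivative_def level_real_tower
    by metis
  moreover have "\<exists>\<delta>>0. \<forall>h\<in>level (model_tower n) 1. lnorm (model_tower n) 1 h < \<delta> \<and> vadd (model_tower n) x h \<in> U \<longrightarrow>
        lnorm (real_tower j) 0 (vdiff (real_tower j) (vdiff (real_tower j) (F (vadd (model_tower n) x h)) (F x)) (A h))
          \<le> e * lnorm (model_tower n) 1 h" if "e > 0" for e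
  proof -
    from that have e3: "e / 3 > 0" by simp
    obtain d where d: "d > 0" "\<And>h. h \<in> C1_towers n \<Longrightarrow> c1size h < d \<Longrightarrow> vadd (model_tower n) x h \<in> small_towers \<epsilon> n \<Longrightarrow>
      rsize (vdiff (real_tower j) (vdiff (real_tower j) (F (vadd (model_tower n) x h)) (F x)) (A h)) \<le> e / 3 * c1size h"
      using F e3 unfolding has_tower_derivative_def by meson
    show ?thesis
    proof (intro exI[of _ "d / 3"] conjI ballI impI)
      show "d / 3 > 0" using d by simp
      fix h assume h: "h \<in> level (model_tower n) 1" "lnorm (model_tower n) 1 h < d / 3 \<and> vadd (model_tower n) x h \<in> U"
      have s: "c1size h \<le> 3 * lnorm (model_tower n) 1 h" by (rule c1size_le_lnorm[OF h(1)])
      let ?R = "vdiff (real_tower j) (vdiff (real_tower j) (F (vadd (model_tower n) x h)) (F x)) (A h)"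
      have "rsize ?R \<le> e / 3 * c1size h"
        using s h U by (intro d(2) level_model_tower_C1[OF h(1)]) auto
      also have "\<dots> \<le> e / 3 * (3 * lnorm (model_tower n) 1 h)"
        using s e3 by (intro mult_left_mono) auto
      finally show "lnorm (real_tower j) 0 ?R \<le> e * lnorm (model_tower n) 1 h"
        using lnorm_real_tower[of ?R j 0] Ft by (simp add: real_towers_vdiff)
    qed
  qed
  ultimately show ?thesis unfolding has_sc_derivative_def by blast
qed

text \<open>The tangent map of an integral map is an integral map on the next tangent space, so the recursive
  definition of \<open>sc\<^sup>k\<close> can be followed without loss. The sc-structure enters only through the
  domination of the \<open>C\<^sup>1\<close> norm by all level norms.\<close>

theorem integral_map_sc_on:
  "integral_map \<epsilon> n j F \<Longrightarrow> U \<subseteq> small_towers \<epsilon> n \<Longrightarrow> sc_on k (model_tower n) (real_tower j) U F"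
proof (induction k arbitrary: n j F U)
  case 0
  then show ?case by (simp add: integral_map_sc0_on)
next
  case (Suc k)
  obtain D where D: "integral_map \<epsilon> (Suc n) j (\<lambda>z. D (base z) (dir z))"
    "\<And>x. x \<in> small_towers \<epsilon> n \<Longrightarrow> has_tower_derivative \<epsilon> n j F x (D x)"
    using integral_map_derivative[OF Suc.prems(1)] by blast
  have Dt: "D x h \<in> real_towers j" for x h using integral_map_real_towers[OF D(1), of "Tan x h"] by simp
  have "integral_map \<epsilon> (Suc n) (Suc j) (tangent_map F D)"
    using integral_map.int_Tan[OF integral_map_base[OF Suc.prems(1)] D(1)] by (simp add: tangent_map_def[abs_def])
  moreover have "tangent_dom (model_tower n) U \<subseteq> small_towers \<epsilon> (Suc n)"
    using Suc.prems(2) level_model_tower_C1 by (auto simp: tangent_dom_def Tan_small_towers)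
  ultimately have "sc_on k (model_tower (Suc n)) (real_tower (Suc j)) (tangent_dom (model_tower n) U) (tangent_map F D)"
    by (rule Suc.IH)
  moreover have "has_sc_derivative (model_tower n) (real_tower j) U F x (D x)" if "x \<in> U" for x
    using D(2) that Suc.prems(2)
    by (intro has_tower_derivative_sc[of \<epsilon>] integral_map_real_towers[OF Suc.prems(1)] Dt) blast+
  ultimately show ?case
    using integral_map_sc0_on[OF Suc.prems] by auto
qed

lemma sc_on_cong:
  "(\<And>x. x \<in> U \<Longrightarrow> f x = g x) \<Longrightarrow> sc_on k E H U f \<Longrightarrow> sc_on k E H U g"
proof (induction k arbitrary: E H U f g)
  case 0
  then show ?case by (simp add: sc0_on_def)
next
  case (Suc k)
  from Suc.prems(2) have "sc0_on E H U f \<and>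
     (\<exists>Df. (\<forall>x\<in>U \<inter> level E 1. has_sc_derivative E H U f x (Df x)) \<and>
           sc_on k (tangent_space E) (tangent_space H) (tangent_dom E U) (tangent_map f Df))"
    by (simp only: sc_on.simps)
  then obtain Df where Df: "sc0_on E H U f" "\<And>x. x \<in> U \<inter> level E 1 \<Longrightarrow> has_sc_derivative E H U f x (Df x)"
    "sc_on k (tangent_space E) (tangent_space H) (tangent_dom E U) (tangent_map f Df)" by blast
  have "sc0_on E H U g" using Df(1) Suc.prems(1) by (simp add: sc0_on_def)
  moreover have "has_sc_derivative E H U g x (Df x)" if "x \<in> U \<inter> level E 1" for x
    using Df(2)[OF that] Suc.prems(1) that unfolding has_sc_derivative_def by auto
  moreover have "sc_on k (tangent_space E) (tangent_space H) (tangent_dom E U) (tangent_map g Df)"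
    by (rule Suc.IH[OF _ Df(3)]) (auto simp: tangent_dom_def tangent_map_def Suc.prems(1))
  ultimately show ?case by auto
qed


section \<open>The length density of graphs over a loop\<close>

context oriented_riemannian_surface
begin

text \<open>The chart in which the speed of a curve at \<open>p\<close> is computed. It may jump along a curve; the point of
  the lemmas below is that the speed does not.\<close>

definition chart_at :: "'m \<Rightarrow> 'm chart" where
  "chart_at p = (SOME c. c \<in> \<A> \<and> p \<in> chart_dom c)"

lemma chart_at: "chart_at p \<in> \<A>" "p \<in> chart_dom (chart_at p)"
proof -
  have "\<exists>c. c \<in> \<A> \<and> p \<in> chart_dom c" using charts_cover by blast
  then have "chart_at p \<in> \<A> \<and> p \<in> chart_dom (chart_at p)" unfolding chart_at_def by (rule someI_ex)
  then show "chart_at p \<in> \<A>" "p \<in> chart_dom (chart_at p)" by auto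
qed

lemma speed_chart_at:
  "speed \<A> g v t = (let c = chart_at (v t); \<xi> = vector_derivative (coords c \<circ> v) (at t)
     in sqrt (\<xi> \<bullet> (g c (coords c (v t)) *v \<xi>)))"
  by (simp add: speed_def chart_at_def)

lemma inv_coords: "c \<in> \<A> \<Longrightarrow> p \<in> chart_dom c \<Longrightarrow> inv_into (chart_dom c) (coords c) (coords c p) = p"
  using chart_homeomorphism unfolding homeomorphism_def by blast

lemma transition_coords:
  "c \<in> \<A> \<Longrightarrow> p \<in> chart_dom c \<Longrightarrow> transition c d (coords c p) = coords d p"
  by (simp add: transition_def inv_coords)

lemma transition_derivative:
  assumes "c \<in> \<A>" "d \<in> \<A>" "p \<in> chart_dom c" "p \<in> chart_dom d"
  shows "(transition c d has_derivative frechet_derivative (transition c d) (at (coords c p))) (at (coords c p))"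
  by (rule smooth_on_differentiable[OF transition_smooth[OF assms(1,2)]]) (use assms in \<open>auto simp: overlap_def\<close>)

lemma gram_invariant:
  assumes "c \<in> \<A>" "d \<in> \<A>" "p \<in> chart_dom c" "p \<in> chart_dom d"
  defines "J \<equiv> frechet_derivative (transition c d) (at (coords c p))"
  shows "\<xi> \<bullet> (g c (coords c p) *v \<xi>) = J \<xi> \<bullet> (g d (coords d p) *v J \<xi>)"
proof -
  let ?J = "jacobian (transition c d) (coords c p)"
  have x: "coords c p \<in> overlap c d" using assms by (auto simp: overlap_def)
  have lin: "linear J" unfolding J_def using transition_derivative[OF assms(1-4)] has_derivative_linear by blast
  have J: "?J *v \<eta> = J \<eta>" for \<eta>
    using matrix_works[of J \<eta>] lin unfolding jacobian_def J_def[symmetric] by (simp add: linear_matrix_vector_mul_eq)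
  have "g c (coords c p) *v \<xi> = transpose ?J *v (g d (coords d p) *v (?J *v \<xi>))"
    using metric_transform[OF assms(1,2) x] transition_coords[OF assms(1,3)]
    by (simp add: matrix_vector_mul_assoc matrix_mul_assoc)
  then have "\<xi> \<bullet> (g c (coords c p) *v \<xi>) = ((g d (coords d p) *v (?J *v \<xi>)) v* ?J) \<bullet> \<xi>"
    by (simp add: transpose_matrix_vector inner_commute)
  also have "\<dots> = (g d (coords d p) *v (?J *v \<xi>)) \<bullet> (?J *v \<xi>)" by (rule dot_lmul_matrix)
  finally show ?thesis by (simp add: J inner_commute)
qed

lemma change_coords_derivative:
  fixes s :: "'x::real_normed_vector \<Rightarrow> 'm"
  assumes "c \<in> \<A>" "d \<in> \<A>" "s z \<in> chart_dom c" "s z \<in> chart_dom d" "isCont s z"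
    and f': "((coords c \<circ> s) has_derivative f') (at z)"
  shows "((coords d \<circ> s) has_derivative (\<lambda>v. frechet_derivative (transition c d) (at (coords c (s z))) (f' v))) (at z)"
proof -
  have "open (chart_dom c \<inter> chart_dom d)" using chart_dom_open assms(1,2) by (intro open_Int)
  then have "\<forall>\<^sub>F y in nhds z. s y \<in> chart_dom c \<inter> chart_dom d"
    using assms(3-5) by (auto simp: isCont_def tendsto_at_iff_tendsto_nhds dest!: topological_tendstoD)
  then obtain T where T: "open T" "z \<in> T" "\<And>y. y \<in> T \<Longrightarrow> s y \<in> chart_dom c \<inter> chart_dom d"
    by (auto simp: eventually_nhds)
  have "((\<lambda>y. transition c d ((coords c \<circ> s) y)) has_derivative
      (\<lambda>v. frechet_derivative (transition c d) (at (coords c (s z))) (f' v))) (at z)"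
    using has_derivative_compose[OF f', of "transition c d"] transition_derivative[OF assms(1-4)] by simp
  then show ?thesis
    by (rule has_derivative_transform_within_open[OF _ T(1,2)]) (use T(3) transition_coords assms in auto)
qed

text \<open>The Riemannian length of the image of \<open>(1, b)\<close> under the differential of \<open>\<sigma>\<close> at \<open>(t, a)\<close>, that is,
  the speed of \<open>s \<mapsto> \<sigma> (s, \<tau> s)\<close> at \<open>t\<close> if \<open>\<tau> t = a\<close> and \<open>\<tau>' t = b\<close>.\<close>

definition length_density :: "(real \<times> real \<Rightarrow> 'm) \<Rightarrow> real \<times> real \<times> real \<Rightarrow> real" where
  "length_density \<sigma> = (\<lambda>(t, a, b). let c = chart_at (\<sigma> (t, a));
      \<xi> = frechet_derivative (coords c \<circ> \<sigma>) (at (t, a)) (1, b)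
    in sqrt (\<xi> \<bullet> (g c (coords c (\<sigma> (t, a))) *v \<xi>)))"

text \<open>The differential is injective since the inverse diffeomorphism is differentiable, too.\<close>

lemma diffeo_into_chart:
  assumes c: "c \<in> \<A>" and N: "\<sigma> ` N \<subseteq> chart_dom c" and d: "diffeo_between N V (coords c \<circ> \<sigma>) \<rho>" and z: "z \<in> N"
  shows "isCont \<sigma> z"
    and "((coords c \<circ> \<sigma>) has_derivative frechet_derivative (coords c \<circ> \<sigma>) (at z)) (at z)"
    and "v \<noteq> 0 \<Longrightarrow> frechet_derivative (coords c \<circ> \<sigma>) (at z) v \<noteq> 0"
proof -
  let ?f = "coords c \<circ> \<sigma>"
  have f: "open N" "open V" "homeomorphism N V ?f \<rho>" "smooth_on ?f N" "smooth_on \<rho> V"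
    using d by (auto simp: diffeo_between_def)
  have "continuous_on (coords c ` chart_dom c) (inv_into (chart_dom c) (coords c))"
    using chart_homeomorphism[OF c] by (simp add: homeomorphism_def)
  moreover have "continuous_on N ?f" using f(3) by (simp add: homeomorphism_def)
  moreover have "?f ` N \<subseteq> coords c ` chart_dom c" using N by auto
  ultimately have "continuous_on N (\<lambda>x. inv_into (chart_dom c) (coords c) (?f x))"
    by (rule continuous_on_compose2)
  moreover have "inv_into (chart_dom c) (coords c) (?f x) = \<sigma> x" if "x \<in> N" for x
    using inv_coords[OF c] that N by auto
  ultimately have "continuous_on N \<sigma>" by (rule continuous_on_eq)
  then show "isCont \<sigma> z" using f(1) z by (simp add: continuous_on_eq_continuous_at)
  show d1: "(?f has_derivative frechet_derivative ?f (at z)) (at z)"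
    by (rule smooth_on_differentiable[OF f(4) z])
  have fz: "?f z \<in> V" using f(3) z unfolding homeomorphism_def by blast
  have "((\<lambda>x. \<rho> (?f x)) has_derivative (\<lambda>v. frechet_derivative \<rho> (at (?f z)) (frechet_derivative ?f (at z) v))) (at z)"
    by (rule has_derivative_compose[OF d1 smooth_on_differentiable[OF f(5) fz]])
  then have "((\<lambda>x. x) has_derivative (\<lambda>v. frechet_derivative \<rho> (at (?f z)) (frechet_derivative ?f (at z) v))) (at z)"
    by (rule has_derivative_transform_within_open[OF _ f(1) z]) (use f(3) in \<open>auto simp: homeomorphism_def\<close>)
  then have "(\<lambda>v. frechet_derivative \<rho> (at (?f z)) (frechet_derivative ?f (at z) v)) = (\<lambda>v. v)"
    using has_derivative_unique[OF _ has_derivative_ident] by blast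
  moreover have "frechet_derivative \<rho> (at (?f z)) 0 = 0"
    using smooth_on_differentiable[OF f(5) fz] has_derivative_linear linear_0 by blast
  ultimately show "v \<noteq> 0 \<Longrightarrow> frechet_derivative ?f (at z) v \<noteq> 0" by (metis (no_types))
qed

lemma length_density_in_chart:
  fixes b :: real
  assumes c: "c \<in> \<A>" and N: "\<sigma> ` N \<subseteq> chart_dom c" and d: "diffeo_between N V (coords c \<circ> \<sigma>) \<rho>" and z: "(t, a) \<in> N"
  defines "\<xi> \<equiv> frechet_derivative (coords c \<circ> \<sigma>) (at (t, a)) (1, b)"
  shows "length_density \<sigma> (t, a, b) = sqrt (\<xi> \<bullet> (g c ((coords c \<circ> \<sigma>) (t, a)) *v \<xi>))"
    and "(coords (chart_at (\<sigma> (t, a))) \<circ> \<sigma>) differentiable at (t, a)"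
proof -
  let ?z = "(t, a)"
  let ?c = "chart_at (\<sigma> ?z)"
  let ?J = "frechet_derivative (transition c ?c) (at (coords c (\<sigma> ?z)))"
  have zc: "\<sigma> ?z \<in> chart_dom c" using N z by auto
  note D = diffeo_into_chart[OF c N d z]
  have "((coords ?c \<circ> \<sigma>) has_derivative (\<lambda>v. ?J (frechet_derivative (coords c \<circ> \<sigma>) (at ?z) v))) (at ?z)"
    by (rule change_coords_derivative[OF c chart_at(1) zc chart_at(2) D(1,2)])
  then have "frechet_derivative (coords ?c \<circ> \<sigma>) (at ?z) = (\<lambda>v. ?J (frechet_derivative (coords c \<circ> \<sigma>) (at ?z) v))"
    and diff: "(coords ?c \<circ> \<sigma>) differentiable at ?z"
    by (auto simp: differentiable_def frechet_derivative_at[symmetric])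
  then show "length_density \<sigma> (t, a, b) = sqrt (\<xi> \<bullet> (g c ((coords c \<circ> \<sigma>) ?z) *v \<xi>))"
    using gram_invariant[OF c chart_at(1) zc chart_at(2)] by (simp add: length_density_def \<xi>_def Let_def)
  show "(coords ?c \<circ> \<sigma>) differentiable at ?z" by (rule diff)
qed

text \<open>Near each point, invariance of the metric allows the density to be computed in one fixed chart. The
  vector \<open>(1, b)\<close> never vanishes and the differential of \<open>\<sigma>\<close> is injective, so the square root is only
  taken of positive numbers, where it is smooth.\<close>

lemma length_density_smooth:
  assumes \<sigma>: "local_diffeo_into \<A> (UNIV \<times> {-\<epsilon><..<\<epsilon>}) \<sigma>"
  shows "smooth_on (length_density \<sigma>) (tube \<epsilon>)"
  unfolding smooth_on_def
proof (intro allI Ck_on_local[OF open_tube])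
  fix n p0 assume "p0 \<in> tube \<epsilon>"
  then obtain t0 a0 b0 where p0: "p0 = (t0, a0, b0)" "(t0, a0) \<in> UNIV \<times> {-\<epsilon><..<\<epsilon>}"
    by (auto simp: tube_def)
  then obtain c N V \<rho> where c: "c \<in> \<A>" "(t0, a0) \<in> N" and N: "\<sigma> ` N \<subseteq> chart_dom c"
    and d: "diffeo_between N V (coords c \<circ> \<sigma>) \<rho>"
    using \<sigma> unfolding local_diffeo_into_def by meson
  let ?f = "coords c \<circ> \<sigma>"
  have f: "open N" "homeomorphism N V ?f \<rho>" "smooth_on ?f N" using d by (auto simp: diffeo_between_def)
  define \<pi> :: "real \<times> real \<times> real \<Rightarrow> real \<times> real" where "\<pi> = (\<lambda>p. (fst p, fst (snd p)))"
  define M where "M = \<pi> -` N"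
  have \<pi>: "bounded_linear \<pi>" unfolding \<pi>_def
    by (intro bounded_linear_Pair bounded_linear_fst bounded_linear_compose[OF bounded_linear_fst bounded_linear_snd])
  have \<beta>: "bounded_linear (\<lambda>p::real \<times> real \<times> real. snd (snd p))"
    by (intro bounded_linear_compose[OF bounded_linear_snd bounded_linear_snd])
  have "open M" unfolding M_def using f(1) linear_continuous_on[OF \<pi>] by (metis continuous_on_open_vimage open_UNIV Int_UNIV_right)
  have \<pi>M: "\<pi> ` M \<subseteq> N" by (auto simp: M_def)
  define \<xi> where "\<xi> = (\<lambda>p. frechet_derivative ?f (at (\<pi> p)) (1, 0) + snd (snd p) *\<^sub>R frechet_derivative ?f (at (\<pi> p)) (0, 1))"
  define q where "q = (\<lambda>p. \<xi> p \<bullet> (g c (?f (\<pi> p)) *v \<xi> p))"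
  have \<xi>_eq: "\<xi> p = frechet_derivative ?f (at (\<pi> p)) (1, snd (snd p))" if "p \<in> M" for p
  proof -
    have l: "linear (frechet_derivative ?f (at (\<pi> p)))"
      using diffeo_into_chart(2)[OF c(1) N d, of "\<pi> p"] that has_derivative_linear by (auto simp: M_def)
    have "(1, snd (snd p)) = (1, 0) + snd (snd p) *\<^sub>R (0::real, 1::real)" by simp
    then show ?thesis unfolding \<xi>_def by (simp only: linear_add[OF l] linear_cmul[OF l])
  qed
  have dens: "length_density \<sigma> p = sqrt (q p)" if "p \<in> M" for p
  proof -
    obtain t a b where p: "p = (t, a, b)" by (metis prod_cases3)
    then have "(t, a) \<in> N" using that by (simp add: M_def \<pi>_def)
    from length_density_in_chart(1)[OF c(1) N d this] show ?thesis
      using \<xi>_eq[OF that] by (simp add: q_def p \<pi>_def)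
  qed
  have q_pos: "q p > 0" if "p \<in> M" for p
  proof -
    have "\<pi> p \<in> N" using that by (simp add: M_def)
    then have "\<xi> p \<noteq> 0" using \<xi>_eq[OF that] diffeo_into_chart(3)[OF c(1) N d, of "\<pi> p"] by (simp add: zero_prod_def)
    moreover have "?f (\<pi> p) \<in> coords c ` chart_dom c" using \<open>\<pi> p \<in> N\<close> N by auto
    ultimately show ?thesis unfolding q_def by (intro metric_positive c)
  qed
  have fv: "Ck_on n (\<lambda>p. frechet_derivative ?f (at (\<pi> p)) v) M" for v
    by (rule Ck_on_compose[OF \<pi>M Ck_on_bounded_linear[OF \<pi>]])
      (use smooth_on_derivative[OF f(3,1), of v] in \<open>simp only: smooth_on_def\<close>)
  have \<xi>_Ck: "Ck_on n \<xi> M"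
    unfolding \<xi>_def
    by (intro Ck_on_add fv Ck_on_bilinear[OF bounded_bilinear_scaleR] Ck_on_bounded_linear[OF \<beta>])
  have f\<pi>_Ck: "Ck_on n (\<lambda>p. ?f (\<pi> p)) M"
    by (rule Ck_on_compose[OF \<pi>M Ck_on_bounded_linear[OF \<pi>]]) (use f(3) in \<open>simp only: smooth_on_def\<close>)
  have f\<pi>_sub: "(\<lambda>p. ?f (\<pi> p)) ` M \<subseteq> coords c ` chart_dom c"
  proof (rule image_subsetI)
    fix p assume "p \<in> M"
    then have "\<sigma> (\<pi> p) \<in> chart_dom c" using N \<pi>M by blast
    then show "?f (\<pi> p) \<in> coords c ` chart_dom c" by simp
  qed
  have "Ck_on n (g c) (coords c ` chart_dom c)"
    using metric_smooth[OF c(1)] by (simp add: smooth_on_def)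
  then have g_Ck: "Ck_on n (\<lambda>p. g c (?f (\<pi> p))) M"
    by (rule Ck_on_compose[OF f\<pi>_sub f\<pi>_Ck])
  have "bounded_bilinear (\<lambda>(A::real^2^2) x. A *v x)"
    unfolding bilinear_conv_bounded_bilinear[symmetric] bilinear_def
    by (auto intro!: linearI simp: matrix_vector_mult_add_rdistrib matrix_vector_right_distrib
        scaleR_matrix_vector_assoc matrix_vector_mult_scaleR)
  then have "Ck_on n (\<lambda>p. g c (?f (\<pi> p)) *v \<xi> p) M"
    using g_Ck \<xi>_Ck by (rule Ck_on_bilinear)
  then have "Ck_on n q M"
    unfolding q_def by (intro Ck_on_bilinear[OF bounded_bilinear_inner] \<xi>_Ck)
  then have "Ck_on n (\<lambda>p. sqrt (q p)) M"
    using q_pos by (intro Ck_on_compose[where g = sqrt, OF _ _ Ck_on_sqrt]) auto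
  then have "Ck_on n (length_density \<sigma>) M"
    by (rule Ck_on_cong[OF \<open>open M\<close>, rotated]) (simp add: dens)
  moreover have "p0 \<in> M" using p0 c(2) by (simp add: M_def \<pi>_def)
  ultimately show "\<exists>N. open N \<and> p0 \<in> N \<and> Ck_on n (length_density \<sigma>) N" using \<open>open M\<close> by blast
qed

lemma speed_chart_curve:
  assumes \<sigma>: "local_diffeo_into \<A> (UNIV \<times> {-\<epsilon><..<\<epsilon>}) \<sigma>"
    and \<tau>: "(\<tau> has_real_derivative \<tau>') (at t)" "\<bar>\<tau> t\<bar> < \<epsilon>"
  shows "speed \<A> g (chart_curve \<sigma> \<tau>) t = length_density \<sigma> (t, \<tau> t, \<tau>')"
proof -
  have "(t, \<tau> t) \<in> UNIV \<times> {-\<epsilon><..<\<epsilon>}" using \<tau>(2) by (auto simp: abs_less_iff minus_less_iff)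
  then obtain c N V \<rho> where c: "c \<in> \<A>" "(t, \<tau> t) \<in> N" "\<sigma> ` N \<subseteq> chart_dom c"
    "diffeo_between N V (coords c \<circ> \<sigma>) \<rho>"
    using \<sigma> unfolding local_diffeo_into_def by meson
  let ?c = "chart_at (\<sigma> (t, \<tau> t))"
  let ?F = "frechet_derivative (coords ?c \<circ> \<sigma>) (at (t, \<tau> t))"
  have F: "((coords ?c \<circ> \<sigma>) has_derivative ?F) (at (t, \<tau> t))"
    using length_density_in_chart(2)[OF c(1,3,4,2)] by (simp add: frechet_derivative_works)
  have "((\<lambda>s. (s, \<tau> s)) has_derivative (\<lambda>h. (h, \<tau>' * h))) (at t)"
    using \<tau>(1) by (auto intro!: has_derivative_Pair simp: has_field_derivative_def)
  then have "((\<lambda>s. (coords ?c \<circ> \<sigma>) (s, \<tau> s)) has_derivative (\<lambda>h. ?F (h, \<tau>' * h))) (at t)"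
    by (rule has_derivative_compose[where f = "\<lambda>s. (s, \<tau> s)" and g = "coords ?c \<circ> \<sigma>", OF _ F])
  moreover have "?F (h, \<tau>' * h) = h *\<^sub>R ?F (1, \<tau>')" for h
  proof -
    have "(h, \<tau>' * h) = h *\<^sub>R (1, \<tau>')" by simp
    then show ?thesis using linear_cmul[OF has_derivative_linear[OF F]] by metis
  qed
  ultimately have "((coords ?c \<circ> chart_curve \<sigma> \<tau>) has_vector_derivative ?F (1, \<tau>')) (at t)"
    by (simp add: has_vector_derivative_def chart_curve_def o_def)
  then have "vector_derivative (coords ?c \<circ> chart_curve \<sigma> \<tau>) (at t) = ?F (1, \<tau>')"
    by (rule vector_derivative_at)
  then show ?thesis
    by (simp add: speed_chart_at length_density_def Let_def chart_curve_def)
qed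

end


section \<open>Invariance of the length under reparametrization\<close>

lemma integral_periodic_unit:
  fixes h :: "real \<Rightarrow> real"
  assumes c: "continuous_on UNIV h" and p: "\<And>t. h (t + 1) = h t"
  shows "integral {x..x + 1} h = integral {0..1} h"
proof -
  define lo where "lo = min 0 x - 1"
  define \<Phi> where "\<Phi> = (\<lambda>y. integral {lo..y} h)"
  have hS: "continuous_on S h" for S using c continuous_on_subset by blast
  have \<Phi>: "(\<Phi> has_real_derivative h y) (at y)" if "y > lo" for y
  proof -
    have "(\<Phi> has_real_derivative h y) (at y within {lo..y + 1})"
      unfolding \<Phi>_def using that by (intro integral_has_real_derivative hS) auto
    then show ?thesis using that at_within_Icc_at[of lo y "y + 1"] by simp
  qed
  have "((\<lambda>y. \<Phi> (y + 1) - \<Phi> y) has_real_derivative 0) (at y within {lo<..})" if "y \<in> {lo<..}" for y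
  proof -
    have "((\<lambda>y. \<Phi> (y + 1)) has_real_derivative h (y + 1)) (at y)"
      using \<Phi>[of "y + 1"] that DERIV_shift[of \<Phi> "h (y + 1)" y 1] by simp
    then have "((\<lambda>y. \<Phi> (y + 1) - \<Phi> y) has_real_derivative h (y + 1) - h y) (at y)"
      using \<Phi>[of y] that by (intro DERIV_diff) auto
    then show ?thesis using p[of y] by (simp add: has_field_derivative_at_within)
  qed
  then obtain k where k: "\<And>y. y \<in> {lo<..} \<Longrightarrow> \<Phi> (y + 1) - \<Phi> y = k"
    using has_field_derivative_zero_constant[of "{lo<..}" "\<lambda>y. \<Phi> (y + 1) - \<Phi> y"] by auto
  have "integral {y..y + 1} h = \<Phi> (y + 1) - \<Phi> y" if "y > lo" for y
    using Henstock_Kurzweil_Integration.integral_combine[of lo y "y + 1" h] that integrable_continuous_real[OF hS]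
    unfolding \<Phi>_def by simp
  from this[of x] this[of 0] show ?thesis using k[of x] k[of 0] by (simp add: lo_def)
qed

context oriented_riemannian_surface
begin

lemma emb_loop_derivative:
  assumes "v \<in> emb_loops \<A> k" "c \<in> \<A>" "v t \<in> chart_dom c"
  obtains \<xi> where "\<xi> \<noteq> 0" "((coords c \<circ> v) has_vector_derivative \<xi>) (at t)"
  using assms unfolding emb_loops_def by blast

lemma speed_periodic:
  assumes v: "v \<in> emb_loops \<A> k"
  shows "speed \<A> g v (t + 1) = speed \<A> g v t"
proof -
  have per: "v (s + 1) = v s" for s using v by (simp add: emb_loops_def W_loops_def)
  let ?c = "chart_at (v t)"
  obtain \<xi> where \<xi>: "((coords ?c \<circ> v) has_vector_derivative \<xi>) (at t)"
    using emb_loop_derivative[OF v chart_at] by blast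
  have "((\<lambda>s::real. s - 1) has_vector_derivative 1) (at (t + 1))"
    by (auto intro!: derivative_eq_intros)
  then have "(((coords ?c \<circ> v) \<circ> (\<lambda>s. s - 1)) has_vector_derivative 1 *\<^sub>R \<xi>) (at (t + 1))"
    using \<xi> by (intro vector_diff_chain_at) auto
  moreover have "v (s - 1) = v s" for s using per[of "s - 1"] by simp
  ultimately have "((coords ?c \<circ> v) has_vector_derivative \<xi>) (at (t + 1))"
    by (simp add: o_def)
  then show ?thesis
    using \<xi> by (simp add: speed_chart_at per vector_derivative_at)
qed

text \<open>As \<open>v\<close> has a nonzero derivative at \<open>\<psi> t\<close>, a suitable scalar
  component of \<open>v\<close> can be inverted to first order, and the differentiability of \<open>v \<circ> \<psi>\<close> at \<open>t\<close> passes
  to \<open>\<psi>\<close>.\<close>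

lemma reparametrization_differentiable:
  assumes v: "v \<in> emb_loops \<A> k" and w: "v \<circ> \<psi> \<in> emb_loops \<A> k"
    and \<psi>: "inj \<psi>" "continuous_on UNIV \<psi>"
  shows "\<exists>\<psi>'. (\<psi> has_real_derivative \<psi>') (at t)"
proof -
  let ?c = "chart_at (v (\<psi> t))"
  let ?f = "coords ?c \<circ> v"
  obtain \<xi> where \<xi>: "\<xi> \<noteq> 0" "(?f has_vector_derivative \<xi>) (at (\<psi> t))"
    using emb_loop_derivative[OF v chart_at] by blast
  obtain \<zeta> where "((coords ?c \<circ> (v \<circ> \<psi>)) has_vector_derivative \<zeta>) (at t)"
    using emb_loop_derivative[OF w chart_at(1)[of "v (\<psi> t)"], of t] chart_at(2)[of "v (\<psi> t)"] by auto
  then have \<zeta>: "((?f \<circ> \<psi>) has_vector_derivative \<zeta>) (at t)" by (simp add: comp_assoc)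
  \<comment> \<open>The component in the direction of the derivative itself has derivative \<open>\<bar>\<xi>\<bar>\<^sup>2 \<noteq> 0\<close>.\<close>
  define F where "F = (\<lambda>s. \<xi> \<bullet> ?f s)"
  have inner: "((\<lambda>s. \<xi> \<bullet> h s) has_real_derivative \<xi> \<bullet> \<eta>) (at s)" if "(h has_vector_derivative \<eta>) (at s)"
    for h :: "real \<Rightarrow> real^2" and \<eta> s
    using bounded_linear.has_vector_derivative[OF bounded_linear_inner_right that, of \<xi>]
    by (simp add: has_real_derivative_iff_has_vector_derivative)
  have F: "(F has_real_derivative \<xi> \<bullet> \<xi>) (at (\<psi> t))" unfolding F_def by (rule inner[OF \<xi>(2)])
  have F\<psi>: "((\<lambda>s. F (\<psi> s)) has_real_derivative \<xi> \<bullet> \<zeta>) (at t)" using inner[OF \<zeta>] by (simp add: F_def)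
  obtain m where m: "\<And>z. F z - F (\<psi> t) = m z * (z - \<psi> t)" "isCont m (\<psi> t)" "m (\<psi> t) = \<xi> \<bullet> \<xi>"
    using F unfolding CARAT_DERIV by blast
  have "isCont \<psi> t" using \<psi>(2) by (simp add: continuous_on_eq_continuous_at)
  from isCont_o2[OF this m(2)] have mlim: "(\<lambda>s. m (\<psi> s)) \<midarrow>t\<rightarrow> \<xi> \<bullet> \<xi>" using m(3) by (simp add: isCont_def)
  have "((\<lambda>s. (F (\<psi> s) - F (\<psi> t)) / (s - t)) \<longlongrightarrow> \<xi> \<bullet> \<zeta>) (at t)"
    using F\<psi> by (simp add: has_field_derivative_iff)
  then have "((\<lambda>s. (F (\<psi> s) - F (\<psi> t)) / (s - t) / m (\<psi> s)) \<longlongrightarrow> (\<xi> \<bullet> \<zeta>) / (\<xi> \<bullet> \<xi>)) (at t)"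
    using \<xi>(1) by (intro tendsto_divide mlim) auto
  moreover have "\<forall>\<^sub>F s in at t. m (\<psi> s) \<noteq> 0"
    using tendsto_imp_eventually_ne[OF mlim, of 0] \<xi>(1) by simp
  then have "\<forall>\<^sub>F s in at t. (F (\<psi> s) - F (\<psi> t)) / (s - t) / m (\<psi> s) = (\<psi> s - \<psi> t) / (s - t)"
    by eventually_elim (simp add: m(1))
  ultimately have "((\<lambda>s. (\<psi> s - \<psi> t) / (s - t)) \<longlongrightarrow> (\<xi> \<bullet> \<zeta>) / (\<xi> \<bullet> \<xi>)) (at t)"
    using tendsto_cong by fast
  then show ?thesis by (auto simp: has_field_derivative_iff)
qed

lemma speed_reparametrization:
  assumes v: "v \<in> emb_loops \<A> k" and \<psi>: "(\<psi> has_real_derivative \<psi>') (at t)"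
  shows "speed \<A> g (v \<circ> \<psi>) t = \<bar>\<psi>'\<bar> * speed \<A> g v (\<psi> t)"
proof -
  let ?c = "chart_at (v (\<psi> t))"
  obtain \<xi> where \<xi>: "((coords ?c \<circ> v) has_vector_derivative \<xi>) (at (\<psi> t))"
    using emb_loop_derivative[OF v chart_at] by blast
  then have "((coords ?c \<circ> v \<circ> \<psi>) has_vector_derivative \<psi>' *\<^sub>R \<xi>) (at t)"
    using \<psi> by (intro vector_diff_chain_at) (auto simp: has_real_derivative_iff_has_vector_derivative)
  then have "vector_derivative (coords ?c \<circ> (v \<circ> \<psi>)) (at t) = \<psi>' *\<^sub>R \<xi>"
    by (simp add: comp_assoc vector_derivative_at)
  moreover have "vector_derivative (coords ?c \<circ> v) (at (\<psi> t)) = \<xi>" using \<xi> by (rule vector_derivative_at)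
  ultimately show ?thesis
    by (simp add: speed_chart_at Let_def matrix_vector_mult_scaleR real_sqrt_mult power2_eq_square[symmetric] mult.assoc[symmetric])
qed

text \<open>Change of variables maps one period to one period, possibly with reversed orientation; the length
  of a period of the periodic speed does not depend on where it starts.\<close>

lemma loop_length_reparametrization:
  assumes v: "v \<in> emb_loops \<A> k" and w: "v \<circ> \<psi> \<in> emb_loops \<A> k" and \<psi>: "\<psi> \<in> circle_diffeos k"
    and cont: "continuous_on UNIV (speed \<A> g v)"
  shows "loop_length \<A> g (v \<circ> \<psi>) = loop_length \<A> g v"
proof -
  let ?s = "speed \<A> g v"
  have \<psi>_props: "inj \<psi>" "continuous_on UNIV \<psi>" using \<psi> by (auto simp: circle_diffeos_def bij_def)
  define \<psi>' where "\<psi>' = (\<lambda>t. SOME y. (\<psi> has_real_derivative y) (at t))"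
  have \<psi>': "(\<psi> has_real_derivative \<psi>' t) (at t)" for t
    unfolding \<psi>'_def by (rule someI_ex[OF reparametrization_differentiable[OF v w \<psi>_props]])
  have "\<psi> ` closed_segment 0 1 = closed_segment (\<psi> 0) (\<psi> 1)"
    using \<psi>_props by (intro continuous_injective_image_segment_1) (auto intro: continuous_on_subset inj_on_subset)
  moreover have "\<psi> 1 = \<psi> 0 + 1 \<or> \<psi> 1 = \<psi> 0 - 1"
    using \<psi> unfolding circle_diffeos_def by (metis (mono_tags, lifting) add_0 mem_Collect_eq)
  ultimately obtain x where x: "\<psi> ` {0..1} = {x..x + 1}"
    by (auto simp: closed_segment_eq_real_ivl split: if_splits)
  have s_abs: "?s absolutely_integrable_on {x..x + 1}"
    using cont continuous_on_subset absolutely_integrable_continuous_real by blast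
  have "integral {0..1} (\<lambda>t. \<bar>\<psi>' t\<bar> * ?s (\<psi> t)) = integral (\<psi> ` {0..1}) ?s"
    using has_absolute_integral_change_of_variables_1'[of "{0..1}" \<psi> \<psi>' ?s "integral (\<psi> ` {0..1}) ?s"]
      \<psi>' \<psi>_props(1) s_abs x by (auto intro: has_field_derivative_at_within inj_on_subset)
  also have "\<dots> = integral {0..1} ?s"
    unfolding x by (rule integral_periodic_unit[OF cont speed_periodic[OF v]])
  also have "(\<lambda>t. \<bar>\<psi>' t\<bar> * ?s (\<psi> t)) = speed \<A> g (v \<circ> \<psi>)"
    using speed_reparametrization[OF v \<psi>'] by (intro ext) simp
  finally show ?thesis unfolding loop_length_def .
qed

end

section \<open>The length functional in a chart\<close>

lemma id_circle_diffeo: "id \<in> circle_diffeos 2"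
proof -
  have "id \<in> sobolev_loc 2" using id_sobolev by (auto simp: sobolev_loc_def id_def)
  then show ?thesis by (simp add: circle_diffeos_def)
qed

lemma periodic_abs_bounded:
  fixes \<tau> :: "real \<Rightarrow> real"
  assumes "continuous_on UNIV \<tau>" "\<And>t. \<tau> (t + 1) = \<tau> t"
  shows "bdd_above (range (\<lambda>t. \<bar>\<tau> t\<bar>))"
proof -
  interpret periodic_fun_simple' \<tau> by unfold_locales (rule assms(2))
  have "continuous_on {0..1} \<tau>" using assms(1) continuous_on_subset by blast
  then obtain B where B: "\<And>t. t \<in> {0..1} \<Longrightarrow> \<bar>\<tau> t\<bar> \<le> B"
    using continuous_unit_interval_bounded by blast
  have "\<bar>\<tau> t\<bar> \<le> B" for t
  proof -
    have "\<tau> t = \<tau> (frac t)" using minus_of_int[of t "\<lfloor>t\<rfloor>"] by (simp add: frac_def)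
    then show ?thesis using B[of "frac t"] frac_lt_1[of t] by (simp add: less_imp_le)
  qed
  then show ?thesis by (intro bdd_aboveI[of _ B]) auto
qed

context oriented_riemannian_surface
begin

text \<open>In a chart the length functional is an integral functional of first order. By invariance under
  reparametrization it may be computed on the representative \<open>t \<mapsto> \<sigma> (t, \<tau> t)\<close> of the class.\<close>

lemma length_functional_in_chart:
  assumes chart: "sc_chart \<A> \<sigma> \<epsilon> U" and \<tau>: "\<tau> \<in> U"
  shows "\<tau> \<in> C1" "\<bar>\<tau> t\<bar> < \<epsilon>"
    and "length_functional \<A> g (chart_map \<A> \<sigma> \<tau>) = integral {0..1} (\<lambda>t. length_density \<sigma> (t, \<tau> t, deriv \<tau> t))"
proof -
  have \<sigma>: "local_diffeo_into \<A> (UNIV \<times> {-\<epsilon><..<\<epsilon>}) \<sigma>" using chart by (simp add: sc_chart_def)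
  have "Pt \<tau> \<in> level model_space 0" using chart \<tau> by (auto simp: sc_chart_def sc_open_def)
  then have W: "\<tau> \<in> W_circle (0 + 2)" by (auto simp: model_space_def)
  show C1: "\<tau> \<in> C1" by (rule W_circle_C1[OF W])
  have sup: "(SUP t. \<bar>\<tau> t\<bar>) < \<epsilon>" and emb: "chart_curve \<sigma> \<tau> \<in> emb_loops \<A> 2"
    using chart \<tau> by (auto simp: sc_chart_def)
  have "bdd_above (range (\<lambda>t. \<bar>\<tau> t\<bar>))" using W by (intro periodic_abs_bounded) (auto simp: W_circle_def)
  then have small: "\<bar>\<tau> t\<bar> < \<epsilon>" for t using sup cSUP_upper[of t UNIV "\<lambda>t. \<bar>\<tau> t\<bar>"] by force
  then show "\<bar>\<tau> t\<bar> < \<epsilon>" .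
  let ?v = "chart_curve \<sigma> \<tau>"
  have speed: "speed \<A> g ?v = (\<lambda>t. length_density \<sigma> (t, \<tau> t, deriv \<tau> t))"
    using speed_chart_curve[OF \<sigma> C1_D(1)[OF C1] small] by blast
  have "continuous_on (tube \<epsilon>) (length_density \<sigma>)"
    using length_density_smooth[OF \<sigma>] Ck_on_imp_continuous_on by (auto simp: smooth_on_def)
  then have cont: "continuous_on UNIV (speed \<A> g ?v)"
    unfolding speed
    by (rule continuous_on_compose2) (use small C1_D[OF C1] in
        \<open>auto intro!: continuous_intros simp: tube_def abs_less_iff minus_less_iff\<close>)
  \<comment> \<open>The class consists of reparametrizations of this curve, and it contains the curve itself.\<close>
  have "loop_length \<A> g w = loop_length \<A> g ?v" if "w \<in> chart_map \<A> \<sigma> \<tau>" for w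
    using that loop_length_reparametrization[OF emb _ _ cont] by (auto simp: chart_map_def reparam_rel_def)
  moreover have "?v \<in> chart_map \<A> \<sigma> \<tau>"
    using emb id_circle_diffeo by (auto simp: chart_map_def reparam_rel_def intro!: bexI[of _ id])
  ultimately have "loop_length \<A> g ` chart_map \<A> \<sigma> \<tau> = {loop_length \<A> g ?v}" by blast
  then show "length_functional \<A> g (chart_map \<A> \<sigma> \<tau>) = integral {0..1} (\<lambda>t. length_density \<sigma> (t, \<tau> t, deriv \<tau> t))"
    by (simp add: length_functional_def loop_length_def speed)
qed

end

theorem lemma3p6:
  fixes \<A> :: "'m::{t2_space, second_countable_topology} chart set"
    and g :: "'m chart \<Rightarrow> real^2 \<Rightarrow> real^2^2"
  assumes "oriented_riemannian_surface \<A> g"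
  shows "sc_smooth_on_loops \<A> (length_functional \<A> g)"
  unfolding sc_smooth_on_loops_def sc_smooth_on_def
proof (intro allI impI)
  fix \<sigma> :: "real \<times> real \<Rightarrow> 'm" and \<epsilon> :: real and U :: "(real \<Rightarrow> real) set" and k
  assume chart: "sc_chart \<A> \<sigma> \<epsilon> U"
  interpret oriented_riemannian_surface \<A> g by fact
  let ?F = "\<lambda>z. Pt (integral {0..1} (\<lambda>t. length_density \<sigma> (t, root_fun 0 z t, deriv (root_fun 0 z) t)))"
  have "smooth_on (length_density \<sigma>) (tube \<epsilon>)"
    using chart by (intro length_density_smooth) (simp add: sc_chart_def)
  then have "integral_map \<epsilon> 0 0 ?F" by (intro int_Pt nem_kernel)
  moreover have "Pt ` U \<subseteq> small_towers \<epsilon> 0"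
    using length_functional_in_chart(1,2)[OF chart] by (auto simp: small_towers_def)
  ultimately have "sc_on k (model_tower 0) (real_tower 0) (Pt ` U) ?F" by (rule integral_map_sc_on)
  then have "sc_on k model_space real_space (Pt ` U) ?F" by simp
  then show "sc_on k model_space real_space (Pt ` U) (\<lambda>z. Pt (length_functional \<A> g (chart_map \<A> \<sigma> (pt z))))"
    by (rule sc_on_cong[rotated]) (use length_functional_in_chart(3)[OF chart] in auto)
qed

end
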